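(* Let $F\in H^{-3/2}(\Gamma_1)$ with $F\notin C^\infty(\Gamma_1)$. Then the equation $$\mathcal{A}u^0=F$$ has no solution $u^0$ in $\mathcal{D}'(\Gamma_1)$, where $\mathcal{A}=\mathcal{R}_0^*P^*P\mathcal{R}_0$.
   Context: Greek indices range over $\{1,2\}$; repeated indices are summed. $\Omega\subset\mathbb{R}^2$ is a connected bounded open set with $C^\infty$ boundary $\Gamma=\Gamma_0\cup\Gamma_1$, where $\Gamma_0,\Gamma_1$ are disjoint compact smooth one-dimensional manifolds without boundary. A $C^\infty$ surface is given by $\varphi:\overline\Omega\to\mathbb{R}^3$ with linearly independent tangent vectors $a_\alpha=\partial_\alpha\varphi$, unit normal $a_3$, second fundamental form $b_{\alpha\beta}=a_3\cdot\partial_\beta a_\alpha$ and Christoffel symbols $\Gamma^\lambda_{\alpha\beta}=a^\lambda\cdot\partial_\alpha a_\beta$ (with $a^i$ the dual basis); it is elliptic: $b_{11}b_{22}-b_{12}^2>0$ uniformly, $b_{11}>0$. Put $\gamma_{\alpha\beta}(u)=\frac12(\partial_\beta u_\alpha+\partial_\alpha u_\beta)-\Gamma^\lambda_{\alpha\beta}u_\lambda-b_{\alpha\beta}u_3$. Near the boundary the coordinates are chosen so that on the boundary the frame $(a_1,a_2,a_3)$ is orthonormal, with $u_1$ the tangential component and $u_2$ the component normal to the boundary in the tangent plane. The operator $\mathcal{R}_0$: for $w\in C^\infty(\Gamma_1)$, let $\tilde w=(\tilde w_1,\tilde w_2,\tilde w_3)$ solve the elliptic boundary value problem $\gamma_{\alpha\beta}(\tilde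 w)=0$ in $\Omega$, $\tilde w_2=0$ on $\Gamma_0$, $\tilde w_3=w$ on $\Gamma_1$ (solved up to a finite-dimensional space of functions smooth on $\overline\Omega$ and up to finitely many compatibility conditions, which are understood to be factored out); then $\mathcal{R}_0w=\tilde w_3|_{\Gamma_0}$. The operator $\mathcal{R}_0$ extends continuously to $\mathcal{R}_0\in\mathcal{L}(H^s(\Gamma_1),H^r(\Gamma_0))$ for all $s,r\in\mathbb{R}$ (this extension is still denoted $\mathcal{R}_0$), and its adjoint satisfies $\mathcal{R}_0^*\in\mathcal{L}(H^{-r}(\Gamma_0),H^{-s}(\Gamma_1))$ for all $s,r\in\mathbb{R}$. The operator $P$ is an elliptic pseudo-differential operator of order $1/2$ on $\Gamma_0$ with principal symbol $\theta(1+|\xi_1|^2)^{1/4}$, where $\theta$ is a nonvanishing function determined by the coefficients of the problem; $P$ is an isomorphism from $H^s(\Gamma_0)$ onto $H^{s-1/2}(\Gamma_0)$ for every $s\in\mathbb{R}$, and $P^*$ is its adjoint. Since $\Gamma_1$ is compact, $\mathcal{D}'(\Gamma_1)=\bigcup_{s\in\mathbb{R}}H^s(\Gamma_1)$, and $\mathcal{A}$ is defined on all of $\mathcal{D}'(\Gamma_1)$ through these continuous extensions. *)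

theory Defs
  imports "HOL-Analysis.Analysis"
begin

section \<open>Smooth functions\<close>

primrec Ck_on :: "nat \<Rightarrow> 'a::real_normed_vector set \<Rightarrow> ('a \<Rightarrow> 'b::real_normed_vector) \<Rightarrow> bool" where
  "Ck_on 0 U f \<longleftrightarrow> continuous_on U f"
| "Ck_on (Suc k) U f \<longleftrightarrow>
     (\<forall>x\<in>U. f differentiable (at x)) \<and> (\<forall>v. Ck_on k U (\<lambda>x. frechet_derivative f (at x) v))"

text \<open>Only meant for open \<open>U\<close>.\<close>
definition smooth_on :: "'a::real_normed_vector set \<Rightarrow> ('a \<Rightarrow> 'b::real_normed_vector) \<Rightarrow> bool" where
  "smooth_on U f \<longleftrightarrow> (\<forall>k. Ck_on k U f)"

text \<open>\<open>C\<^sup>\<infinity>\<close> up to the boundary: \<open>f\<close> is smooth on some open neighbourhood of the closure of \<open>\<Omega>\<close>. For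
  a domain with smooth boundary every function all of whose derivatives extend continuously to the
  closure has such an extension; only values and derivatives on the closure are used below.\<close>
definition smooth_upto :: "'a::real_normed_vector set \<Rightarrow> ('a \<Rightarrow> 'b::real_normed_vector) \<Rightarrow> bool" where
  "smooth_upto \<Omega> f \<longleftrightarrow> (\<exists>U. open U \<and> closure \<Omega> \<subseteq> U \<and> smooth_on U f)"

text \<open>Smooth boundary: locally \<open>\<Omega>\<close> is a strict sublevel set of a smooth function without critical
  points.\<close>
definition smooth_boundary :: "(real^2) set \<Rightarrow> bool" where
  "smooth_boundary \<Omega> \<longleftrightarrow>
     (\<forall>p\<in>frontier \<Omega>. \<exists>U (\<rho> :: real^2 \<Rightarrow> real). open U \<and> p \<in> U \<and> smooth_on U \<rho> \<and>
        (\<forall>x\<in>U. \<exists>v. frechet_derivative \<rho> (at x) v \<noteq> 0) \<and> \<Omega> \<inter> U = {x \<in> U. \<rho> x < 0})"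

definition Cc_inf :: "real set \<Rightarrow> (real \<Rightarrow> complex) set" where
  "Cc_inf J = {\<psi>. smooth_on UNIV \<psi> \<and> (\<exists>K. compact K \<and> K \<subseteq> J \<and> (\<forall>t. t \<notin> K \<longrightarrow> \<psi> t = 0))}"


section \<open>One-dimensional submanifolds of the plane\<close>

text \<open>A chart is a smooth regular parametrization \<open>c\<close> of a relatively open subset of \<open>\<Gamma>\<close> by an open
  set \<open>J\<close> of reals. \<open>J\<close> need not be connected; this matters for pseudo-differential operators, where
  the off-diagonal smoothness of the kernel is read off in disconnected charts.\<close>
type_synonym chart = "(real \<Rightarrow> real^2) \<times> real set"

definition charts :: "(real^2) set \<Rightarrow> chart set" where
  "charts \<Gamma> = {(c, J). open J \<and> smooth_on J c \<and> (\<forall>t\<in>J. vector_derivative c (at t) \<noteq> 0) \<and>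
      homeomorphism J (c ` J) c (inv_into J c) \<and> openin (top_of_set \<Gamma>) (c ` J)}"

definition smooth_curve_manifold :: "(real^2) set \<Rightarrow> bool" where
  "smooth_curve_manifold \<Gamma> \<longleftrightarrow> (\<forall>p\<in>\<Gamma>. \<exists>(c, J)\<in>charts \<Gamma>. p \<in> c ` J)"

text \<open>\<open>C\<^sup>\<infinity>(\<Gamma>)\<close>; its elements are normalized to vanish off \<open>\<Gamma>\<close>.\<close>
definition Cinf :: "(real^2) set \<Rightarrow> (real^2 \<Rightarrow> complex) set" where
  "Cinf \<Gamma> = {f. (\<forall>(c, J)\<in>charts \<Gamma>. smooth_on J (\<lambda>t. f (c t))) \<and> (\<forall>x. x \<notin> \<Gamma> \<longrightarrow> f x = 0)}"

definition push :: "chart \<Rightarrow> (real \<Rightarrow> complex) \<Rightarrow> real^2 \<Rightarrow> complex" where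
  "push = (\<lambda>(c, J) \<psi> x. if x \<in> c ` J then \<psi> (inv_into J c x) else 0)"


section \<open>Distributions\<close>

type_synonym dist = "(real^2 \<Rightarrow> complex) \<Rightarrow> complex"

text \<open>\<open>D'(\<Gamma>)\<close> for compact \<open>\<Gamma>\<close>: linear functionals on \<open>C\<^sup>\<infinity>(\<Gamma>)\<close> (normalized to vanish on functions
  outside \<open>C\<^sup>\<infinity>(\<Gamma>)\<close>), continuous for the seminorms
  \<open>sup {\<bar>(f \<circ> c)\<^sup>(\<^sup>j\<^sup>)(t)\<bar> | j \<le> n, t \<in> K}\<close>, \<open>K \<subseteq> J\<close> compact. The bound \<open>B\<close> replaces the maximum
  of finitely many of these suprema.\<close>
definition distributions :: "(real^2) set \<Rightarrow> dist set" where
  "distributions \<Gamma> = {u.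
      (\<forall>f\<in>Cinf \<Gamma>. \<forall>g\<in>Cinf \<Gamma>. u (\<lambda>x. f x + g x) = u f + u g) \<and>
      (\<forall>k. \<forall>f\<in>Cinf \<Gamma>. u (\<lambda>x. k * f x) = k * u f) \<and>
      (\<forall>f. f \<notin> Cinf \<Gamma> \<longrightarrow> u f = 0) \<and>
      (\<exists>S n C. finite S \<and> (\<forall>((c, J), K)\<in>S. (c, J) \<in> charts \<Gamma> \<and> compact K \<and> K \<subseteq> J) \<and>
        (\<forall>f\<in>Cinf \<Gamma>. \<forall>B\<ge>0.
           (\<forall>((c, J), K)\<in>S. \<forall>j\<le>n. \<forall>t\<in>K.
              cmod (((\<lambda>h s. vector_derivative h (at s)) ^^ j) (\<lambda>s. f (c s)) t) \<le> B)
           \<longrightarrow> cmod (u f) \<le> C * B))}"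

text \<open>A line element \<open>L x v\<close> is the length of the vector \<open>v\<close> at the point \<open>x\<close>. It fixes the measure
  \<open>ds\<close> on \<open>\<Gamma>\<close> by which functions are identified with distributions, \<open>f \<mapsto> (h \<mapsto> \<integral> f h ds)\<close>.\<close>
type_synonym line_element = "real^2 \<Rightarrow> real^2 \<Rightarrow> real"

definition speed :: "line_element \<Rightarrow> chart \<Rightarrow> real \<Rightarrow> real" where
  "speed L = (\<lambda>(c, J) t. L (c t) (vector_derivative c (at t)))"

text \<open>The distribution \<open>u \<circ> c\<close> on \<open>J\<close>. Since \<open>ds = speed dt\<close>, the division by the speed makes this
  the composition with \<open>c\<close> when \<open>u\<close> is a function.\<close>
definition pull :: "line_element \<Rightarrow> chart \<Rightarrow> dist \<Rightarrow> (real \<Rightarrow> complex) \<Rightarrow> complex" where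
  "pull L \<kappa> u \<psi> = u (push \<kappa> (\<lambda>t. \<psi> t / complex_of_real (speed L \<kappa> t)))"

text \<open>The distribution \<open>h \<mapsto> \<integral> f h ds\<close>, the integral over \<open>\<Gamma>\<close> being characterized by its values on
  functions supported in charts.\<close>
definition dist_of :: "line_element \<Rightarrow> (real^2) set \<Rightarrow> (real^2 \<Rightarrow> complex) \<Rightarrow> dist" where
  "dist_of L \<Gamma> f = (THE u. u \<in> distributions \<Gamma> \<and>
      (\<forall>(c, J)\<in>charts \<Gamma>. \<forall>\<psi>\<in>Cc_inf J. pull L (c, J) u \<psi> = (LINT t|lborel. f (c t) * \<psi> t)))"


section \<open>Sobolev spaces\<close>

definition local_fourier ::
  "line_element \<Rightarrow> chart \<Rightarrow> (real \<Rightarrow> complex) \<Rightarrow> dist \<Rightarrow> real \<Rightarrow> complex" where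
  "local_fourier L \<kappa> \<eta> u \<xi> = pull L \<kappa> u (\<lambda>t. \<eta> t * cis (- (\<xi> * t)))"

definition sobolev :: "line_element \<Rightarrow> (real^2) set \<Rightarrow> real \<Rightarrow> dist set" where
  "sobolev L \<Gamma> s = {u \<in> distributions \<Gamma>. \<forall>(c, J)\<in>charts \<Gamma>. \<forall>\<eta>\<in>Cc_inf J.
      integrable lborel (\<lambda>\<xi>. (1 + \<xi>\<^sup>2) powr s * (cmod (local_fourier L (c, J) \<eta> u \<xi>))\<^sup>2)}"

text \<open>The \<open>H\<^sup>s(\<real>)\<close> norm of \<open>\<eta> (u \<circ> c)\<close>. For compact \<open>\<Gamma>\<close> finitely many of these seminorms, taken
  from a partition of unity, give the norm of \<open>H\<^sup>s(\<Gamma>)\<close> up to equivalence.\<close>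
definition sobolev_seminorm ::
  "line_element \<Rightarrow> real \<Rightarrow> chart \<Rightarrow> (real \<Rightarrow> complex) \<Rightarrow> dist \<Rightarrow> real" where
  "sobolev_seminorm L s \<kappa> \<eta> u =
     sqrt (LINT \<xi>|lborel. (1 + \<xi>\<^sup>2) powr s * (cmod (local_fourier L \<kappa> \<eta> u \<xi>))\<^sup>2)"

text \<open>\<open>T \<in> \<L>(H\<^sup>s(\<Gamma>), H\<^sup>r(\<Gamma>'))\<close>\<close>
definition bounded_op ::
  "line_element \<Rightarrow> (real^2) set \<Rightarrow> real \<Rightarrow> (real^2) set \<Rightarrow> real \<Rightarrow> (dist \<Rightarrow> dist) \<Rightarrow> bool" where
  "bounded_op L \<Gamma> s \<Gamma>' r T \<longleftrightarrow>
     (\<forall>u\<in>sobolev L \<Gamma> s. T u \<in> sobolev L \<Gamma>' r) \<and>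
     (\<forall>u\<in>sobolev L \<Gamma> s. \<forall>v\<in>sobolev L \<Gamma> s. T (\<lambda>h. u h + v h) = (\<lambda>h. T u h + T v h)) \<and>
     (\<forall>k. \<forall>u\<in>sobolev L \<Gamma> s. T (\<lambda>h. k * u h) = (\<lambda>h. k * T u h)) \<and>
     (\<forall>(c, J)\<in>charts \<Gamma>'. \<forall>\<eta>\<in>Cc_inf J. \<exists>S C. finite S \<and>
        (\<forall>((c', J'), \<eta>')\<in>S. (c', J') \<in> charts \<Gamma> \<and> \<eta>' \<in> Cc_inf J') \<and>
        (\<forall>u\<in>sobolev L \<Gamma> s.
           sobolev_seminorm L r (c, J) \<eta> (T u)
             \<le> C * (\<Sum>(\<kappa>', \<eta>')\<in>S. sobolev_seminorm L s \<kappa>' \<eta>' u)))"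

text \<open>Action on smooth functions of an operator \<open>T\<close> from \<open>D'(\<Gamma>)\<close> to \<open>D'(\<Gamma>')\<close> that preserves smoothness.\<close>
definition smooth_action ::
  "line_element \<Rightarrow> (real^2) set \<Rightarrow> (real^2) set \<Rightarrow> (dist \<Rightarrow> dist) \<Rightarrow> (real^2 \<Rightarrow> complex) \<Rightarrow> real^2 \<Rightarrow> complex"
  where
  "smooth_action L \<Gamma> \<Gamma>' T f = (THE g. g \<in> Cinf \<Gamma>' \<and> dist_of L \<Gamma>' g = T (dist_of L \<Gamma> f))"

text \<open>The adjoint with respect to the sesquilinear \<open>L\<^sup>2\<close> pairing \<open>(v, g) = \<integral> v g\<^bold>- ds\<close>, which for a
  distribution \<open>v\<close> is \<open>v\<close> applied to the conjugate of \<open>g\<close>. The equation \<open>(T\<^sup>* v, w) = (v, T w)\<close> for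
  smooth \<open>w\<close>, read with \<open>h\<close> the conjugate of \<open>w\<close>, is the formula below.\<close>
definition adjoint_op ::
  "line_element \<Rightarrow> (real^2) set \<Rightarrow> (real^2) set \<Rightarrow> (dist \<Rightarrow> dist) \<Rightarrow> dist \<Rightarrow> dist" where
  "adjoint_op L \<Gamma> \<Gamma>' T v =
     (\<lambda>h. if h \<in> Cinf \<Gamma> then v (\<lambda>y. cnj (smooth_action L \<Gamma> \<Gamma>' T (\<lambda>x. cnj (h x)) y)) else 0)"


section \<open>Pseudo-differential operators\<close>

definition symbol_class :: "real \<Rightarrow> (real \<times> real \<Rightarrow> complex) set" where
  "symbol_class m = {a. smooth_on UNIV a \<and>
     (\<forall>i j. \<exists>C. \<forall>t \<tau>.
        cmod (((\<lambda>b z. frechet_derivative b (at z) (1, 0)) ^^ i)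
              (((\<lambda>b z. frechet_derivative b (at z) (0, 1)) ^^ j) a) (t, \<tau>))
          \<le> C * (1 + \<bar>\<tau>\<bar>) powr (m - real j))}"

definition Op :: "(real \<times> real \<Rightarrow> complex) \<Rightarrow> (real \<Rightarrow> complex) \<Rightarrow> real \<Rightarrow> complex" where
  "Op a f t = (1 / (2 * of_real pi)) *
     (LINT \<tau>|lborel. cis (t * \<tau>) * a (t, \<tau>) * (LINT s|lborel. cis (- (s * \<tau>)) * f s))"

text \<open>\<open>P\<close> is a pseudo-differential operator of order \<open>m\<close> on \<open>\<Gamma>\<close> whose principal symbol at the
  covector \<open>\<xi>\<close> over \<open>x\<close> is \<open>p x \<bar>\<xi>\<bar>\<close>, the length being the one dual to \<open>L\<close>. In a chart the covector
  \<open>\<tau> dt\<close> has length \<open>\<bar>\<tau>\<bar> / speed\<close>; in an arc length coordinate this is \<open>\<bar>\<tau>\<bar>\<close>.\<close>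
definition pseudo_diff_op ::
  "line_element \<Rightarrow> (real^2) set \<Rightarrow> real \<Rightarrow> (real^2 \<Rightarrow> real \<Rightarrow> complex) \<Rightarrow> (dist \<Rightarrow> dist) \<Rightarrow> bool" where
  "pseudo_diff_op L \<Gamma> m p P \<longleftrightarrow>
     (\<forall>f\<in>Cinf \<Gamma>. P (dist_of L \<Gamma> f) \<in> dist_of L \<Gamma> ` Cinf \<Gamma>) \<and>
     (\<forall>(c, J)\<in>charts \<Gamma>. \<forall>\<eta>\<in>Cc_inf J. \<forall>\<psi>\<in>Cc_inf J. \<exists>a\<in>symbol_class m.
        (\<forall>f\<in>Cc_inf UNIV. \<forall>t.
           \<eta> t * smooth_action L \<Gamma> \<Gamma> P (push (c, J) (\<lambda>s. \<psi> s * f s)) (c t) = Op a f t) \<and>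
        (\<lambda>(t, \<tau>). a (t, \<tau>) - \<eta> t * \<psi> t * p (c t) (\<bar>\<tau>\<bar> / speed L (c, J) t)) \<in> symbol_class (m - 1))"

definition elliptic_symbol :: "(real^2) set \<Rightarrow> real \<Rightarrow> (real^2 \<Rightarrow> real \<Rightarrow> complex) \<Rightarrow> bool" where
  "elliptic_symbol \<Gamma> m p \<longleftrightarrow>
     (\<exists>C>0. \<exists>R>0. \<forall>x\<in>\<Gamma>. \<forall>r\<ge>R. C * r powr m \<le> cmod (p x r))"


section \<open>Geometry of the surface\<close>

definition partial :: "2 \<Rightarrow> (real^2 \<Rightarrow> 'b::real_normed_vector) \<Rightarrow> real^2 \<Rightarrow> 'b" where
  "partial \<alpha> f x = frechet_derivative f (at x) (axis \<alpha> 1)"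

definition tangent :: "(real^2 \<Rightarrow> real^3) \<Rightarrow> 2 \<Rightarrow> real^2 \<Rightarrow> real^3" where
  "tangent \<phi> \<alpha> = partial \<alpha> \<phi>"

definition unit_normal :: "(real^2 \<Rightarrow> real^3) \<Rightarrow> real^2 \<Rightarrow> real^3" where
  "unit_normal \<phi> x = sgn (cross3 (tangent \<phi> 1 x) (tangent \<phi> 2 x))"

text \<open>The vectors \<open>a\<^sup>1, a\<^sup>2\<close> of the basis dual to \<open>a\<^sub>1, a\<^sub>2, a\<^sub>3\<close>.\<close>
definition dual_tangent :: "(real^2 \<Rightarrow> real^3) \<Rightarrow> 2 \<Rightarrow> real^2 \<Rightarrow> real^3" where
  "dual_tangent \<phi> \<alpha> x = (THE v. (\<forall>\<beta>. v \<bullet> tangent \<phi> \<beta> x = (if \<beta> = \<alpha> then 1 else 0)) \<and>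
     v \<bullet> unit_normal \<phi> x = 0)"

definition second_form :: "(real^2 \<Rightarrow> real^3) \<Rightarrow> 2 \<Rightarrow> 2 \<Rightarrow> real^2 \<Rightarrow> real" where
  "second_form \<phi> \<alpha> \<beta> x = unit_normal \<phi> x \<bullet> partial \<beta> (tangent \<phi> \<alpha>) x"

definition christoffel :: "(real^2 \<Rightarrow> real^3) \<Rightarrow> 2 \<Rightarrow> 2 \<Rightarrow> 2 \<Rightarrow> real^2 \<Rightarrow> real" where
  "christoffel \<phi> \<mu> \<alpha> \<beta> x = dual_tangent \<phi> \<mu> x \<bullet> partial \<alpha> (tangent \<phi> \<beta>) x"

definition regular_surface :: "(real^2) set \<Rightarrow> (real^2 \<Rightarrow> real^3) \<Rightarrow> bool" where
  "regular_surface \<Omega> \<phi> \<longleftrightarrow> smooth_upto \<Omega> \<phi> \<and>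
     (\<forall>x\<in>closure \<Omega>. \<forall>r s. r *\<^sub>R tangent \<phi> 1 x + s *\<^sub>R tangent \<phi> 2 x = 0 \<longrightarrow> r = 0 \<and> s = 0)"

definition elliptic_surface :: "(real^2) set \<Rightarrow> (real^2 \<Rightarrow> real^3) \<Rightarrow> bool" where
  "elliptic_surface \<Omega> \<phi> \<longleftrightarrow>
     (\<exists>k>0. \<forall>x\<in>closure \<Omega>.
        second_form \<phi> 1 1 x * second_form \<phi> 2 2 x - (second_form \<phi> 1 2 x)\<^sup>2 \<ge> k) \<and>
     (\<forall>x\<in>closure \<Omega>. second_form \<phi> 1 1 x > 0)"

text \<open>Length on the surface. It is the length in the local coordinates adapted to the boundary, in
  which the frame is orthonormal on the boundary.\<close>
definition surface_length :: "(real^2 \<Rightarrow> real^3) \<Rightarrow> line_element" where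
  "surface_length \<phi> x v = norm (frechet_derivative \<phi> (at x) v)"


section \<open>The boundary value problem and the operator \<open>\<R>\<^sub>0\<close>\<close>

text \<open>A displacement is given by its covariant components: \<open>u\<close> for the two tangential ones, \<open>u3\<close> for
  the normal one. Scalars are complex, the geometric coefficients real.\<close>
definition membrane_strain ::
  "(real^2 \<Rightarrow> real^3) \<Rightarrow> (real^2 \<Rightarrow> complex^2) \<Rightarrow> (real^2 \<Rightarrow> complex) \<Rightarrow> 2 \<Rightarrow> 2 \<Rightarrow> real^2 \<Rightarrow> complex" where
  "membrane_strain \<phi> u u3 \<alpha> \<beta> x =
     (partial \<beta> (\<lambda>y. u y $ \<alpha>) x + partial \<alpha> (\<lambda>y. u y $ \<beta>) x) / 2
     - (\<Sum>\<mu>\<in>UNIV. complex_of_real (christoffel \<phi> \<mu> \<alpha> \<beta> x) * u x $ \<mu>)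
     - complex_of_real (second_form \<phi> \<alpha> \<beta> x) * u3 x"

text \<open>In local coordinates adapted to the boundary, the component \<open>u\<^sub>2\<close> is the component along the
  conormal (tangent to the surface, orthogonal to the boundary curve). In the global coordinates of
  \<open>\<Omega>\<close> a vector \<open>\<nu> = \<nu>\<^sup>\<alpha> a\<^sub>\<alpha>\<close> is conormal iff it is orthogonal on the surface to the tangent
  of the boundary curve, and the component of \<open>u\<close> along it is \<open>u\<^sub>\<alpha> \<nu>\<^sup>\<alpha>\<close>.\<close>
definition conormal_component_zero ::
  "(real^2 \<Rightarrow> real^3) \<Rightarrow> (real^2) set \<Rightarrow> (real^2 \<Rightarrow> complex^2) \<Rightarrow> bool" where
  "conormal_component_zero \<phi> \<Gamma> u \<longleftrightarrow>
     (\<forall>(c, J)\<in>charts \<Gamma>. \<forall>t\<in>J. \<forall>\<nu>.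
        frechet_derivative \<phi> (at (c t)) \<nu> \<bullet>
          frechet_derivative \<phi> (at (c t)) (vector_derivative c (at t)) = 0 \<longrightarrow>
        (\<Sum>\<alpha>\<in>UNIV. u (c t) $ \<alpha> * complex_of_real (\<nu> $ \<alpha>)) = 0)"

definition bvp_solution ::
  "(real^2) set \<Rightarrow> (real^2) set \<Rightarrow> (real^2) set \<Rightarrow> (real^2 \<Rightarrow> real^3) \<Rightarrow> (real^2 \<Rightarrow> complex) \<Rightarrow>
   (real^2 \<Rightarrow> complex^2) \<Rightarrow> (real^2 \<Rightarrow> complex) \<Rightarrow> bool" where
  "bvp_solution \<Omega> \<Gamma>0 \<Gamma>1 \<phi> w u u3 \<longleftrightarrow>
     smooth_upto \<Omega> u \<and> smooth_upto \<Omega> u3 \<and>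
     (\<forall>\<alpha> \<beta>. \<forall>x\<in>\<Omega>. membrane_strain \<phi> u u3 \<alpha> \<beta> x = 0) \<and>
     conormal_component_zero \<phi> \<Gamma>0 u \<and>
     (\<forall>x\<in>\<Gamma>1. u3 x = w x)"

text \<open>The homogeneous problem has a finite-dimensional solution space, the data \<open>w\<close> for which the
  problem is solvable are those satisfying finitely many linear conditions, and for these \<open>R0\<close> maps
  \<open>w\<close> to the trace on \<open>\<Gamma>0\<close> of the normal component of some solution. On a complement of the
  admissible data, and in the choice of a solution, \<open>R0\<close> is left arbitrary.\<close>
definition R0_operator ::
  "(real^2) set \<Rightarrow> (real^2) set \<Rightarrow> (real^2) set \<Rightarrow> (real^2 \<Rightarrow> real^3) \<Rightarrow> (dist \<Rightarrow> dist) \<Rightarrow> bool" where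
  "R0_operator \<Omega> \<Gamma>0 \<Gamma>1 \<phi> R0 \<longleftrightarrow>
     (\<exists>(n::nat) e e3.
        (\<forall>i<n. bvp_solution \<Omega> \<Gamma>0 \<Gamma>1 \<phi> (\<lambda>_. 0) (e i) (e3 i)) \<and>
        (\<forall>u u3. bvp_solution \<Omega> \<Gamma>0 \<Gamma>1 \<phi> (\<lambda>_. 0) u u3 \<longrightarrow>
           (\<exists>k. \<forall>x\<in>closure \<Omega>. u x = (\<Sum>i<n. k i *s e i x) \<and> u3 x = (\<Sum>i<n. k i * e3 i x)))) \<and>
     (\<exists>S. finite S \<and> S \<subseteq> distributions \<Gamma>1 \<and>
        (\<forall>w\<in>Cinf \<Gamma>1. (\<exists>u u3. bvp_solution \<Omega> \<Gamma>0 \<Gamma>1 \<phi> w u u3) \<longleftrightarrow> (\<forall>l\<in>S. l w = 0))) \<and>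
     (\<forall>w\<in>Cinf \<Gamma>1. (\<exists>u u3. bvp_solution \<Omega> \<Gamma>0 \<Gamma>1 \<phi> w u u3) \<longrightarrow>
        (\<exists>u u3. bvp_solution \<Omega> \<Gamma>0 \<Gamma>1 \<phi> w u u3 \<and>
           R0 (dist_of (surface_length \<phi>) \<Gamma>1 w)
             = dist_of (surface_length \<phi>) \<Gamma>0 (\<lambda>x. if x \<in> \<Gamma>0 then u3 x else 0)))"

definition P_symbol :: "(real^2 \<Rightarrow> complex) \<Rightarrow> real^2 \<Rightarrow> real \<Rightarrow> complex" where
  "P_symbol \<theta> x r = \<theta> x * complex_of_real ((1 + r\<^sup>2) powr (1/4))"

definition A_operator ::
  "line_element \<Rightarrow> (real^2) set \<Rightarrow> (real^2) set \<Rightarrow> (dist \<Rightarrow> dist) \<Rightarrow> (dist \<Rightarrow> dist) \<Rightarrow> dist \<Rightarrow> dist" where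
  "A_operator L \<Gamma>0 \<Gamma>1 R0 P = adjoint_op L \<Gamma>1 \<Gamma>0 R0 \<circ> adjoint_op L \<Gamma>0 \<Gamma>0 P \<circ> P \<circ> R0"

end

theory Submission
  imports Defs "HOL-Probability.Probability"
begin

text \<open>
  The operator \<open>R0\<close> maps every Sobolev space of \<open>\<Gamma>1\<close> into all Sobolev spaces of \<open>\<Gamma>0\<close>, and its adjoint
  maps every Sobolev space of \<open>\<Gamma>0\<close> into all Sobolev spaces of \<open>\<Gamma>1\<close>. Hence every value of the operator
  \<open>R0* P* P R0\<close> is a smooth function, whereas \<open>F\<close> is not smooth.

  In detail, a distribution \<open>u0\<close> on a compact curve has finite order and therefore lies in some
  Sobolev space (\<open>distribution_in_sobolev\<close>). So \<open>R0 u0\<close>, and with it \<open>P (R0 u0)\<close>, lies in all Sobolev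
  spaces of \<open>\<Gamma>0\<close>, and a distribution that lies in all Sobolev spaces is a smooth function
  (\<open>sobolev_smooth\<close>). The adjoint of \<open>P\<close> maps this function to a distribution
  (\<open>adjoint_of_smooth_distribution\<close>), which again lies in some Sobolev space; the adjoint of \<open>R0\<close> maps it
  into all Sobolev spaces of \<open>\<Gamma>1\<close>, and the value is smooth by \<open>sobolev_smooth\<close>.

  That the adjoint of \<open>P\<close> yields a distribution is a continuity property of the action of \<open>P\<close> on smooth
  functions. It holds from \<open>C\<^sup>4\<close> to \<open>C\<^sup>0\<close>: four derivatives bound the Sobolev norm of order \<open>3/2\<close>, \<open>P\<close> is
  bounded from that order to order \<open>1\<close>, and the norm of \<open>H\<^sup>1\<close> bounds the supremum. This suffices because the
  distribution to which the adjoint is applied is a smooth function.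

  The statements about Sobolev spaces are reduced by charts and cutoffs to functionals of finite
  order on the line. Such a functional \<open>V\<close> has a Fourier transform \<open>V (exp (- i \<xi> t))\<close> of polynomial
  growth. If the transform decreases rapidly, then \<open>V\<close> is a smooth function: write a test function by
  Fourier inversion, apply \<open>V\<close> under the integral sign (\<open>finite_order_moment_transform\<close>) and exchange the
  integrations (\<open>finite_order_representation\<close>). The smooth functions obtained in charts are glued by a
  partition of unity. The gluing rests on the smoothness of the transition maps between charts
  (\<open>smooth_transition\<close>) and on the fact that charts induce the same measure on their overlap
  (\<open>chart_change\<close>). The same fact gives the existence of the distribution defined by a smooth function,
  and Fourier inversion shows that this distribution determines the function (\<open>dist_of_inj\<close>).
\<close>

section \<open>Calculus of smooth functions\<close>

text \<open>Derivatives of a \<open>C\<^sup>k\<close> function are taken at points of an open set, so they only depend on the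
  values of the function there. All closure properties below are proved by the same induction: a
  derivative of the new function is an expression of the same kind in the old functions and their
  derivatives.\<close>

lemma Ck_on_cong:
  assumes "open U" "\<And>x. x \<in> U \<Longrightarrow> f x = g x" "Ck_on k U f"
  shows "Ck_on k U (g :: 'a::real_normed_vector \<Rightarrow> 'b::real_normed_vector)"
  using assms(2,3)
proof (induction k arbitrary: f g)
  case 0
  then show ?case by (auto cong: continuous_on_cong)
next
  case (Suc k)
  have der: "(g has_derivative frechet_derivative f (at x)) (at x)" if "x \<in> U" for x
  proof -
    have "(f has_derivative frechet_derivative f (at x)) (at x)"
      using Suc.prems(2) that by (simp add: frechet_derivative_works)
    then show ?thesis
      by (rule has_derivative_transform_within_open[OF _ \<open>open U\<close> that]) (use Suc.prems in auto)
  qed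
  have "frechet_derivative f (at x) v = frechet_derivative g (at x) v" if "x \<in> U" for x v
    using frechet_derivative_at[OF der[OF that]] by simp
  moreover have "Ck_on k U (\<lambda>x. frechet_derivative f (at x) v)" for v
    using Suc.prems(2) by simp
  ultimately have "Ck_on k U (\<lambda>x. frechet_derivative g (at x) v)" for v
    by (rule Suc.IH)
  then show ?case using der by (auto simp: differentiable_def)
qed

lemma Ck_on_SucI:
  assumes "open U" "\<And>x. x \<in> U \<Longrightarrow> (f has_derivative f' x) (at x)"
    and "\<And>v. Ck_on k U (\<lambda>x. f' x v)"
  shows "Ck_on (Suc k) U f"
proof -
  have "f' x v = frechet_derivative f (at x) v" if "x \<in> U" for x v
    using frechet_derivative_at[OF assms(2)[OF that]] by simp
  then have "Ck_on k U (\<lambda>x. frechet_derivative f (at x) v)" for v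
    by (rule Ck_on_cong[OF assms(1) _ assms(3)])
  then show ?thesis using assms(2) by (auto simp: differentiable_def)
qed

lemma Ck_on_Suc_has_derivative:
  "Ck_on (Suc k) U f \<Longrightarrow> x \<in> U \<Longrightarrow> (f has_derivative frechet_derivative f (at x)) (at x)"
  by (simp add: frechet_derivative_works)

lemma Ck_on_Suc_imp: "Ck_on (Suc k) U f \<Longrightarrow> Ck_on k U f"
proof (induction k arbitrary: f)
  case 0
  then show ?case
    by (auto intro!: continuous_at_imp_continuous_on differentiable_imp_continuous_within)
next
  case (Suc k)
  then show ?case by (metis Ck_on.simps(2))
qed

lemma Ck_on_subset: "Ck_on k U f \<Longrightarrow> V \<subseteq> U \<Longrightarrow> Ck_on k V f"
  by (induction k arbitrary: f) (auto intro: continuous_on_subset)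

lemma Ck_on_local:
  assumes "\<And>x. x \<in> U \<Longrightarrow> \<exists>V. open V \<and> x \<in> V \<and> Ck_on k V f"
  shows "Ck_on k U f"
  using assms
proof (induction k arbitrary: f)
  case 0
  have "continuous (at x) f" if "x \<in> U" for x
    using 0[OF that] continuous_on_eq_continuous_at by auto
  then show ?case by (simp add: continuous_at_imp_continuous_on)
next
  case (Suc k)
  have "\<exists>V. open V \<and> x \<in> V \<and> Ck_on k V (\<lambda>x. frechet_derivative f (at x) v)" if "x \<in> U" for x v
    using Suc.prems[OF that] by auto
  moreover have "f differentiable at x" if "x \<in> U" for x
    using Suc.prems[OF that] by auto
  ultimately show ?case using Suc.IH by (simp)
qed

lemma Ck_on_const: "Ck_on k U (\<lambda>_. a)"
  by (induction k arbitrary: a) (auto simp: frechet_derivative_const)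

lemma Ck_on_linear:
  assumes "open U" "bounded_linear T" "Ck_on k U f"
  shows "Ck_on k U (\<lambda>x. T (f x))"
  using assms(3)
proof (induction k arbitrary: f)
  case 0
  then show ?case using bounded_linear.continuous_on[OF assms(2)] by auto
next
  case (Suc k)
  show ?case
  proof (rule Ck_on_SucI[OF assms(1)])
    show "((\<lambda>x. T (f x)) has_derivative (\<lambda>v. T (frechet_derivative f (at x) v))) (at x)" if "x \<in> U" for x
      by (rule bounded_linear.has_derivative[OF assms(2) Ck_on_Suc_has_derivative[OF Suc.prems that]])
    show "Ck_on k U (\<lambda>x. T (frechet_derivative f (at x) v))" for v
      using Suc by auto
  qed
qed

lemma Ck_on_add:
  assumes "open U" "Ck_on k U f" "Ck_on k U g"
  shows "Ck_on k U (\<lambda>x. f x + g x)"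
  using assms(2,3)
proof (induction k arbitrary: f g)
  case 0
  then show ?case by (auto intro: continuous_on_add)
next
  case (Suc k)
  show ?case
  proof (rule Ck_on_SucI[OF assms(1)])
    show "((\<lambda>x. f x + g x) has_derivative
        (\<lambda>v. frechet_derivative f (at x) v + frechet_derivative g (at x) v)) (at x)" if "x \<in> U" for x
      by (intro has_derivative_add Ck_on_Suc_has_derivative[OF Suc.prems(1) that]
          Ck_on_Suc_has_derivative[OF Suc.prems(2) that])
  qed (use Suc in auto)
qed

lemma (in bounded_bilinear) Ck_on_bilinear:
  assumes "open U" "Ck_on k U f" "Ck_on k U g"
  shows "Ck_on k U (\<lambda>x. prod (f x) (g x))"
  using assms(2,3)
proof (induction k arbitrary: f g)
  case 0
  then show ?case by (auto intro: continuous_on)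
next
  case (Suc k)
  show ?case
  proof (rule Ck_on_SucI[OF assms(1)])
    show "((\<lambda>x. prod (f x) (g x)) has_derivative
        (\<lambda>v. prod (f x) (frechet_derivative g (at x) v) + prod (frechet_derivative f (at x) v) (g x))) (at x)"
      if "x \<in> U" for x
      by (intro FDERIV Ck_on_Suc_has_derivative[OF Suc.prems(1) that]
          Ck_on_Suc_has_derivative[OF Suc.prems(2) that])
    show "Ck_on k U (\<lambda>x. prod (f x) (frechet_derivative g (at x) v) + prod (frechet_derivative f (at x) v) (g x))" for v
      using Suc.prems Ck_on_Suc_imp[OF Suc.prems(1)] Ck_on_Suc_imp[OF Suc.prems(2)]
      by (intro Ck_on_add assms(1) Suc.IH) auto
  qed
qed

lemma Ck_on_sum:
  assumes "open U" "\<And>i. i \<in> I \<Longrightarrow> Ck_on k U (f i)"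
  shows "Ck_on k U (\<lambda>x. \<Sum>i\<in>I. f i x)"
  using assms(2)
  by (induction I rule: infinite_finite_induct) (auto intro: Ck_on_const Ck_on_add[OF assms(1)])

text \<open>The induction needs the derivative \<open>v \<mapsto> f'(g x) (g' x v)\<close> for a fixed direction \<open>v\<close> as a product of
  functions of \<open>x\<close>; expanding \<open>g' x v\<close> in a basis achieves this.\<close>

lemma Ck_on_compose:
  fixes f :: "'b::euclidean_space \<Rightarrow> 'c::real_normed_vector" and g :: "'a::real_normed_vector \<Rightarrow> 'b"
  assumes "open U" "Ck_on k V f" "Ck_on k U g" "\<And>x. x \<in> U \<Longrightarrow> g x \<in> V"
  shows "Ck_on k U (\<lambda>x. f (g x))"
  using assms(2,3)
proof (induction k arbitrary: f)
  case 0
  then show ?case using assms(4) by (auto intro: continuous_on_compose2[of V f])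
next
  case (Suc k)
  let ?f' = "\<lambda>y. frechet_derivative f (at y)" and ?g' = "\<lambda>x. frechet_derivative g (at x)"
  show ?case
  proof (rule Ck_on_SucI[OF assms(1)])
    fix x assume x: "x \<in> U"
    have "(f has_derivative ?f' (g x)) (at (g x))"
      using Ck_on_Suc_has_derivative[OF Suc.prems(1) assms(4)[OF x]] .
    moreover have "(g has_derivative ?g' x) (at x)"
      using Ck_on_Suc_has_derivative[OF Suc.prems(2) x] .
    ultimately have "((\<lambda>x. f (g x)) has_derivative (\<lambda>v. ?f' (g x) (?g' x v))) (at x)"
      using has_derivative_compose[of g "?g' x" x UNIV f "?f' (g x)"] by simp
    moreover have "?f' (g x) (?g' x v) = (\<Sum>b\<in>Basis. (?g' x v \<bullet> b) *\<^sub>R ?f' (g x) b)" for v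
    proof -
      have "linear (?f' (g x))"
        using \<open>(f has_derivative ?f' (g x)) (at (g x))\<close> has_derivative_linear by blast
      then have "?f' (g x) (\<Sum>b\<in>Basis. (?g' x v \<bullet> b) *\<^sub>R b) = (\<Sum>b\<in>Basis. (?g' x v \<bullet> b) *\<^sub>R ?f' (g x) b)"
        by (simp add: linear_sum linear_cmul)
      then show ?thesis by (simp add: euclidean_representation)
    qed
    ultimately show "((\<lambda>x. f (g x)) has_derivative
        (\<lambda>v. \<Sum>b\<in>Basis. (?g' x v \<bullet> b) *\<^sub>R ?f' (g x) b)) (at x)" by simp
  next
    fix v
    show "Ck_on k U (\<lambda>x. \<Sum>b\<in>Basis. (?g' x v \<bullet> b) *\<^sub>R ?f' (g x) b)"
    proof (intro Ck_on_sum assms(1) bounded_bilinear.Ck_on_bilinear[OF bounded_bilinear_scaleR])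
      fix b :: 'b
      show "Ck_on k U (\<lambda>x. ?g' x v \<bullet> b)"
        by (rule Ck_on_linear[OF assms(1) bounded_linear_inner_left]) (use Suc.prems(2) in auto)
      show "Ck_on k U (\<lambda>x. ?f' (g x) b)"
        using Suc.IH[of "\<lambda>y. ?f' y b"] Suc.prems Ck_on_Suc_imp by auto
    qed
  qed
qed

lemma smooth_on_cong:
  assumes "smooth_on U f" "open U" "\<And>x. x \<in> U \<Longrightarrow> f x = g x"
  shows "smooth_on U g"
  using assms(1) unfolding smooth_on_def by (auto intro: Ck_on_cong[OF assms(2,3)])

lemma smooth_on_subset: "smooth_on U f \<Longrightarrow> V \<subseteq> U \<Longrightarrow> smooth_on V f"
  unfolding smooth_on_def by (auto intro: Ck_on_subset)

lemma smooth_on_local: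
  assumes "\<And>x. x \<in> U \<Longrightarrow> \<exists>V. open V \<and> x \<in> V \<and> smooth_on V f"
  shows "smooth_on U f"
  unfolding smooth_on_def
proof (intro allI Ck_on_local)
  fix k x assume "x \<in> U"
  then show "\<exists>V. open V \<and> x \<in> V \<and> Ck_on k V f" using assms[of x] by (auto simp: smooth_on_def)
qed

lemma smooth_on_const [simp]: "smooth_on U (\<lambda>_. a)"
  by (simp add: smooth_on_def Ck_on_const)

lemma smooth_on_linear: "smooth_on U f \<Longrightarrow> open U \<Longrightarrow> bounded_linear T \<Longrightarrow> smooth_on U (\<lambda>x. T (f x))"
  by (simp add: smooth_on_def Ck_on_linear)

lemma smooth_on_add: "smooth_on U f \<Longrightarrow> smooth_on U g \<Longrightarrow> open U \<Longrightarrow> smooth_on U (\<lambda>x. f x + g x)"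
  by (simp add: smooth_on_def Ck_on_add)

lemma smooth_on_sum:
  "(\<And>i. i \<in> I \<Longrightarrow> smooth_on U (f i)) \<Longrightarrow> open U \<Longrightarrow> smooth_on U (\<lambda>x. \<Sum>i\<in>I. f i x)"
  by (simp add: smooth_on_def Ck_on_sum)

lemma smooth_on_mult:
  "smooth_on U f \<Longrightarrow> smooth_on U g \<Longrightarrow> open U \<Longrightarrow> smooth_on U (\<lambda>x. f x * g x :: 'a::real_normed_algebra)"
  by (simp add: smooth_on_def bounded_bilinear.Ck_on_bilinear[OF bounded_bilinear_mult])

lemma smooth_on_compose:
  fixes f :: "'b::euclidean_space \<Rightarrow> 'c::real_normed_vector" and g :: "'a::real_normed_vector \<Rightarrow> 'b"
  assumes "smooth_on V f" "smooth_on U g" "open U" "\<And>x. x \<in> U \<Longrightarrow> g x \<in> V"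
  shows "smooth_on U (\<lambda>x. f (g x))"
  using assms(1,2) unfolding smooth_on_def by (auto intro: Ck_on_compose[OF assms(3) _ _ assms(4)])

lemma smooth_on_continuous: "smooth_on U f \<Longrightarrow> continuous_on U f"
  unfolding smooth_on_def by (metis Ck_on.simps(1))

lemma smooth_on_differentiable: "smooth_on U f \<Longrightarrow> x \<in> U \<Longrightarrow> f differentiable at x"
  unfolding smooth_on_def by (metis Ck_on.simps(2))

lemma smooth_on_frechet: "smooth_on U f \<Longrightarrow> smooth_on U (\<lambda>x. frechet_derivative f (at x) v)"
  unfolding smooth_on_def by (metis Ck_on.simps(2))

text \<open>The derivative of a function of one real variable, whose iterates occur in the seminorms that
  define distributions.\<close>

abbreviation (input) vderiv :: "(real \<Rightarrow> 'a::real_normed_vector) \<Rightarrow> real \<Rightarrow> 'a" where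
  "vderiv \<equiv> \<lambda>h s. vector_derivative h (at s)"

lemma Ck_on_SucI_real:
  assumes "open J" "\<And>t. t \<in> J \<Longrightarrow> (f has_vector_derivative f' t) (at t)" "Ck_on k J f'"
  shows "Ck_on (Suc k) J f"
  using assms
  by (intro Ck_on_SucI[where f' = "\<lambda>t v. v *\<^sub>R f' t"])
    (auto simp: has_vector_derivative_def intro: Ck_on_linear bounded_linear_scaleR_right)

lemma smooth_on_realI:
  assumes "open J" "\<And>t. t \<in> J \<Longrightarrow> (f has_vector_derivative f' t) (at t)" "smooth_on J f'"
  shows "smooth_on J f"
  unfolding smooth_on_def
proof
  fix k show "Ck_on k J f"
    by (rule Ck_on_Suc_imp, rule Ck_on_SucI_real[OF assms(1,2)]) (use assms(3) smooth_on_def in auto)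
qed

text \<open>The natural way to prove smoothness of functions that are defined by a limit process: a
  sequence in which every function has the next one as its derivative consists of smooth functions.\<close>

lemma smooth_on_sequenceI:
  assumes "open J" "\<And>j t. t \<in> J \<Longrightarrow> (f j has_vector_derivative f (Suc j) t) (at t)"
  shows "smooth_on J (f j)"
proof -
  have "Ck_on k J (f j)" for k
  proof (induction k arbitrary: j)
    case 0
    show ?case
      using assms(2) by (auto intro!: continuous_at_imp_continuous_on has_vector_derivative_continuous)
  next
    case (Suc k)
    show ?case by (rule Ck_on_SucI_real[OF assms(1)]) (use assms(2) Suc in auto)
  qed
  then show ?thesis by (simp add: smooth_on_def)
qed

lemma smooth_on_has_vderiv:
  "smooth_on J f \<Longrightarrow> t \<in> J \<Longrightarrow> (f has_vector_derivative vderiv f t) (at t)"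
  using smooth_on_differentiable vector_derivative_works by blast

lemma smooth_on_vderiv:
  assumes "smooth_on J f" "open J" shows "smooth_on J (vderiv f)"
proof (rule smooth_on_cong[OF smooth_on_frechet[OF assms(1), of 1] assms(2)])
  fix t assume "t \<in> J"
  then show "frechet_derivative f (at t) 1 = vderiv f t"
    using frechet_derivative_eq_vector_derivative[OF smooth_on_differentiable[OF assms(1)]] by simp
qed

lemma smooth_on_vderiv_pow:
  assumes "smooth_on J f" "open J" shows "smooth_on J ((vderiv ^^ j) f)"
  using assms by (induction j) (auto intro: smooth_on_vderiv)

lemma vderiv_cong:
  assumes "open J" "\<And>t. t \<in> J \<Longrightarrow> f t = g t" "t \<in> J"
  shows "vderiv f t = vderiv g t"
proof -
  have "(f has_vector_derivative d) (at t) \<longleftrightarrow> (g has_vector_derivative d) (at t)" for d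
    using assms has_vector_derivative_transform_within_open[of f d t J g]
      has_vector_derivative_transform_within_open[of g d t J f] by auto
  then show ?thesis by (simp add: vector_derivative_def)
qed

lemma vderiv_pow_cong:
  assumes "open J" "\<And>t. t \<in> J \<Longrightarrow> f t = g t" "t \<in> J"
  shows "(vderiv ^^ j) f t = (vderiv ^^ j) g t"
  using assms(3)
proof (induction j arbitrary: t)
  case (Suc j)
  then show ?case using vderiv_cong[OF assms(1) Suc.IH Suc.prems] by simp
qed (simp add: assms)

lemma vderiv_pow_add:
  assumes "smooth_on J f" "smooth_on J g" "open J" "t \<in> J"
  shows "(vderiv ^^ j) (\<lambda>t. f t + g t) t = (vderiv ^^ j) f t + (vderiv ^^ j) g t"
  using assms(4)
proof (induction j arbitrary: t)
  case (Suc j)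
  let ?f = "(vderiv ^^ j) f" and ?g = "(vderiv ^^ j) g"
  have "((\<lambda>t. ?f t + ?g t) has_vector_derivative (vderiv ?f t + vderiv ?g t)) (at t)"
    by (intro has_vector_derivative_add smooth_on_has_vderiv[OF smooth_on_vderiv_pow, of J] assms Suc.prems)
  then show ?case
    using vderiv_cong[OF assms(3) Suc.IH Suc.prems] by (simp add: vector_derivative_at)
qed simp

lemma vderiv_pow_linear:
  assumes "smooth_on J f" "open J" "t \<in> J" "bounded_linear T"
  shows "(vderiv ^^ j) (\<lambda>t. T (f t)) t = T ((vderiv ^^ j) f t)"
  using assms(3)
proof (induction j arbitrary: t)
  case (Suc j)
  let ?f = "(vderiv ^^ j) f"
  have "((\<lambda>t. T (?f t)) has_vector_derivative (T (vderiv ?f t))) (at t)"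
    by (intro bounded_linear.has_vector_derivative[OF assms(4)]
        smooth_on_has_vderiv[OF smooth_on_vderiv_pow, of J] assms Suc.prems)
  then show ?case
    using vderiv_cong[OF assms(2) Suc.IH Suc.prems] by (simp add: vector_derivative_at)
qed simp

lemma vderiv_pow_sequence:
  assumes "open J" "\<And>j t. t \<in> J \<Longrightarrow> (f j has_vector_derivative f (Suc j) t) (at t)" "t \<in> J"
  shows "(vderiv ^^ j) (f 0) t = f j t"
  using assms(3)
proof (induction j arbitrary: t)
  case (Suc j)
  then show ?case
    using vderiv_cong[OF assms(1) Suc.IH Suc.prems] vector_derivative_at[OF assms(2)] by simp
qed simp

lemma smooth_on_ident: "open J \<Longrightarrow> smooth_on J (\<lambda>t. t :: real)"
  by (rule smooth_on_realI[where f' = "\<lambda>_. 1"]) auto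

lemma smooth_on_cis:
  fixes a :: real
  shows "smooth_on UNIV (\<lambda>t. cis (a * t))"
proof -
  have "smooth_on UNIV ((\<lambda>j t. (\<i> * a) ^ j * cis (a * t)) 0)"
    by (rule smooth_on_sequenceI)
      (auto simp: cis_conv_exp intro!: derivative_eq_intros has_vector_derivative_real_field)
  then show ?thesis by simp
qed

lemma Ck_on_inverse: "Ck_on k {t::real. t \<noteq> 0} inverse"
proof (induction k)
  case 0
  then show ?case by (auto intro: continuous_on_inverse continuous_on_id)
next
  case (Suc k)
  have o: "open {t::real. t \<noteq> 0}" by (simp add: open_Collect_neq)
  show ?case
  proof (rule Ck_on_SucI_real[OF o])
    show "(inverse has_vector_derivative - (inverse t * inverse t)) (at t)" if "t \<in> {t. t \<noteq> 0}" for t :: real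
      using that by (auto simp: has_real_derivative_iff_has_vector_derivative[symmetric] intro!: derivative_eq_intros)
    show "Ck_on k {t::real. t \<noteq> 0} (\<lambda>t. - (inverse t * inverse t))"
      by (intro Ck_on_linear[OF o bounded_linear_minus[OF bounded_linear_ident]]
          bounded_bilinear.Ck_on_bilinear[OF bounded_bilinear_mult] Suc o)
  qed
qed

lemma smooth_on_inverse:
  fixes f :: "'a::real_normed_vector \<Rightarrow> real"
  assumes "smooth_on U f" "open U" "\<And>x. x \<in> U \<Longrightarrow> f x \<noteq> 0"
  shows "smooth_on U (\<lambda>x. inverse (f x))"
  by (rule smooth_on_compose[of "{t. t \<noteq> 0}"]) (use assms in \<open>auto simp: smooth_on_def Ck_on_inverse\<close>)

lemma smooth_on_divide:
  fixes f g :: "'a::real_normed_vector \<Rightarrow> real"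
  assumes "smooth_on U f" "smooth_on U g" "open U" "\<And>x. x \<in> U \<Longrightarrow> g x \<noteq> 0"
  shows "smooth_on U (\<lambda>x. f x / g x)"
  unfolding divide_inverse using assms by (intro smooth_on_mult smooth_on_inverse)

lemma Ck_on_sqrt: "Ck_on k {0<..} sqrt"
proof (induction k)
  case 0
  then show ?case by (auto intro!: continuous_intros)
next
  case (Suc k)
  show ?case
  proof (rule Ck_on_SucI_real)
    show "(sqrt has_vector_derivative inverse (sqrt t) / 2) (at t)" if "t \<in> {0<..}" for t :: real
      using that DERIV_real_sqrt[of t] by (simp add: has_real_derivative_iff_has_vector_derivative)
    show "Ck_on k {0<..} (\<lambda>t. inverse (sqrt t) / 2)"
      by (intro Ck_on_linear[where T = "\<lambda>x. x / 2"] bounded_linear_divide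
          Ck_on_compose[OF _ Ck_on_inverse Suc]) auto
  qed simp
qed

lemma smooth_on_norm:
  fixes f :: "'a::real_normed_vector \<Rightarrow> 'b::euclidean_space"
  assumes "smooth_on U f" "open U" "\<And>x. x \<in> U \<Longrightarrow> f x \<noteq> 0"
  shows "smooth_on U (\<lambda>x. norm (f x))"
  unfolding norm_eq_sqrt_inner
  by (rule smooth_on_compose[of "{0<..}"])
    (use assms in \<open>auto simp: smooth_on_def Ck_on_sqrt intro: bounded_bilinear.Ck_on_bilinear[OF bounded_bilinear_inner]\<close>)

section \<open>Cutoff functions\<close>

text \<open>The function \<open>exp (- 1 / t)\<close>, together with its products with powers of \<open>1 / t\<close>. The latter are
  included because the linear span of the family is closed under differentiation, which makes all its
  members smooth.\<close>

definition flat_exp :: "nat \<Rightarrow> real \<Rightarrow> real" where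
  "flat_exp n t = (if t \<le> 0 then 0 else inverse t ^ n * exp (- inverse t))"

lemma flat_exp_deriv: "(flat_exp n has_real_derivative (- real n * flat_exp (Suc n) t + flat_exp (Suc (Suc n)) t)) (at t)"
proof -
  consider "t < 0" | "t = 0" | "t > 0" by linarith
  then show ?thesis
  proof cases
    case 1
    have "((\<lambda>_. 0) has_real_derivative 0) (at t)" by simp
    then have "(flat_exp n has_real_derivative 0) (at t)"
      by (rule DERIV_cong_ev[THEN iffD1, rotated -1])
        (use 1 in \<open>auto simp: flat_exp_def eventually_nhds intro!: exI[of _ "{..<0}"]\<close>)
    then show ?thesis using 1 by (simp add: flat_exp_def)
  next
    case 2
    have "((\<lambda>x. x ^ Suc n / exp x) \<longlongrightarrow> (0::real)) at_top" by (rule tendsto_power_div_exp_0)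
    then have "((\<lambda>x. flat_exp (Suc n) (inverse x)) \<longlongrightarrow> 0) at_top"
      by (rule Lim_transform_eventually)
        (auto simp: flat_exp_def eventually_at_top_linorder exp_minus field_simps intro!: exI[of _ 1])
    then have "(flat_exp (Suc n) \<longlongrightarrow> 0) (at_right 0)" by (simp add: filterlim_at_right_to_top)
    then have "((\<lambda>h. flat_exp n h / h) \<longlongrightarrow> 0) (at_right 0)"
      by (rule Lim_transform_eventually)
        (auto simp: flat_exp_def eventually_at_right_field field_simps intro!: exI[of _ 1])
    moreover have "((\<lambda>h. flat_exp n h / h) \<longlongrightarrow> 0) (at_left 0)"
      by (rule Lim_transform_eventually[OF tendsto_const])
        (auto simp: flat_exp_def eventually_at_left_field intro!: exI[of _ "-1"])
    ultimately have "((\<lambda>h. flat_exp n h / h) \<longlongrightarrow> 0) (at 0)" by (rule filterlim_split_at[rotated])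
    then show ?thesis using 2 by (simp add: DERIV_def flat_exp_def)
  next
    case 3
    define i where "i = inverse t"
    have "(inverse has_real_derivative - (i * i)) (at t)"
      using 3 by (auto intro!: derivative_eq_intros simp: i_def)
    from DERIV_power[OF this, of n]
    have "((\<lambda>t. inverse t ^ n * exp (- inverse t)) has_real_derivative
        real n * (- (i * i) * i ^ (n - Suc 0)) * exp (- i) + exp (- i) * (i * i) * i ^ n) (at t)"
      using 3 by (auto intro!: derivative_eq_intros simp: i_def)
    moreover have "real n * (- (i * i) * i ^ (n - Suc 0)) * exp (- i) + exp (- i) * (i * i) * i ^ n =
        - real n * flat_exp (Suc n) t + flat_exp (Suc (Suc n)) t"
      using 3 by (cases n) (auto simp: flat_exp_def i_def algebra_simps)
    ultimately have "((\<lambda>t. inverse t ^ n * exp (- inverse t)) has_real_derivative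
        (- real n * flat_exp (Suc n) t + flat_exp (Suc (Suc n)) t)) (at t)" by metis
    then show ?thesis
      by (rule DERIV_cong_ev[THEN iffD1, rotated -1])
        (use 3 in \<open>auto simp: flat_exp_def eventually_nhds intro!: exI[of _ "{0<..}"]\<close>)
  qed
qed

lemma smooth_flat_exp: "smooth_on UNIV (flat_exp n)"
proof -
  have "Ck_on k UNIV (flat_exp n)" for k
  proof (induction k arbitrary: n)
    case 0
    then show ?case
      using flat_exp_deriv by (auto intro!: continuous_at_imp_continuous_on DERIV_isCont)
  next
    case (Suc k)
    show ?case
    proof (rule Ck_on_SucI_real)
      show "(flat_exp n has_vector_derivative - real n * flat_exp (Suc n) t + flat_exp (Suc (Suc n)) t) (at t)" for t
        using flat_exp_deriv by (simp add: has_real_derivative_iff_has_vector_derivative)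
      show "Ck_on k UNIV (\<lambda>t. - real n * flat_exp (Suc n) t + flat_exp (Suc (Suc n)) t)"
        by (intro Ck_on_add Suc Ck_on_linear[OF _ bounded_linear_mult_right] open_UNIV)
    qed simp
  qed
  then show ?thesis by (simp add: smooth_on_def)
qed

lemma flat_exp_nonneg: "0 \<le> flat_exp n t" and flat_exp_pos: "0 < t \<Longrightarrow> 0 < flat_exp n t"
  and flat_exp_zero: "t \<le> 0 \<Longrightarrow> flat_exp n t = 0"
  by (auto simp: flat_exp_def)

lemma smooth_step:
  obtains S :: "real \<Rightarrow> real"
  where "smooth_on UNIV S" "\<And>t. t \<le> 0 \<Longrightarrow> S t = 0" "\<And>t. 1 \<le> t \<Longrightarrow> S t = 1" "\<And>t. 0 \<le> S t"
proof
  let ?S = "\<lambda>t. flat_exp 0 t / (flat_exp 0 t + flat_exp 0 (1 - t))"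
  have pos: "0 < flat_exp 0 t + flat_exp 0 (1 - t)" for t
    using flat_exp_pos[of t 0] flat_exp_pos[of "1 - t" 0] flat_exp_nonneg[of 0 t] flat_exp_nonneg[of 0 "1 - t"]
    by (cases "t > 0") auto
  have lin: "smooth_on UNIV (\<lambda>t::real. 1 - t)"
    by (rule smooth_on_realI[where f' = "\<lambda>_. - 1"]) (auto intro!: derivative_eq_intros)
  have "smooth_on UNIV (\<lambda>t. flat_exp 0 (1 - t))"
    by (rule smooth_on_compose[OF smooth_flat_exp lin]) auto
  then show "smooth_on UNIV ?S"
    by (intro smooth_on_divide smooth_on_add smooth_flat_exp) (use pos in \<open>auto simp: less_le\<close>)
  show "t \<le> 0 \<Longrightarrow> ?S t = 0" for t by (simp add: flat_exp_zero)
  show "1 \<le> t \<Longrightarrow> ?S t = 1" for t using flat_exp_pos[of t 0] by (simp add: flat_exp_zero)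
  show "0 \<le> ?S t" for t by (simp add: flat_exp_nonneg)
qed

lemma Cc_infD:
  assumes "\<psi> \<in> Cc_inf J"
  shows "smooth_on UNIV \<psi>" "\<And>t. t \<notin> J \<Longrightarrow> \<psi> t = 0" "continuous_on UNIV \<psi>"
  using assms smooth_on_continuous unfolding Cc_inf_def by auto

lemma Cc_infE:
  assumes "\<psi> \<in> Cc_inf J"
  obtains K where "compact K" "K \<subseteq> J" "\<And>t. t \<notin> K \<Longrightarrow> \<psi> t = 0"
  using assms unfolding Cc_inf_def by auto

lemma Cc_infI:
  assumes "open J" "smooth_on J \<psi>" "compact K" "K \<subseteq> J" "\<And>t. t \<notin> K \<Longrightarrow> \<psi> t = 0"
  shows "\<psi> \<in> Cc_inf J"
proof -
  have "\<exists>V. open V \<and> t \<in> V \<and> smooth_on V \<psi>" for t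
  proof (cases "t \<in> K")
    case True
    then show ?thesis using assms by blast
  next
    case False
    have "open (- K)" using assms(3) by (simp add: compact_imp_closed open_Compl)
    moreover have "smooth_on (- K) \<psi>"
      by (rule smooth_on_cong[OF smooth_on_const[of _ 0] \<open>open (- K)\<close>]) (use assms in auto)
    ultimately show ?thesis using False by blast
  qed
  then have "smooth_on UNIV \<psi>" by (intro smooth_on_local)
  then show ?thesis using assms by (auto simp: Cc_inf_def)
qed

lemma Cc_inf_mult:
  assumes "\<psi> \<in> Cc_inf J" "open J" "smooth_on J m"
  shows "(\<lambda>t. \<psi> t * m t) \<in> Cc_inf J" "(\<lambda>t. m t * \<psi> t) \<in> Cc_inf J"
proof -
  obtain K where K: "compact K" "K \<subseteq> J" "\<And>t. t \<notin> K \<Longrightarrow> \<psi> t = 0"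
    using Cc_infE[OF assms(1)] by metis
  have "smooth_on J \<psi>" using Cc_infD(1)[OF assms(1)] smooth_on_subset by blast
  then show "(\<lambda>t. \<psi> t * m t) \<in> Cc_inf J" "(\<lambda>t. m t * \<psi> t) \<in> Cc_inf J"
    using K by (auto intro!: Cc_infI[OF assms(2) _ K(1,2)] smooth_on_mult assms)
qed

lemma Cc_inf_mono: "\<psi> \<in> Cc_inf J \<Longrightarrow> J \<subseteq> J' \<Longrightarrow> \<psi> \<in> Cc_inf J'"
  unfolding Cc_inf_def by auto

lemma Cc_inf_zero: "(\<lambda>_. 0) \<in> Cc_inf J"
  unfolding Cc_inf_def by auto

lemma smooth_on_of_real:
  fixes f :: "'a::real_normed_vector \<Rightarrow> real"
  shows "smooth_on U f \<Longrightarrow> open U \<Longrightarrow> smooth_on U (\<lambda>x. of_real (f x) :: complex)"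
  using smooth_on_linear[OF _ _ bounded_linear_of_real] .

lemma Cc_inf_cutoff:
  assumes "open J" "compact K" "K \<subseteq> J"
  obtains \<eta> :: "real \<Rightarrow> real"
  where "(\<lambda>t. complex_of_real (\<eta> t)) \<in> Cc_inf J" "\<And>t. 0 \<le> \<eta> t" "\<And>t. t \<in> K \<Longrightarrow> \<eta> t = 1"
proof (cases "K = {}")
  case True
  then show ?thesis using that[of "\<lambda>_. 0"] Cc_inf_zero by simp
next
  case False
  have "\<exists>r>0. cball p r \<subseteq> J" if "p \<in> K" for p
    using assms open_contains_cball that by blast
  then obtain r where r: "\<And>p. p \<in> K \<Longrightarrow> r p > 0" "\<And>p. p \<in> K \<Longrightarrow> cball p (r p) \<subseteq> J" by metis
  obtain D where D: "D \<subseteq> K" "finite D" "K \<subseteq> (\<Union>p\<in>D. ball p (r p))"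
  proof (rule compactE_image[OF assms(2), of K "\<lambda>p. ball p (r p)"])
    show "K \<subseteq> (\<Union>p\<in>K. ball p (r p))" using r by (auto intro!: centre_in_ball[THEN iffD2])
  qed auto
  \<comment> \<open>A sum of bumps that is positive on \<open>K\<close>, hence at least some \<open>d > 0\<close> there. Composition with a
    step from \<open>0\<close> to \<open>1\<close> turns it into a function that equals \<open>1\<close> on \<open>K\<close>.\<close>
  define g where "g t = (\<Sum>p\<in>D. flat_exp 0 ((r p)\<^sup>2 - (t - p)\<^sup>2))" for t
  have "smooth_on UNIV (\<lambda>t. flat_exp 0 ((r p)\<^sup>2 - (t - p)\<^sup>2))" for p
  proof (rule smooth_on_compose[OF smooth_flat_exp])
    show "smooth_on UNIV (\<lambda>t. (r p)\<^sup>2 - (t - p)\<^sup>2)"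
      by (rule smooth_on_realI[where f' = "\<lambda>t. 2 * (p - t)"],
          auto simp: has_real_derivative_iff_has_vector_derivative[symmetric] intro!: derivative_eq_intros)
        (rule smooth_on_realI[where f' = "\<lambda>t. - 2"],
          auto simp: has_real_derivative_iff_has_vector_derivative[symmetric] intro!: derivative_eq_intros)
  qed auto
  then have smooth_g: "smooth_on UNIV g" unfolding g_def[abs_def] by (intro smooth_on_sum) auto
  have g_pos: "0 < g t" if t: "t \<in> K" for t
  proof -
    obtain p where p: "p \<in> D" "\<bar>t - p\<bar> < r p" using D(3) t
      by (fastforce simp: dist_real_def abs_minus_commute)
    then have "(t - p)\<^sup>2 < (r p)\<^sup>2" by (metis abs_ge_zero power2_abs power2_eq_square mult_strict_mono')
    then have "0 < flat_exp 0 ((r p)\<^sup>2 - (t - p)\<^sup>2)" by (simp add: flat_exp_pos)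
    then show ?thesis unfolding g_def using p D(2) by (intro sum_pos2[of D p]) (auto simp: flat_exp_nonneg)
  qed
  have g_zero: "g t = 0" if "t \<notin> (\<Union>p\<in>D. cball p (r p))" for t
  proof -
    have "(r p)\<^sup>2 \<le> (t - p)\<^sup>2" if "p \<in> D" for p
    proof -
      have "r p \<le> \<bar>t - p\<bar>" "0 < r p"
        using that D(1) r(1) \<open>t \<notin> (\<Union>p\<in>D. cball p (r p))\<close> by (force simp: dist_real_def)+
      then show ?thesis by (metis abs_le_square_iff abs_of_pos)
    qed
    then show ?thesis unfolding g_def by (intro sum.neutral) (auto simp: flat_exp_zero)
  qed
  obtain t0 where t0: "t0 \<in> K" "\<And>t. t \<in> K \<Longrightarrow> g t0 \<le> g t"
    using continuous_attains_inf[OF assms(2) False, of g]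
      smooth_on_continuous[OF smooth_on_subset[OF smooth_g]] by (metis subset_UNIV)
  define d where "d = g t0"
  have d: "d > 0" using g_pos t0 by (simp add: d_def)
  obtain S :: "real \<Rightarrow> real" where S: "smooth_on UNIV S" "\<And>t. t \<le> 0 \<Longrightarrow> S t = 0" "\<And>t. 1 \<le> t \<Longrightarrow> S t = 1" "\<And>t. 0 \<le> S t"
    using smooth_step by metis
  show ?thesis
  proof (rule that[of "\<lambda>t. S (g t / d)"])
    have "smooth_on UNIV (\<lambda>t. g t / d)"
      using smooth_on_linear[OF smooth_g _ bounded_linear_divide] by simp
    then have "smooth_on UNIV (\<lambda>t. S (g t / d))" by (intro smooth_on_compose[OF S(1)]) auto
    then have "smooth_on J (\<lambda>t. complex_of_real (S (g t / d)))"
      using smooth_on_subset by (intro smooth_on_of_real assms) blast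
    moreover have "compact (\<Union>p\<in>D. cball p (r p))" using D by (intro compact_UN) auto
    moreover have "(\<Union>p\<in>D. cball p (r p)) \<subseteq> J" using D r by blast
    ultimately show "(\<lambda>t. complex_of_real (S (g t / d))) \<in> Cc_inf J"
      by (intro Cc_infI[OF assms(1)]) (auto simp: g_zero S)
    show "S (g t / d) = 1" if "t \<in> K" for t using t0(2)[OF that] d by (intro S) (simp add: d_def)
  qed (rule S)
qed

section \<open>Fourier transform of test functions\<close>

lemma Cc_inf_times_integrable:
  assumes "\<psi> \<in> Cc_inf J" "continuous_on UNIV h"
  shows "integrable lborel (\<lambda>t. \<psi> t * h t)"
proof -
  obtain K where K: "compact K" "\<And>t. t \<notin> K \<Longrightarrow> \<psi> t = 0" using Cc_infE[OF assms(1)] by metis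
  have "continuous_on K (\<lambda>t. \<psi> t * h t)"
    using Cc_infD(3)[OF assms(1)] assms(2) by (auto intro!: continuous_on_mult intro: continuous_on_subset)
  then have "integrable lborel (\<lambda>t. indicator K t *\<^sub>R (\<psi> t * h t))"
    by (rule borel_integrable_compact[OF K(1)])
  moreover have "(\<lambda>t. indicator K t *\<^sub>R (\<psi> t * h t)) = (\<lambda>t. \<psi> t * h t)"
    using K(2) by (auto simp: fun_eq_iff indicator_def)
  ultimately show ?thesis by simp
qed

lemma Cc_inf_integrable: "\<psi> \<in> Cc_inf J \<Longrightarrow> integrable lborel \<psi>"
  using Cc_inf_times_integrable[of \<psi> J "\<lambda>_. 1"] by simp

lemma Cc_inf_vderiv:
  assumes "\<psi> \<in> Cc_inf J" shows "vderiv \<psi> \<in> Cc_inf J"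
proof -
  obtain K where K: "compact K" "K \<subseteq> J" "\<And>t. t \<notin> K \<Longrightarrow> \<psi> t = 0" using Cc_infE[OF assms] by metis
  have "vderiv \<psi> t = 0" if "t \<notin> K" for t
    using vderiv_cong[of "- K" \<psi> "\<lambda>_. 0" t] K that by (simp add: compact_imp_closed open_Compl)
  then show ?thesis
    using K smooth_on_vderiv[OF Cc_infD(1)[OF assms]] unfolding Cc_inf_def by auto
qed

lemma Cc_inf_vderiv_pow: "\<psi> \<in> Cc_inf J \<Longrightarrow> (vderiv ^^ j) \<psi> \<in> Cc_inf J"
  by (induction j) (auto intro: Cc_inf_vderiv)

lemma integral_vderiv_eq_0:
  assumes "\<psi> \<in> Cc_inf J" shows "(LINT t|lborel. vderiv \<psi> t) = 0"
proof -
  obtain K where K: "compact K" "K \<subseteq> J" "\<And>t. t \<notin> K \<Longrightarrow> \<psi> t = 0" using Cc_infE[OF assms] by metis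
  obtain R where R: "R > 0" "\<And>t. t \<in> K \<Longrightarrow> \<bar>t\<bar> < R"
    using compact_imp_bounded[OF K(1)] bounded_pos_less by (metis real_norm_def)
  have zero: "vderiv \<psi> t = 0" if "t \<notin> {-R..R}" for t
    using vderiv_cong[of "- K" \<psi> "\<lambda>_. 0" t] K R(2)[of t] that by (force simp: compact_imp_closed open_Compl)
  have "(LINT t|lborel. indicator {-R..R} t *\<^sub>R vderiv \<psi> t) = \<psi> R - \<psi> (- R)"
  proof (rule integral_FTC_Icc)
    show "(\<psi> has_vector_derivative vderiv \<psi> t) (at t within {-R..R})" for t
      using smooth_on_has_vderiv[OF Cc_infD(1)[OF assms], of t] by (simp add: has_vector_derivative_at_within)
    show "continuous_on {-R..R} (vderiv \<psi>)"
      using Cc_infD(3)[OF Cc_inf_vderiv[OF assms]] continuous_on_subset by blast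
  qed (use R in simp)
  moreover have "(\<lambda>t. indicator {-R..R} t *\<^sub>R vderiv \<psi> t) = vderiv \<psi>"
    using zero by (auto simp: fun_eq_iff indicator_def)
  moreover have "\<psi> R = 0" "\<psi> (- R) = 0"
    using K(3) R(1) R(2)[of R] R(2)[of "- R"] by fastforce+
  ultimately show ?thesis by simp
qed

definition fourier :: "(real \<Rightarrow> complex) \<Rightarrow> real \<Rightarrow> complex" where
  "fourier f \<xi> = (LINT t|lborel. f t * cis (- (\<xi> * t)))"

lemma smooth_on_cis_neg: "smooth_on UNIV (\<lambda>t. cis (- (\<xi> * t)))"
  using smooth_on_cis[of "- \<xi>"] by simp

lemma continuous_cis_neg: "continuous_on UNIV (\<lambda>t. cis (- (\<xi> * t)))"
  using smooth_on_continuous[OF smooth_on_cis_neg] .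

lemma fourier_vderiv:
  assumes "\<psi> \<in> Cc_inf J" shows "fourier (vderiv \<psi>) \<xi> = \<i> * \<xi> * fourier \<psi> \<xi>"
proof -
  let ?e = "\<lambda>t. cis (- (\<xi> * t))"
  have \<psi>: "\<psi> \<in> Cc_inf UNIV" using assms Cc_inf_mono by blast
  have *: "(\<lambda>t. \<psi> t * ?e t) \<in> Cc_inf UNIV"
    using Cc_inf_mult(1)[OF \<psi> _ smooth_on_cis_neg] by simp
  have "((\<lambda>t. \<psi> t * ?e t) has_vector_derivative (vderiv \<psi> t * ?e t - \<i> * \<xi> * (\<psi> t * ?e t))) (at t)" for t
  proof -
    have "(?e has_vector_derivative (- \<i> * \<xi> * ?e t)) (at t)"
      by (auto simp: cis_conv_exp intro!: derivative_eq_intros has_vector_derivative_real_field)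
    from has_vector_derivative_mult[OF smooth_on_has_vderiv[OF Cc_infD(1)[OF assms] UNIV_I] this]
    show ?thesis by (simp add: algebra_simps)
  qed
  then have "vderiv (\<lambda>t. \<psi> t * ?e t) = (\<lambda>t. vderiv \<psi> t * ?e t - \<i> * \<xi> * (\<psi> t * ?e t))"
    by (auto intro: vector_derivative_at)
  then have "0 = (LINT t|lborel. vderiv \<psi> t * ?e t - \<i> * \<xi> * (\<psi> t * ?e t))"
    using integral_vderiv_eq_0[OF *] by simp
  also have "\<dots> = fourier (vderiv \<psi>) \<xi> - \<i> * \<xi> * fourier \<psi> \<xi>"
    unfolding fourier_def
    by (subst Bochner_Integration.integral_diff)
      (auto intro!: Cc_inf_times_integrable[OF Cc_inf_vderiv[OF assms]] Cc_inf_times_integrable[OF assms]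
        integrable_mult_right continuous_cis_neg)
  finally show ?thesis by simp
qed

lemma fourier_vderiv_pow:
  "\<psi> \<in> Cc_inf J \<Longrightarrow> fourier ((vderiv ^^ j) \<psi>) \<xi> = (\<i> * \<xi>) ^ j * fourier \<psi> \<xi>"
  by (induction j) (simp_all add: fourier_vderiv[OF Cc_inf_vderiv_pow, of \<psi> J])

lemma fourier_le: "cmod (fourier f \<xi>) \<le> (LINT t|lborel. cmod (f t))"
  unfolding fourier_def using integral_norm_bound[of lborel "\<lambda>t. f t * cis (- (\<xi> * t))"]
  by (simp add: norm_mult)

lemma fourier_measurable [measurable]:
  assumes [measurable]: "f \<in> borel_measurable borel"
  shows "fourier f \<in> borel_measurable borel"
proof -
  have "(\<lambda>\<xi>. LINT t|lborel. f t * cis (- (\<xi> * t))) \<in> borel_measurable borel"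
    by (rule lborel.borel_measurable_lebesgue_integral)
      (auto simp: cis_conv_exp intro!: borel_measurable_times borel_measurable_exp)
  then show ?thesis by (simp add: fourier_def[abs_def])
qed

lemma integrable_inverse_square: "integrable lborel (\<lambda>x::real. inverse (1 + x\<^sup>2))"
  using integrable_inverse_1_plus_square by (simp add: set_integrable_def)

text \<open>The decay of a Fourier transform that makes the inverse transform smooth.\<close>

definition all_moments :: "(real \<Rightarrow> complex) \<Rightarrow> bool" where
  "all_moments w \<longleftrightarrow> w \<in> borel_measurable borel \<and> (\<forall>j. integrable lborel (\<lambda>\<xi>. \<bar>\<xi>\<bar> ^ j * cmod (w \<xi>)))"

lemma fourier_all_moments:
  assumes "\<psi> \<in> Cc_inf J" shows "all_moments (fourier \<psi>)"
  unfolding all_moments_def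
proof (intro conjI allI)
  have meas[measurable]: "\<psi> \<in> borel_measurable borel"
    using Cc_infD(3)[OF assms] borel_measurable_continuous_onI by blast
  show "fourier \<psi> \<in> borel_measurable borel" by measurable
  fix j
  define M where "M j = (LINT t|lborel. cmod ((vderiv ^^ j) \<psi> t))" for j
  have M: "\<bar>\<xi>\<bar> ^ j * cmod (fourier \<psi> \<xi>) \<le> M j" for j \<xi>
    using fourier_le[of "(vderiv ^^ j) \<psi>" \<xi>] fourier_vderiv_pow[OF assms, of j \<xi>]
    by (simp add: norm_mult norm_power M_def)
  show "integrable lborel (\<lambda>\<xi>. \<bar>\<xi>\<bar> ^ j * cmod (fourier \<psi> \<xi>))"
  proof (rule Bochner_Integration.integrable_bound)
    show "integrable lborel (\<lambda>\<xi>. (M j + M (j + 2)) * inverse (1 + \<xi>\<^sup>2))"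
      by (intro integrable_mult_right integrable_inverse_square)
    show "AE \<xi> in lborel. norm (\<bar>\<xi>\<bar> ^ j * cmod (fourier \<psi> \<xi>)) \<le> norm ((M j + M (j + 2)) * inverse (1 + \<xi>\<^sup>2))"
    proof (rule AE_I2)
      fix \<xi> :: real
      have "(1 + \<xi>\<^sup>2) * (\<bar>\<xi>\<bar> ^ j * cmod (fourier \<psi> \<xi>)) \<le> M j + M (j + 2)"
      proof -
        have "(1 + \<xi>\<^sup>2) * (\<bar>\<xi>\<bar> ^ j * cmod (fourier \<psi> \<xi>)) =
            \<bar>\<xi>\<bar> ^ j * cmod (fourier \<psi> \<xi>) + \<bar>\<xi>\<bar> ^ (j + 2) * cmod (fourier \<psi> \<xi>)"
          unfolding power_add power2_abs by algebra
        then show ?thesis using M[of \<xi> j] M[of \<xi> "j + 2"] by linarith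
      qed
      moreover have "1 + \<xi>\<^sup>2 > 0" by (simp add: add_pos_nonneg)
      moreover have "M j + M (j + 2) \<ge> 0" by (auto simp: M_def)
      ultimately show "norm (\<bar>\<xi>\<bar> ^ j * cmod (fourier \<psi> \<xi>)) \<le> norm ((M j + M (j + 2)) * inverse (1 + \<xi>\<^sup>2))"
        by (simp add: field_simps abs_mult)
    qed
  qed measurable
qed

text \<open>Up to the factor \<open>2 \<pi>\<close>, the \<open>j\<close>-th derivative of the inverse Fourier transform of \<open>w\<close>.\<close>

definition moment_transform :: "(real \<Rightarrow> complex) \<Rightarrow> nat \<Rightarrow> real \<Rightarrow> complex" where
  "moment_transform w j t = (LINT \<xi>|lborel. (\<i> * \<xi>) ^ j * w \<xi> * cis (\<xi> * t))"

lemma moment_integrable: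
  assumes "all_moments w" "f \<in> borel_measurable borel" "\<And>\<xi>. cmod (f \<xi>) \<le> C * \<bar>\<xi>\<bar> ^ j"
  shows "integrable lborel (\<lambda>\<xi>. w \<xi> * f \<xi>)"
proof (rule Bochner_Integration.integrable_bound)
  show "integrable lborel (\<lambda>\<xi>. C * (\<bar>\<xi>\<bar> ^ j * cmod (w \<xi>)))"
    using assms(1) by (auto simp: all_moments_def)
  show "(\<lambda>\<xi>. w \<xi> * f \<xi>) \<in> borel_measurable lborel" using assms by (auto simp: all_moments_def)
  show "AE \<xi> in lborel. norm (w \<xi> * f \<xi>) \<le> norm (C * (\<bar>\<xi>\<bar> ^ j * cmod (w \<xi>)))"
  proof (rule AE_I2)
    fix \<xi>
    have "norm (w \<xi> * f \<xi>) \<le> cmod (w \<xi>) * (C * \<bar>\<xi>\<bar> ^ j)"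
      using assms(3) by (auto simp: norm_mult intro!: mult_left_mono)
    then show "norm (w \<xi> * f \<xi>) \<le> norm (C * (\<bar>\<xi>\<bar> ^ j * cmod (w \<xi>)))" by (simp add: algebra_simps)
  qed
qed

lemma cis_measurable [measurable]: "f \<in> borel_measurable M \<Longrightarrow> (\<lambda>x. cis (f x)) \<in> borel_measurable M"
  unfolding cis_conv_exp by measurable

lemma moment_transform_integrable:
  assumes "all_moments w" shows "integrable lborel (\<lambda>\<xi>. (\<i> * \<xi>) ^ j * w \<xi> * cis (\<xi> * t))"
  using moment_integrable[OF assms, of "\<lambda>\<xi>. (\<i> * \<xi>) ^ j * cis (\<xi> * t)" 1 j]
  by (simp add: norm_mult norm_power mult_ac)

text \<open>For differentiation under the integral sign in \<open>moment_transform\<close>, where the second order Taylor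
  remainder of the exponential is at most \<open>\<xi>\<^sup>2 h\<^sup>2\<close>, and the factor \<open>\<xi>\<^sup>2\<close> is absorbed
  by the moments.\<close>

lemma has_vector_derivative_quadraticI:
  assumes "\<And>h. norm (f (t + h) - f t - h *\<^sub>R d) \<le> C * h\<^sup>2"
  shows "(f has_vector_derivative d) (at t)"
  unfolding has_vector_derivative_def has_derivative_at
proof (intro conjI bounded_linear_scaleR_left)
  have "((\<lambda>h::real. C * \<bar>h\<bar>) \<longlongrightarrow> C * \<bar>0\<bar>) (at 0)" by (intro tendsto_intros)
  then have lim: "((\<lambda>h::real. C * \<bar>h\<bar>) \<longlongrightarrow> 0) (at 0)" by simp
  show "(\<lambda>h. norm (f (t + h) - f t - h *\<^sub>R d) / norm h) \<midarrow>0\<rightarrow> 0"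
  proof (rule tendsto_sandwich[OF _ _ tendsto_const lim])
    show "\<forall>\<^sub>F h in at 0. norm (f (t + h) - f t - h *\<^sub>R d) / norm h \<le> C * \<bar>h\<bar>"
      using assms by (auto simp: eventually_at_filter divide_simps power2_eq_square abs_mult_self_eq algebra_simps)
  qed auto
qed

lemma moment_transform_deriv:
  assumes "all_moments w"
  shows "(moment_transform w j has_vector_derivative moment_transform w (Suc j) t) (at t)"
proof (rule has_vector_derivative_quadraticI)
  fix h :: real
  define q where "q \<xi> = cis (\<xi> * t) * (cis (\<xi> * h) - 1 - \<i> * \<xi> * h)" for \<xi> :: real
  have q: "cmod (q \<xi>) \<le> h\<^sup>2 * \<bar>\<xi>\<bar>\<^sup>2" for \<xi>
  proof -
    have "cmod (cis (\<xi> * h) - (1 + \<i> * (\<xi> * h))) \<le> \<bar>\<xi> * h\<bar>\<^sup>2 / 2"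
      using iexp_approx1[of "\<xi> * h" 1] by (simp add: cis_conv_exp power2_eq_square algebra_simps)
    also have "\<dots> \<le> h\<^sup>2 * \<bar>\<xi>\<bar>\<^sup>2" by (simp add: power_mult_distrib)
    finally have "cmod (cis (\<xi> * h) - 1 - \<i> * \<xi> * h) \<le> h\<^sup>2 * \<bar>\<xi>\<bar>\<^sup>2" by (simp add: diff_diff_add mult.assoc)
    then show ?thesis by (simp add: q_def norm_mult)
  qed
  have "moment_transform w j (t + h) - moment_transform w j t - h *\<^sub>R moment_transform w (Suc j) t
      = (LINT \<xi>|lborel. w \<xi> * ((\<i> * \<xi>) ^ j * q \<xi>))"
    unfolding moment_transform_def
    by (simp only: integral_scaleR_right[symmetric]
        Bochner_Integration.integral_diff[symmetric] moment_transform_integrable[OF assms]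
        Bochner_Integration.integrable_diff Bochner_Integration.integrable_scaleR_right)
      (auto intro!: Bochner_Integration.integral_cong simp: q_def algebra_simps scaleR_conv_of_real cis_mult[symmetric])
  also have "norm \<dots> \<le> (LINT \<xi>|lborel. norm (w \<xi> * ((\<i> * \<xi>) ^ j * q \<xi>)))"
    by (rule integral_norm_bound)
  also have "\<dots> \<le> (LINT \<xi>|lborel. h\<^sup>2 * (\<bar>\<xi>\<bar> ^ (j + 2) * cmod (w \<xi>)))"
  proof (rule integral_mono)
    have le: "cmod ((\<i> * \<xi>) ^ j * q \<xi>) \<le> h\<^sup>2 * \<bar>\<xi>\<bar> ^ (j + 2)" for \<xi> :: real
    proof -
      have a: "h\<^sup>2 * \<bar>\<xi>\<bar> ^ (j + 2) = \<bar>\<xi>\<bar> ^ j * (h\<^sup>2 * \<bar>\<xi>\<bar>\<^sup>2)" by (simp only: power_add mult_ac)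
      have b: "cmod ((\<i> * \<xi>) ^ j * q \<xi>) = \<bar>\<xi>\<bar> ^ j * cmod (q \<xi>)" by (simp add: norm_mult norm_power)
      show ?thesis unfolding a b by (rule mult_left_mono[OF q]) simp
    qed
    have "q \<in> borel_measurable borel" unfolding q_def[abs_def] by measurable
    then have "integrable lborel (\<lambda>\<xi>. w \<xi> * ((\<i> * \<xi>) ^ j * q \<xi>))"
      by (intro moment_integrable[OF assms _ le]) measurable
    then show "integrable lborel (\<lambda>\<xi>. norm (w \<xi> * ((\<i> * \<xi>) ^ j * q \<xi>)))" by (rule integrable_norm)
    show "integrable lborel (\<lambda>\<xi>. h\<^sup>2 * (\<bar>\<xi>\<bar> ^ (j + 2) * cmod (w \<xi>)))"
      using assms unfolding all_moments_def by (intro integrable_mult_right) blast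
    show "norm (w \<xi> * ((\<i> * \<xi>) ^ j * q \<xi>)) \<le> h\<^sup>2 * (\<bar>\<xi>\<bar> ^ (j + 2) * cmod (w \<xi>))" for \<xi>
      using mult_left_mono[OF le[of \<xi>], of "cmod (w \<xi>)"] by (simp add: norm_mult algebra_simps)
  qed
  also have "\<dots> = (LINT \<xi>|lborel. \<bar>\<xi>\<bar> ^ (j + 2) * cmod (w \<xi>)) * h\<^sup>2" by simp
  finally show "norm (moment_transform w j (t + h) - moment_transform w j t - h *\<^sub>R moment_transform w (Suc j) t)
      \<le> (LINT \<xi>|lborel. \<bar>\<xi>\<bar> ^ (j + 2) * cmod (w \<xi>)) * h\<^sup>2" .
qed

lemma smooth_moment_transform: "all_moments w \<Longrightarrow> smooth_on UNIV (moment_transform w j)"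
  by (rule smooth_on_sequenceI) (auto intro: moment_transform_deriv)

lemma vderiv_moment_transform:
  "all_moments w \<Longrightarrow> (vderiv ^^ j) (moment_transform w 0) t = moment_transform w j t"
  by (rule vderiv_pow_sequence[of UNIV]) (auto intro: moment_transform_deriv)

lemma fubini_cis:
  fixes a b :: "real \<Rightarrow> complex"
  assumes [measurable]: "integrable lborel a" "integrable lborel b"
  shows "(LINT x|lborel. a x * (LINT y|lborel. b y * cis (c * x * y)))
       = (LINT y|lborel. b y * (LINT x|lborel. a x * cis (c * x * y)))"
proof -
  have int: "integrable (lborel \<Otimes>\<^sub>M lborel) (\<lambda>(x, y). a x * b y * cis (c * x * y))"
  proof (rule lborel_pair.Fubini_integrable)
    have [measurable]: "a \<in> borel_measurable borel" "b \<in> borel_measurable borel" using assms by auto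
    show "(\<lambda>(x, y). a x * b y * cis (c * x * y)) \<in> borel_measurable (lborel \<Otimes>\<^sub>M lborel)" by measurable
    show "integrable lborel (\<lambda>x. LINT y|lborel. norm (case (x, y) of (x, y) \<Rightarrow> a x * b y * cis (c * x * y)))"
      using assms by (simp add: norm_mult)
    have "integrable lborel (\<lambda>y. b y * cis (c * x * y))" for x
      by (rule Bochner_Integration.integrable_bound[OF assms(2)]) (auto simp: norm_mult)
    then have "integrable lborel (\<lambda>y. a x * (b y * cis (c * x * y)))" for x by (intro integrable_mult_right)
    then show "AE x in lborel. integrable lborel (\<lambda>y. case (x, y) of (x, y) \<Rightarrow> a x * b y * cis (c * x * y))"
      by (simp add: mult_ac)
  qed
  have "(LINT y|lborel. LINT x|lborel. a x * b y * cis (c * x * y)) =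
        (LINT x|lborel. LINT y|lborel. a x * b y * cis (c * x * y))"
    using lborel_pair.Fubini_integral[of "\<lambda>x y. a x * b y * cis (c * x * y)"] int by simp
  moreover have "(LINT y|lborel. a x * b y * cis (c * x * y)) = a x * (LINT y|lborel. b y * cis (c * x * y))" for x
    by (simp add: mult.assoc)
  moreover have "(LINT x|lborel. a x * b y * cis (c * x * y)) = b y * (LINT x|lborel. a x * cis (c * x * y))" for y
    by (simp add: mult.assoc mult.left_commute[of _ "b y"])
  ultimately show ?thesis by simp
qed

lemma gauss_integrable: "integrable lborel (\<lambda>x. exp (- (x\<^sup>2) / 2) :: real)"
proof -
  have "integrable lborel (\<lambda>x. sqrt (2 * pi) * std_normal_density x)" by simp
  then show ?thesis by (simp add: std_normal_density_def)
qed

lemma fourier_gauss: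
  "(LINT x|lborel. complex_of_real (exp (- (x\<^sup>2) / 2)) * cis (t * x)) = complex_of_real (sqrt (2 * pi) * exp (- (t\<^sup>2) / 2))"
proof -
  have "complex_of_real (exp (- (t\<^sup>2) / 2)) = char std_normal_distribution t"
    by (simp add: char_std_normal_distribution)
  also have "\<dots> = (LINT x|lborel. std_normal_density x *\<^sub>R iexp (t * x))"
    unfolding char_def by (subst integral_density) (auto simp: normal_density_nonneg)
  also have "\<dots> = (LINT x|lborel. complex_of_real (1 / sqrt (2 * pi)) * (complex_of_real (exp (- (x\<^sup>2) / 2)) * cis (t * x)))"
    by (intro Bochner_Integration.integral_cong)
      (auto simp: std_normal_density_def scaleR_conv_of_real cis_conv_exp mult.assoc)
  also have "\<dots> = complex_of_real (1 / sqrt (2 * pi)) * (LINT x|lborel. complex_of_real (exp (- (x\<^sup>2) / 2)) * cis (t * x))"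
    by (rule integral_mult_right_zero)
  finally show ?thesis by (simp add: field_simps)
qed

text \<open>Fourier inversion. Damping the integral by a Gaussian of width \<open>1/\<epsilon>\<close> makes the exchange of
  the two integrations legitimate and turns the inner one into a Gaussian of width \<open>\<epsilon>\<close> around the
  point \<open>t\<close>; both sides have the expected limit as \<open>\<epsilon> \<rightarrow> 0\<close>.\<close>

theorem fourier_inversion:
  fixes \<psi> :: "real \<Rightarrow> complex"
  assumes \<psi>: "\<psi> \<in> Cc_inf J"
  shows "moment_transform (fourier \<psi>) 0 t = 2 * pi * \<psi> t"
proof -
  define G :: "real \<Rightarrow> real" where "G x = exp (- (x\<^sup>2) / 2)" for x
  have G: "0 \<le> G x" "G x \<le> 1" "integrable lborel G" for x
    using gauss_integrable by (auto simp: G_def[abs_def])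
  have [measurable]: "G \<in> borel_measurable borel" unfolding G_def by measurable
  have cont: "continuous_on UNIV \<psi>" using Cc_infD(3)[OF \<psi>] .
  have [measurable]: "\<psi> \<in> borel_measurable borel"
    using cont borel_measurable_continuous_onI by blast
  have fint: "integrable lborel (fourier \<psi>)"
    using moment_transform_integrable[OF fourier_all_moments[OF \<psi>], of 0 0] by simp
  have eq: "(LINT \<xi>|lborel. fourier \<psi> \<xi> * cis (\<xi> * t) * G (\<epsilon> * \<xi>))
      = sqrt (2 * pi) * (LINT x|lborel. \<psi> (t + \<epsilon> * x) * G x)" if \<epsilon>: "\<epsilon> > 0" for \<epsilon>
  proof -
    define a where "a \<xi> = complex_of_real (G (\<epsilon> * \<xi>)) * cis (\<xi> * t)" for \<xi>
    have "integrable lborel (\<lambda>\<xi>. G (0 + \<epsilon> * \<xi>))"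
      by (intro lborel_integrable_real_affine G) (use \<epsilon> in simp)
    then have inta: "integrable lborel a"
      by (rule Bochner_Integration.integrable_bound) (auto simp: a_def[abs_def] norm_mult G)
    have inner: "(LINT \<xi>|lborel. a \<xi> * cis (- 1 * \<xi> * s)) = sqrt (2 * pi) / \<epsilon> * G ((s - t) / \<epsilon>)" for s
    proof -
      have "complex_of_real (sqrt (2 * pi) * G ((t - s) / \<epsilon>)) =
          (LINT x|lborel. complex_of_real (G x) * cis ((t - s) / \<epsilon> * x))"
        unfolding G_def by (rule fourier_gauss[symmetric])
      also have "\<dots> = \<bar>\<epsilon>\<bar> *\<^sub>R (LINT \<xi>|lborel. complex_of_real (G (0 + \<epsilon> * \<xi>)) * cis ((t - s) / \<epsilon> * (0 + \<epsilon> * \<xi>)))"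
        using \<epsilon> by (intro lborel_integral_real_affine) simp
      also have "(LINT \<xi>|lborel. complex_of_real (G (0 + \<epsilon> * \<xi>)) * cis ((t - s) / \<epsilon> * (0 + \<epsilon> * \<xi>)))
          = (LINT \<xi>|lborel. a \<xi> * cis (- 1 * \<xi> * s))"
      proof (intro Bochner_Integration.integral_cong refl)
        fix \<xi>
        have "(t - s) / \<epsilon> * (0 + \<epsilon> * \<xi>) = \<xi> * t + - 1 * \<xi> * s" using \<epsilon> by (simp add: field_simps)
        then show "complex_of_real (G (0 + \<epsilon> * \<xi>)) * cis ((t - s) / \<epsilon> * (0 + \<epsilon> * \<xi>)) =
            a \<xi> * cis (- 1 * \<xi> * s)"
          by (simp add: a_def cis_mult mult.assoc)
      qed
      finally show ?thesis
        using \<epsilon> by (simp add: scaleR_conv_of_real field_simps G_def power_divide power2_commute)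
    qed
    have "(LINT \<xi>|lborel. fourier \<psi> \<xi> * cis (\<xi> * t) * G (\<epsilon> * \<xi>)) =
        (LINT \<xi>|lborel. a \<xi> * (LINT s|lborel. \<psi> s * cis (- 1 * \<xi> * s)))"
      by (simp add: fourier_def a_def mult_ac)
    also have "\<dots> = (LINT s|lborel. \<psi> s * (sqrt (2 * pi) / \<epsilon> * G ((s - t) / \<epsilon>)))"
      unfolding fubini_cis[OF inta Cc_inf_integrable[OF \<psi>]] inner ..
    also have "\<dots> = \<bar>\<epsilon>\<bar> *\<^sub>R (LINT x|lborel. \<psi> (t + \<epsilon> * x) * (sqrt (2 * pi) / \<epsilon> * G ((t + \<epsilon> * x - t) / \<epsilon>)))"
      using \<epsilon> by (intro lborel_integral_real_affine) simp
    also have "\<dots> = (LINT x|lborel. \<epsilon> * (\<psi> (t + \<epsilon> * x) * (sqrt (2 * pi) / \<epsilon> * G x)))"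
      using \<epsilon> by (simp add: scaleR_conv_of_real)
    also have "\<dots> = (LINT x|lborel. sqrt (2 * pi) * (\<psi> (t + \<epsilon> * x) * G x))"
      using \<epsilon> by (intro Bochner_Integration.integral_cong) (auto simp: field_simps)
    finally show ?thesis by simp
  qed
  define \<epsilon> where "\<epsilon> n = 1 / real (Suc n)" for n
  have \<epsilon>: "\<epsilon> n > 0" "\<epsilon> \<longlonglongrightarrow> 0" for n
    using LIMSEQ_inverse_real_of_nat by (auto simp: \<epsilon>_def[abs_def] inverse_eq_divide)
  have "(\<lambda>n. LINT \<xi>|lborel. fourier \<psi> \<xi> * cis (\<xi> * t) * G (\<epsilon> n * \<xi>)) \<longlonglongrightarrow>
      (LINT \<xi>|lborel. fourier \<psi> \<xi> * cis (\<xi> * t) * G (0 * \<xi>))"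
  proof (rule integral_dominated_convergence[where w = "\<lambda>\<xi>. cmod (fourier \<psi> \<xi>)"])
    show "AE \<xi> in lborel. (\<lambda>n. fourier \<psi> \<xi> * cis (\<xi> * t) * G (\<epsilon> n * \<xi>)) \<longlonglongrightarrow> fourier \<psi> \<xi> * cis (\<xi> * t) * G (0 * \<xi>)"
      unfolding G_def by (intro AE_I2 tendsto_intros \<epsilon>) auto
    show "AE \<xi> in lborel. norm (fourier \<psi> \<xi> * cis (\<xi> * t) * G (\<epsilon> n * \<xi>)) \<le> cmod (fourier \<psi> \<xi>)" for n
      using G by (intro AE_I2) (auto simp: norm_mult abs_of_nonneg intro!: mult_left_le)
  qed (use fint in auto)
  then have lim1: "(\<lambda>n. LINT \<xi>|lborel. fourier \<psi> \<xi> * cis (\<xi> * t) * G (\<epsilon> n * \<xi>)) \<longlonglongrightarrow> moment_transform (fourier \<psi>) 0 t"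
    by (simp add: moment_transform_def G_def)
  obtain B where B: "\<And>s. cmod (\<psi> s) \<le> B"
  proof -
    obtain K where K: "compact K" "\<And>t. t \<notin> K \<Longrightarrow> \<psi> t = 0" using Cc_infE[OF \<psi>] by metis
    have "bounded (\<psi> ` K)"
      using K(1) cont by (intro compact_imp_bounded compact_continuous_image) (auto intro: continuous_on_subset)
    then obtain B where "\<And>s. s \<in> K \<Longrightarrow> cmod (\<psi> s) \<le> B" unfolding bounded_iff by auto
    then have "cmod (\<psi> s) \<le> max B 0" for s using K(2)[of s] by (cases "s \<in> K") (auto simp: max.coboundedI1)
    then show ?thesis by (rule that)
  qed
  have "(\<lambda>n. LINT x|lborel. \<psi> (t + \<epsilon> n * x) * G x) \<longlonglongrightarrow> (LINT x|lborel. \<psi> (t + 0 * x) * G x)"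
  proof (rule integral_dominated_convergence[where w = "\<lambda>x. B * G x"])
    show "AE x in lborel. (\<lambda>n. \<psi> (t + \<epsilon> n * x) * G x) \<longlonglongrightarrow> \<psi> (t + 0 * x) * G x"
    proof (intro AE_I2 tendsto_mult tendsto_const)
      fix x
      have "isCont \<psi> (t + 0 * x)" using cont by (simp add: continuous_on_eq_continuous_at)
      then show "(\<lambda>n. \<psi> (t + \<epsilon> n * x)) \<longlonglongrightarrow> \<psi> (t + 0 * x)"
        by (rule isCont_tendsto_compose) (intro tendsto_intros \<epsilon>)
    qed
    show "AE x in lborel. norm (\<psi> (t + \<epsilon> n * x) * G x) \<le> B * G x" for n
      using B G by (auto simp: norm_mult abs_of_nonneg intro!: mult_right_mono)
  qed (use G in auto)
  moreover have "complex_of_real (LINT x|lborel. G x) = complex_of_real (sqrt (2 * pi))"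
    using fourier_gauss[of 0] by (simp add: G_def[abs_def] cis_conv_exp)
  then have "(LINT x|lborel. G x) = sqrt (2 * pi)" by (simp only: of_real_eq_iff)
  ultimately have "(\<lambda>n. sqrt (2 * pi) * (LINT x|lborel. \<psi> (t + \<epsilon> n * x) * G x)) \<longlonglongrightarrow> sqrt (2 * pi) * (\<psi> t * sqrt (2 * pi))"
    by (intro tendsto_mult tendsto_const) simp
  also have "complex_of_real (sqrt (2 * pi)) * (\<psi> t * sqrt (2 * pi)) = 2 * pi * \<psi> t"
  proof -
    have "complex_of_real (sqrt (2 * pi)) * complex_of_real (sqrt (2 * pi)) = complex_of_real (2 * pi)"
      unfolding of_real_mult[symmetric] by simp
    then show ?thesis by (metis mult.assoc mult.commute of_real_mult of_real_numeral)
  qed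
  finally show ?thesis
    using LIMSEQ_unique[OF lim1] by (simp add: eq[OF \<epsilon>(1)])
qed

section \<open>Functionals of finite order on the line\<close>

text \<open>In charts, and after multiplication by a cutoff, a distribution becomes a compactly supported
  distribution on the line, that is, a functional of the following kind.\<close>

definition finite_order :: "nat \<Rightarrow> ((real \<Rightarrow> complex) \<Rightarrow> complex) \<Rightarrow> bool" where
  "finite_order n V \<longleftrightarrow>
     (\<forall>f g. smooth_on UNIV f \<longrightarrow> smooth_on UNIV g \<longrightarrow> V (\<lambda>t. f t + g t) = V f + V g) \<and>
     (\<forall>k f. smooth_on UNIV f \<longrightarrow> V (\<lambda>t. k * f t) = k * V f) \<and>
     (\<exists>C R. \<forall>f B. smooth_on UNIV f \<longrightarrow> 0 \<le> B \<longrightarrow>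
        (\<forall>j\<le>n. \<forall>t. \<bar>t\<bar> \<le> R \<longrightarrow> cmod ((vderiv ^^ j) f t) \<le> B) \<longrightarrow> cmod (V f) \<le> C * B)"

lemma finite_order_add:
  "finite_order n V \<Longrightarrow> smooth_on UNIV f \<Longrightarrow> smooth_on UNIV g \<Longrightarrow> V (\<lambda>t. f t + g t) = V f + V g"
  and finite_order_scale: "finite_order n V \<Longrightarrow> smooth_on UNIV f \<Longrightarrow> V (\<lambda>t. k * f t) = k * V f"
  by (auto simp: finite_order_def)

lemma smooth_on_scale: "smooth_on U f \<Longrightarrow> open U \<Longrightarrow> smooth_on U (\<lambda>t. k * f t :: complex)"
  by (intro smooth_on_mult smooth_on_const)

lemma finite_order_diff:
  assumes "finite_order n V" "smooth_on UNIV f" "smooth_on UNIV g"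
  shows "V (\<lambda>t. f t - g t) = V f - V g"
  using finite_order_add[OF assms(1,2) smooth_on_scale[OF assms(3), of "-1"]]
    finite_order_scale[OF assms(1,3), of "-1"] by simp

lemma finite_orderE:
  assumes "finite_order n V"
  obtains C R where "0 \<le> C" "0 \<le> R"
    "\<And>f B. smooth_on UNIV f \<Longrightarrow> 0 \<le> B \<Longrightarrow> (\<And>j t. j \<le> n \<Longrightarrow> \<bar>t\<bar> \<le> R \<Longrightarrow> cmod ((vderiv ^^ j) f t) \<le> B) \<Longrightarrow>
      cmod (V f) \<le> C * B"
proof -
  obtain C R where "\<forall>f B. smooth_on UNIV f \<longrightarrow> 0 \<le> B \<longrightarrow>
      (\<forall>j\<le>n. \<forall>t. \<bar>t\<bar> \<le> R \<longrightarrow> cmod ((vderiv ^^ j) f t) \<le> B) \<longrightarrow> cmod (V f) \<le> C * B"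
    using assms unfolding finite_order_def by (elim conjE exE)
  then have CR: "\<And>f B. smooth_on UNIV f \<Longrightarrow> 0 \<le> B \<Longrightarrow>
      (\<And>j t. j \<le> n \<Longrightarrow> \<bar>t\<bar> \<le> R \<Longrightarrow> cmod ((vderiv ^^ j) f t) \<le> B) \<Longrightarrow> cmod (V f) \<le> C * B"
    by simp
  show ?thesis
  proof (rule that[of "max C 0" "max R 0"])
    fix f B assume f: "smooth_on UNIV f" "0 \<le> B"
      "\<And>j t. j \<le> n \<Longrightarrow> \<bar>t\<bar> \<le> max R 0 \<Longrightarrow> cmod ((vderiv ^^ j) f t) \<le> B"
    have "cmod (V f) \<le> C * B" by (rule CR) (use f in auto)
    also have "\<dots> \<le> max C 0 * B" using f(2) by (intro mult_right_mono) auto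
    finally show "cmod (V f) \<le> max C 0 * B" .
  qed auto
qed

lemma vderiv_pow_cis: "(vderiv ^^ j) (\<lambda>t. cis (a * t)) t = (\<i> * a) ^ j * cis (a * t)"
proof -
  have "(vderiv ^^ j) ((\<lambda>j t. (\<i> * a) ^ j * cis (a * t)) 0) t = (\<i> * a) ^ j * cis (a * t)"
    by (rule vderiv_pow_sequence[of UNIV])
      (auto simp: cis_conv_exp intro!: derivative_eq_intros has_vector_derivative_real_field)
  then show ?thesis by simp
qed

lemma power_le_one_plus_power: "j \<le> n \<Longrightarrow> \<bar>a::real\<bar> ^ j \<le> (1 + \<bar>a\<bar>) ^ n"
  using power_mono[of "\<bar>a\<bar>" "1 + \<bar>a\<bar>" j] power_increasing[of j n "1 + \<bar>a\<bar>"] by linarith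

lemma finite_order_cis_bound:
  assumes "finite_order n V"
  obtains C where "0 \<le> C" "\<And>a. cmod (V (\<lambda>t. cis (a * t))) \<le> C * (1 + \<bar>a\<bar>) ^ n"
proof -
  obtain C R where C: "0 \<le> C" "\<And>f B. smooth_on UNIV f \<Longrightarrow> 0 \<le> B \<Longrightarrow>
      (\<And>j t. j \<le> n \<Longrightarrow> \<bar>t\<bar> \<le> R \<Longrightarrow> cmod ((vderiv ^^ j) f t) \<le> B) \<Longrightarrow> cmod (V f) \<le> C * B"
    using finite_orderE[OF assms] by metis
  have "cmod (V (\<lambda>t. cis (a * t))) \<le> C * (1 + \<bar>a\<bar>) ^ n" for a
    by (rule C(2)[OF smooth_on_cis])
      (auto simp: vderiv_pow_cis norm_mult norm_power power_le_one_plus_power)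
  then show ?thesis using that C(1) by blast
qed

text \<open>A jointly continuous kernel depends continuously on its parameter, uniformly on compact sets. It
  is used for the derivatives of order at most \<open>n\<close> of exponentials.\<close>

lemma eventually_uniformly_close:
  fixes k :: "nat \<Rightarrow> real \<Rightarrow> real \<Rightarrow> complex"
  assumes "\<And>j. continuous_on UNIV (\<lambda>(a, t). k j a t)" "0 < e"
  shows "\<forall>\<^sub>F a in nhds c. \<forall>j\<in>{..n}. \<forall>t. \<bar>t\<bar> \<le> R \<longrightarrow> cmod (k j a t - k j c t) \<le> e"
proof (rule eventually_ball_finite, simp, rule ballI)
  fix j
  let ?S = "{c - 1..c + 1} \<times> {-R..R}"
  have "uniformly_continuous_on ?S (\<lambda>(a, t). k j a t)"
    by (intro compact_uniformly_continuous compact_Times compact_Icc)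
      (use assms(1) continuous_on_subset in blast)
  then obtain d where d: "d > 0" "\<And>p q. p \<in> ?S \<Longrightarrow> q \<in> ?S \<Longrightarrow> dist q p < d \<Longrightarrow>
      dist (case q of (a, t) \<Rightarrow> k j a t) (case p of (a, t) \<Rightarrow> k j a t) < e"
    using assms(2) unfolding uniformly_continuous_on_def by metis
  have "cmod (k j a t - k j c t) \<le> e" if "dist a c < min d 1" "\<bar>t\<bar> \<le> R" for a t
  proof -
    have "c - 1 \<le> a" "a \<le> c + 1" using that(1) by (auto simp: dist_real_def)
    then show ?thesis
      using d(2)[of "(c, t)" "(a, t)"] that by (auto simp: dist_Pair_Pair dist_norm abs_le_iff)
  qed
  then show "\<forall>\<^sub>F a in nhds c. \<forall>t. \<bar>t\<bar> \<le> R \<longrightarrow> cmod (k j a t - k j c t) \<le> e"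
    unfolding eventually_nhds_metric using d(1) by (intro exI[of _ "min d 1"]) auto
qed

lemma finite_order_cis_continuous:
  assumes V: "finite_order n V"
  shows "continuous_on UNIV (\<lambda>a. V (\<lambda>t. cis (a * t)))"
proof -
  obtain C R where C: "0 \<le> C" "\<And>f B. smooth_on UNIV f \<Longrightarrow> 0 \<le> B \<Longrightarrow>
      (\<And>j t. j \<le> n \<Longrightarrow> \<bar>t\<bar> \<le> R \<Longrightarrow> cmod ((vderiv ^^ j) f t) \<le> B) \<Longrightarrow> cmod (V f) \<le> C * B"
    using finite_orderE[OF V] by metis
  have "isCont (\<lambda>a. V (\<lambda>t. cis (a * t))) c" for c
    unfolding isCont_def
  proof (rule tendstoI)
    fix e :: real assume "e > 0"
    define e' where "e' = e / (C + 1)"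
    have e': "e' > 0" "C * e' < e" using \<open>e > 0\<close> C(1) by (auto simp: e'_def field_simps)
    have "\<forall>\<^sub>F a in nhds c. \<forall>j\<in>{..n}. \<forall>t. \<bar>t\<bar> \<le> R \<longrightarrow>
        cmod ((\<i> * a) ^ j * cis (a * t) - (\<i> * c) ^ j * cis (c * t)) \<le> e'"
      by (rule eventually_uniformly_close[OF _ e'(1)])
        (auto simp: cis_conv_exp case_prod_unfold intro!: continuous_intros)
    then have "\<forall>\<^sub>F a in nhds c. dist (V (\<lambda>t. cis (a * t))) (V (\<lambda>t. cis (c * t))) < e"
    proof (rule eventually_mono)
      fix a assume a: "\<forall>j\<in>{..n}. \<forall>t. \<bar>t\<bar> \<le> R \<longrightarrow>
        cmod ((\<i> * a) ^ j * cis (a * t) - (\<i> * c) ^ j * cis (c * t)) \<le> e'"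
      have smooth: "smooth_on UNIV (\<lambda>t. - 1 * cis (c * t))" by (intro smooth_on_scale smooth_on_cis open_UNIV)
      have "(vderiv ^^ j) (\<lambda>t. cis (a * t) - cis (c * t)) t = (\<i> * a) ^ j * cis (a * t) - (\<i> * c) ^ j * cis (c * t)" for j t
        using vderiv_pow_add[OF smooth_on_cis smooth open_UNIV UNIV_I, of j a t]
          vderiv_pow_linear[OF smooth_on_cis open_UNIV UNIV_I bounded_linear_minus[OF bounded_linear_ident], of j c t]
        by (simp add: vderiv_pow_cis)
      moreover have "smooth_on UNIV (\<lambda>t. cis (a * t) - cis (c * t))"
        using smooth_on_add[OF smooth_on_cis smooth] by simp
      ultimately have "cmod (V (\<lambda>t. cis (a * t) - cis (c * t))) \<le> C * e'"
        using a e'(1) by (intro C(2)) auto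
      then show "dist (V (\<lambda>t. cis (a * t))) (V (\<lambda>t. cis (c * t))) < e"
        using e'(2) finite_order_diff[OF V smooth_on_cis smooth_on_cis, of a c] by (simp add: dist_norm)
    qed
    then show "\<forall>\<^sub>F a in at c. dist (V (\<lambda>t. cis (a * t))) (V (\<lambda>t. cis (c * t))) < e"
      by (auto simp: eventually_at_filter elim: eventually_mono)
  qed
  then show ?thesis by (simp add: continuous_at_imp_continuous_on)
qed

lemma all_moments_indicator:
  assumes "all_moments w" "A \<in> sets borel"
  shows "all_moments (\<lambda>\<xi>. indicator A \<xi> * w \<xi>)"
  unfolding all_moments_def
proof (intro conjI allI)
  have [measurable]: "w \<in> borel_measurable borel" using assms(1) by (simp add: all_moments_def)
  note [measurable] = assms(2)
  show "(\<lambda>\<xi>. indicator A \<xi> * w \<xi>) \<in> borel_measurable borel" by measurable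
  fix j
  show "integrable lborel (\<lambda>\<xi>. \<bar>\<xi>\<bar> ^ j * cmod (indicator A \<xi> * w \<xi>))"
  proof (rule Bochner_Integration.integrable_bound)
    show "integrable lborel (\<lambda>\<xi>. \<bar>\<xi>\<bar> ^ j * cmod (w \<xi>))" using assms(1) by (simp add: all_moments_def)
  qed (auto simp: norm_mult indicator_def)
qed

lemma all_moments_weight:
  assumes "all_moments w" shows "integrable lborel (\<lambda>\<xi>. (1 + \<bar>\<xi>\<bar>) ^ n * cmod (w \<xi>))"
proof -
  have "(\<lambda>\<xi>. (1 + \<bar>\<xi>\<bar>) ^ n * cmod (w \<xi>)) = (\<lambda>\<xi>. \<Sum>j\<le>n. of_nat (n choose j) * (\<bar>\<xi>\<bar> ^ (n - j) * cmod (w \<xi>)))"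
    by (auto simp: binomial_ring sum_distrib_right mult.assoc)
  then show ?thesis using assms
    by (auto simp: all_moments_def intro!: Bochner_Integration.integrable_sum integrable_mult_right)
qed

lemma moment_transform_add:
  assumes "all_moments v" "all_moments w"
  shows "moment_transform (\<lambda>\<xi>. v \<xi> + w \<xi>) j t = moment_transform v j t + moment_transform w j t"
  unfolding moment_transform_def
  using Bochner_Integration.integral_add[OF moment_transform_integrable[OF assms(1), of j t]
      moment_transform_integrable[OF assms(2), of j t]]
  by (simp add: algebra_simps)

text \<open>A functional of finite order may be applied under the integral sign of an inverse Fourier
  transform. Over a short interval around \<open>c\<close> the integrand is nearly constant, together with all the
  derivatives that the functional sees, so the two sides differ by a small multiple of the length of
  the interval. Subdividing an interval makes the difference there as small as desired, and the
  contribution of the complement of a large interval is controlled by the moments of \<open>w\<close>.\<close>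

theorem finite_order_moment_transform:
  assumes V: "finite_order n V" and w: "all_moments w" "continuous_on UNIV w"
  shows "V (moment_transform w 0) = (LINT a|lborel. w a * V (\<lambda>t. cis (a * t)))"
proof -
  define E where "E a = V (\<lambda>t. cis (a * t))" for a
  define D where "D f = V (moment_transform f 0) - (LINT a|lborel. f a * E a)" for f
  obtain C R where C: "0 \<le> C" "0 \<le> R" "\<And>f B. smooth_on UNIV f \<Longrightarrow> 0 \<le> B \<Longrightarrow>
      (\<And>j t. j \<le> n \<Longrightarrow> \<bar>t\<bar> \<le> R \<Longrightarrow> cmod ((vderiv ^^ j) f t) \<le> B) \<Longrightarrow> cmod (V f) \<le> C * B"
    using finite_orderE[OF V] by metis
  obtain C' where C': "0 \<le> C'" "\<And>a. cmod (E a) \<le> C' * (1 + \<bar>a\<bar>) ^ n"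
    unfolding E_def using finite_order_cis_bound[OF V] by metis
  have contE: "continuous_on UNIV E"
    unfolding E_def[abs_def] by (rule finite_order_cis_continuous[OF V])
  then have [measurable]: "E \<in> borel_measurable borel" by (rule borel_measurable_continuous_onI)
  have intE: "integrable lborel (\<lambda>a. f a * E a)"
    and leE: "cmod (LINT a|lborel. f a * E a) \<le> C' * (LINT a|lborel. (1 + \<bar>a\<bar>) ^ n * cmod (f a))"
    if f: "all_moments f" for f
  proof -
    have [measurable]: "f \<in> borel_measurable borel" using f by (simp add: all_moments_def)
    have int: "integrable lborel (\<lambda>a. C' * ((1 + \<bar>a\<bar>) ^ n * cmod (f a)))"
      using all_moments_weight[OF f] by simp
    have le: "norm (f a * E a) \<le> C' * ((1 + \<bar>a\<bar>) ^ n * cmod (f a))" for a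
      using mult_left_mono[OF C'(2)[of a], of "cmod (f a)"] by (simp add: norm_mult mult_ac)
    show "integrable lborel (\<lambda>a. f a * E a)"
      by (rule Bochner_Integration.integrable_bound[OF int]) (use le in \<open>auto simp: order_trans[OF _ abs_ge_self]\<close>)
    have "cmod (LINT a|lborel. f a * E a) \<le> (LINT a|lborel. C' * ((1 + \<bar>a\<bar>) ^ n * cmod (f a)))"
      by (rule Bochner_Integration.integral_norm_bound_integral) (use \<open>integrable lborel (\<lambda>a. f a * E a)\<close> int le in auto)
    then show "cmod (LINT a|lborel. f a * E a) \<le> C' * (LINT a|lborel. (1 + \<bar>a\<bar>) ^ n * cmod (f a))" by simp
  qed
  have leV: "cmod (V (moment_transform f 0)) \<le> C * (LINT a|lborel. (1 + \<bar>a\<bar>) ^ n * cmod (f a))"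
    if f: "all_moments f" for f
  proof (rule C(3)[OF smooth_moment_transform[OF f]])
    show "0 \<le> (LINT a|lborel. (1 + \<bar>a\<bar>) ^ n * cmod (f a))" by simp
    fix j t assume j: "j \<le> n"
    have "cmod (moment_transform f j t) \<le> (LINT a|lborel. (1 + \<bar>a\<bar>) ^ n * cmod (f a))"
      unfolding moment_transform_def
    proof (rule Bochner_Integration.integral_norm_bound_integral[OF moment_transform_integrable[OF f] all_moments_weight[OF f]])
      show "norm ((\<i> * a) ^ j * f a * cis (a * t)) \<le> (1 + \<bar>a\<bar>) ^ n * cmod (f a)" for a
        using mult_right_mono[OF power_le_one_plus_power[OF j, of a], of "cmod (f a)"]
        by (simp add: norm_mult norm_power)
    qed
    then show "cmod ((vderiv ^^ j) (moment_transform f 0) t) \<le> (LINT a|lborel. (1 + \<bar>a\<bar>) ^ n * cmod (f a))"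
      by (simp add: vderiv_moment_transform[OF f])
  qed
  have D_add: "D (\<lambda>a. f a + g a) = D f + D g" if "all_moments f" "all_moments g" for f g
  proof -
    have "moment_transform (\<lambda>a. f a + g a) 0 = (\<lambda>t. moment_transform f 0 t + moment_transform g 0 t)"
      using moment_transform_add[OF that] by auto
    then have "V (moment_transform (\<lambda>a. f a + g a) 0) = V (moment_transform f 0) + V (moment_transform g 0)"
      using finite_order_add[OF V smooth_moment_transform smooth_moment_transform] that by simp
    then show ?thesis
      using Bochner_Integration.integral_add[OF intE[OF that(1)] intE[OF that(2)]]
      by (simp add: D_def algebra_simps)
  qed
  define cut where "cut x y = (\<lambda>\<xi>. indicator {x<..y::real} \<xi> * w \<xi>)" for x y
  have cut: "all_moments (cut x y)" for x y
    unfolding cut_def by (rule all_moments_indicator[OF w(1)]) simp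
  have small: "\<exists>d>0. \<forall>x y. x \<le> c \<and> c \<le> y \<and> y - x < d \<longrightarrow> cmod (D (cut x y)) \<le> e * (y - x)"
    if "e > 0" for c e
  proof -
    define e' where "e' = e / (C + 1)"
    have "(C + 1) * e' = e" using C(1) by (simp add: e'_def)
    then have e': "e' > 0" "C * e' + e' = e"
      using \<open>e > 0\<close> C(1) by (simp add: e'_def, simp only: distrib_right mult_1_left)
    define k where "k j a t = (\<i> * a) ^ j * w a * cis (a * t)" for j a t
    have "\<forall>\<^sub>F a in nhds c. \<forall>j\<in>{..n}. \<forall>t. \<bar>t\<bar> \<le> R \<longrightarrow> cmod (k j a t - k j c t) \<le> e'"
      by (rule eventually_uniformly_close[OF _ e'(1)])
        (auto simp: k_def cis_conv_exp case_prod_unfold intro!: continuous_intros continuous_on_compose2[OF w(2)])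
    moreover have "\<forall>\<^sub>F a in nhds c. cmod (w a * E a - w c * E c) < e'"
      using continuous_on_mult[OF w(2) contE] e'(1)
      by (auto simp: continuous_on_eq_continuous_at isCont_def tendsto_iff dist_norm eventually_nhds_conv_at)
    ultimately obtain d where d: "d > 0"
      "\<And>a j t. dist a c < d \<Longrightarrow> j \<le> n \<Longrightarrow> \<bar>t\<bar> \<le> R \<Longrightarrow> cmod (k j a t - k j c t) \<le> e'"
      "\<And>a. dist a c < d \<Longrightarrow> cmod (w a * E a - w c * E c) \<le> e'"
      using eventually_conj unfolding eventually_nhds_metric by (smt (verit) atMost_iff)
    have "cmod (D (cut x y)) \<le> e * (y - x)" if xy: "x \<le> c" "c \<le> y" "y - x < d" for x y
    proof -
      have near: "dist a c < d" if "a \<in> {x<..y}" for a using that xy by (auto simp: dist_real_def)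
      have fi: "integrable lborel (indicator {x<..y} :: real \<Rightarrow> real)"
        using xy by (intro integrable_real_indicator) auto
      have bound: "cmod (LINT a|lborel. indicator {x<..y} a * (f a - f c)) \<le> e' * (y - x)"
        if "integrable lborel (\<lambda>a. indicator {x<..y} a * (f a - f c))" "\<And>a. dist a c < d \<Longrightarrow> cmod (f a - f c) \<le> e'"
        for f :: "real \<Rightarrow> complex"
      proof -
        have "cmod (LINT a|lborel. indicator {x<..y} a * (f a - f c)) \<le> (LINT a|lborel. e' * indicator {x<..y} a)"
          by (rule Bochner_Integration.integral_norm_bound_integral[OF that(1) integrable_mult_right[OF fi]])
            (use xy that(2) near in \<open>auto simp: norm_mult indicator_def\<close>)
        then show ?thesis using xy by simp
      qed
      have ind: "integrable lborel (\<lambda>a. indicator {x<..y} a * z)"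
        and ind_eq: "(LINT a|lborel. indicator {x<..y} a * z) = (y - x) * z" for z :: complex
      proof -
        have "integrable lborel (\<lambda>a. complex_of_real (indicator {x<..y} a))" using fi by (rule integrable_of_real)
        then show "integrable lborel (\<lambda>a. indicator {x<..y} a * z)" by (simp add: of_real_indicator)
        have "(LINT a|lborel. complex_of_real (indicator {x<..y} a)) = y - x"
          using xy by (subst integral_complex_of_real) simp
        then show "(LINT a|lborel. indicator {x<..y} a * z) = (y - x) * z" by (simp add: of_real_indicator)
      qed
      define g where "g t = moment_transform (cut x y) 0 t - ((y - x) * w c) * cis (c * t)" for t
      have smooth_cis: "smooth_on UNIV (\<lambda>t. ((y - x) * w c) * cis (c * t))"
        by (intro smooth_on_scale smooth_on_cis open_UNIV)
      have V_g: "V g = V (moment_transform (cut x y) 0) - ((y - x) * w c) * E c"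
        unfolding g_def[abs_def] E_def
        using finite_order_diff[OF V smooth_moment_transform[OF cut] smooth_cis, of x y 0]
          finite_order_scale[OF V smooth_on_cis] by simp
      have smooth_neg: "smooth_on UNIV (\<lambda>t. (- ((y - x) * w c)) * cis (c * t))"
        by (intro smooth_on_scale smooth_on_cis open_UNIV)
      have g_eq: "g = (\<lambda>t. moment_transform (cut x y) 0 t + (- ((y - x) * w c)) * cis (c * t))"
        by (simp add: g_def[abs_def])
      have "smooth_on UNIV g"
        unfolding g_eq by (intro smooth_on_add smooth_moment_transform cut smooth_neg open_UNIV)
      moreover have "cmod ((vderiv ^^ j) g t) \<le> e' * (y - x)" if jt: "j \<le> n" "\<bar>t\<bar> \<le> R" for j t
      proof -
        have "(vderiv ^^ j) g t = moment_transform (cut x y) j t - (y - x) * k j c t"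
          unfolding g_eq
          by (simp only: vderiv_pow_add[OF smooth_moment_transform[OF cut] smooth_neg open_UNIV UNIV_I]
              vderiv_pow_linear[OF smooth_on_cis open_UNIV UNIV_I bounded_linear_mult_right]
              vderiv_moment_transform[OF cut] vderiv_pow_cis k_def) (simp add: mult_ac)
        also have "\<dots> = (LINT a|lborel. indicator {x<..y} a * k j a t) - (LINT a|lborel. indicator {x<..y} a * k j c t)"
          unfolding ind_eq by (simp add: moment_transform_def cut_def k_def mult_ac)
        also have "\<dots> = (LINT a|lborel. indicator {x<..y} a * (k j a t - k j c t))"
          using moment_transform_integrable[OF cut, of j x y t] ind[of "k j c t"]
          by (subst Bochner_Integration.integral_diff[symmetric]) (auto simp: cut_def k_def mult_ac algebra_simps)
        finally have eq: "(vderiv ^^ j) g t = (LINT a|lborel. indicator {x<..y} a * (k j a t - k j c t))" .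
        have "integrable lborel (\<lambda>a. indicator {x<..y} a * k j a t - indicator {x<..y} a * k j c t)"
          using moment_transform_integrable[OF cut, of j x y t]
          by (intro Bochner_Integration.integrable_diff ind) (simp add: cut_def k_def mult_ac)
        then have "integrable lborel (\<lambda>a. indicator {x<..y} a * (k j a t - k j c t))"
          by (simp add: right_diff_distrib)
        then show ?thesis unfolding eq using d(2) jt by (intro bound) auto
      qed
      ultimately have "cmod (V g) \<le> C * (e' * (y - x))"
        using e' xy by (intro C(3)) auto
      moreover have "cmod ((LINT a|lborel. cut x y a * E a) - (y - x) * (w c * E c)) \<le> e' * (y - x)"
      proof -
        have i1: "integrable lborel (\<lambda>a. indicator {x<..y} a * (w a * E a))"
          using intE[OF cut, of x y] by (simp add: cut_def mult_ac)
        have "(LINT a|lborel. cut x y a * E a) - (y - x) * (w c * E c) =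
            (LINT a|lborel. indicator {x<..y} a * (w a * E a)) - (LINT a|lborel. indicator {x<..y} a * (w c * E c))"
          unfolding ind_eq by (simp add: cut_def mult_ac)
        also have "\<dots> = (LINT a|lborel. indicator {x<..y} a * (w a * E a - w c * E c))"
          using i1 ind[of "w c * E c"] by (subst Bochner_Integration.integral_diff[symmetric]) (auto simp: algebra_simps)
        finally have eq: "(LINT a|lborel. cut x y a * E a) - (y - x) * (w c * E c) =
          (LINT a|lborel. indicator {x<..y} a * (w a * E a - w c * E c))" .
        have "integrable lborel (\<lambda>a. indicator {x<..y} a * (w a * E a) - indicator {x<..y} a * (w c * E c))"
          by (intro Bochner_Integration.integrable_diff ind i1)
        then have "integrable lborel (\<lambda>a. indicator {x<..y} a * (w a * E a - w c * E c))"
          by (simp add: right_diff_distrib)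
        then show ?thesis unfolding eq by (rule bound) (rule d(3))
      qed
      moreover have D_eq: "D (cut x y) = V g - ((LINT a|lborel. cut x y a * E a) - (y - x) * (w c * E c))"
        by (simp add: D_def V_g mult_ac)
      ultimately have "cmod (D (cut x y)) \<le> C * (e' * (y - x)) + e' * (y - x)"
        unfolding D_eq
        using norm_triangle_ineq4[of "V g" "(LINT a|lborel. cut x y a * E a) - (y - x) * (w c * E c)"]
        by linarith
      also have "\<dots> = e * (y - x)" by (simp add: e'(2)[symmetric] algebra_simps)
      finally show ?thesis .
    qed
    then show ?thesis using d(1) by blast
  qed
  have cut_join: "D (cut x z) = D (cut x y) + D (cut y z)" if "x \<le> y" "y \<le> z" for x y z
  proof -
    have "cut x z = (\<lambda>a. cut x y a + cut y z a)"
      using that by (auto simp: cut_def indicator_def)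
    then show ?thesis using D_add[OF cut cut] by simp
  qed
  have D_cut: "D (cut x y) = 0" if "x \<le> y" for x y
  proof -
    \<comment> \<open>The estimate is additive over adjacent intervals and holds for short ones, hence for all.\<close>
    have le: "cmod (D (cut x y)) \<le> e * (y - x)" if "e > 0" for e
      using \<open>x \<le> y\<close>
    proof (induction rule: Bolzano)
      case (trans a b c)
      then show ?case using norm_triangle_ineq[of "D (cut a b)" "D (cut b c)"]
        by (simp add: cut_join[of a b c] algebra_simps)
    next
      case (local c)
      then show ?case using small[OF \<open>e > 0\<close>, of c] by blast
    qed
    have "cmod (D (cut x y)) \<le> 0 + e" if "e > 0" for e
    proof -
      have "cmod (D (cut x y)) \<le> e / (1 + (y - x)) * (y - x)"
        using that \<open>x \<le> y\<close> by (intro le) simp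
      also have "\<dots> \<le> e" using that \<open>x \<le> y\<close> by (simp add: field_simps)
      finally show ?thesis by simp
    qed
    then have "cmod (D (cut x y)) \<le> 0" by (rule field_le_epsilon)
    then show ?thesis by simp
  qed
  define tail where "tail m = (\<lambda>\<xi>. indicator (- {- real m<..real m}) \<xi> * w \<xi>)" for m
  have tail: "all_moments (tail m)" for m
    unfolding tail_def by (rule all_moments_indicator[OF w(1)]) simp
  have "cmod (D w) \<le> (C + C') * (LINT a|lborel. (1 + \<bar>a\<bar>) ^ n * cmod (tail m a))" for m
  proof -
    have "w = (\<lambda>a. cut (- real m) (real m) a + tail m a)"
      by (auto simp: cut_def tail_def indicator_def)
    then have "D w = D (cut (- real m) (real m)) + D (tail m)"
      using D_add[OF cut tail, of "- real m" "real m" m] by simp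
    then have "D w = D (tail m)" using D_cut[of "- real m" "real m"] by simp
    then have "cmod (D w) \<le> cmod (V (moment_transform (tail m) 0)) + cmod (LINT a|lborel. tail m a * E a)"
      by (simp add: D_def norm_triangle_ineq4)
    then show ?thesis using leV[OF tail, of m] leE[OF tail, of m] by (simp add: algebra_simps)
  qed
  moreover have "(\<lambda>m. LINT a|lborel. (1 + \<bar>a\<bar>) ^ n * cmod (tail m a)) \<longlonglongrightarrow> integral\<^sup>L lborel (\<lambda>a::real. 0::real)"
  proof (rule integral_dominated_convergence[where w = "\<lambda>a. (1 + \<bar>a\<bar>) ^ n * cmod (w a)"])
    have [measurable]: "w \<in> borel_measurable borel" using w(1) by (simp add: all_moments_def)
    show "(\<lambda>a. (1 + \<bar>a\<bar>) ^ n * cmod (tail m a)) \<in> borel_measurable lborel" for m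
      unfolding tail_def by measurable
    show "AE a in lborel. (\<lambda>m. (1 + \<bar>a\<bar>) ^ n * cmod (tail m a)) \<longlonglongrightarrow> 0"
    proof (rule AE_I2)
      fix a :: real
      obtain M :: nat where "\<bar>a\<bar> < real M" using reals_Archimedean2 by blast
      then have "\<forall>m\<ge>M. (1 + \<bar>a\<bar>) ^ n * cmod (tail m a) = 0"
        by (auto simp: tail_def indicator_def)
      then show "(\<lambda>m. (1 + \<bar>a\<bar>) ^ n * cmod (tail m a)) \<longlonglongrightarrow> 0"
        by (intro tendsto_eventually) (auto simp: eventually_sequentially)
    qed
    show "AE a in lborel. norm ((1 + \<bar>a\<bar>) ^ n * cmod (tail m a)) \<le> (1 + \<bar>a\<bar>) ^ n * cmod (w a)" for m
      by (auto simp: tail_def norm_mult indicator_def)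
  qed (use all_moments_weight[OF w(1)] in auto)
  ultimately have "cmod (D w) \<le> (C + C') * 0"
    by (intro LIMSEQ_le_const[OF tendsto_mult[OF tendsto_const, of _ 0]]) auto
  then show ?thesis by (simp add: D_def E_def)
qed

lemma finite_order_integral:
  assumes \<psi>: "\<psi> \<in> Cc_inf J"
  shows "finite_order 0 (\<lambda>h. LINT t|lborel. \<psi> t * h t)"
  unfolding finite_order_def
proof (intro conjI allI impI)
  have int: "integrable lborel (\<lambda>t. \<psi> t * h t)" if "smooth_on UNIV h" for h
    using Cc_inf_times_integrable[OF \<psi> smooth_on_continuous[OF that]] .
  fix f g :: "real \<Rightarrow> complex" assume "smooth_on UNIV f" "smooth_on UNIV g"
  then show "(LINT t|lborel. \<psi> t * (f t + g t)) = (LINT t|lborel. \<psi> t * f t) + (LINT t|lborel. \<psi> t * g t)"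
    using Bochner_Integration.integral_add[OF int[of f] int[of g]] by (simp add: algebra_simps)
next
  fix k :: complex and f :: "real \<Rightarrow> complex"
  show "(LINT t|lborel. \<psi> t * (k * f t)) = k * (LINT t|lborel. \<psi> t * f t)"
    by (subst integral_mult_right_zero[symmetric]) (simp add: mult_ac)
next
  obtain K where K: "compact K" "\<And>t. t \<notin> K \<Longrightarrow> \<psi> t = 0" using Cc_infE[OF \<psi>] by metis
  obtain R where R: "\<And>t. t \<in> K \<Longrightarrow> \<bar>t\<bar> \<le> R"
    using compact_imp_bounded[OF K(1)] unfolding bounded_iff by auto
  have "cmod (LINT t|lborel. \<psi> t * f t) \<le> (LINT t|lborel. cmod (\<psi> t)) * B"
    if f: "smooth_on UNIV f" and B: "\<forall>j\<le>0. \<forall>t. \<bar>t\<bar> \<le> R \<longrightarrow> cmod ((vderiv ^^ j) f t) \<le> B" for f B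
  proof -
    have "cmod (\<psi> t * f t) \<le> cmod (\<psi> t) * B" for t
      using B R[of t] K(2)[of t] by (cases "t \<in> K") (auto simp: norm_mult intro!: mult_left_mono)
    then have "cmod (LINT t|lborel. \<psi> t * f t) \<le> (LINT t|lborel. cmod (\<psi> t) * B)"
      by (intro Bochner_Integration.integral_norm_bound_integral)
        (auto intro!: Cc_inf_times_integrable[OF \<psi>] smooth_on_continuous[OF f] integrable_mult_left
          integrable_norm Cc_inf_integrable[OF \<psi>])
    then show ?thesis by simp
  qed
  then show "\<exists>C R. \<forall>f B. smooth_on UNIV f \<longrightarrow> 0 \<le> B \<longrightarrow>
      (\<forall>j\<le>0. \<forall>t. \<bar>t\<bar> \<le> R \<longrightarrow> cmod ((vderiv ^^ j) f t) \<le> B) \<longrightarrow>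
      cmod (LINT t|lborel. \<psi> t * f t) \<le> C * B" by blast
qed

lemma finite_order_transform_continuous:
  assumes "finite_order n V" shows "continuous_on UNIV (\<lambda>\<xi>. V (\<lambda>t. cis (- (\<xi> * t))))"
proof -
  have "continuous_on UNIV (\<lambda>\<xi>::real. - \<xi>)" by (intro continuous_intros)
  from continuous_on_compose2[OF finite_order_cis_continuous[OF assms] this] show ?thesis by simp
qed

lemma fourier_continuous: "\<psi> \<in> Cc_inf J \<Longrightarrow> continuous_on UNIV (fourier \<psi>)"
  unfolding fourier_def[abs_def]
  using finite_order_transform_continuous[OF finite_order_integral] .

text \<open>A compactly supported distribution whose Fourier transform has all moments is a smooth function:
  write the test function by Fourier inversion, apply the functional under the integral sign and
  exchange the two integrations.\<close>

theorem finite_order_representation: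
  assumes V: "finite_order n V" and moments: "all_moments (\<lambda>\<xi>. V (\<lambda>t. cis (- (\<xi> * t))))"
  obtains g where "smooth_on UNIV g"
    "\<And>\<psi>. \<psi> \<in> Cc_inf UNIV \<Longrightarrow> V \<psi> = (LINT t|lborel. g t * \<psi> t)"
proof
  define v where "v \<xi> = V (\<lambda>t. cis (- (\<xi> * t)))" for \<xi>
  define g where "g t = 1 / (2 * pi) * moment_transform v 0 t" for t
  have v: "all_moments v" using moments by (simp add: v_def[abs_def])
  then have intv: "integrable lborel v" using moment_transform_integrable[of v 0 0] by simp
  show "smooth_on UNIV g"
    unfolding g_def[abs_def] by (intro smooth_on_scale smooth_moment_transform v open_UNIV)
  fix \<psi> :: "real \<Rightarrow> complex" assume \<psi>: "\<psi> \<in> Cc_inf UNIV"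
  have inner: "(LINT a|lborel. v (0 + - 1 * a) * cis (- 1 * a * t)) = moment_transform v 0 t" for t
    using lborel_integral_real_affine[of "-1" "\<lambda>a. v a * cis (a * t)" 0] by (simp add: moment_transform_def)
  have "V \<psi> = V (\<lambda>t. complex_of_real (1 / (2 * pi)) * moment_transform (fourier \<psi>) 0 t)"
    by (simp add: fourier_inversion[OF \<psi>])
  also have "\<dots> = 1 / (2 * pi) * V (moment_transform (fourier \<psi>) 0)"
    by (intro finite_order_scale[OF V] smooth_moment_transform fourier_all_moments[OF \<psi>])
  also have "V (moment_transform (fourier \<psi>) 0) = (LINT a|lborel. fourier \<psi> a * V (\<lambda>t. cis (a * t)))"
    by (intro finite_order_moment_transform[OF V] fourier_all_moments[OF \<psi>] fourier_continuous[OF \<psi>])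
  also have "\<dots> = (LINT a|lborel. v (0 + - 1 * a) * (LINT t|lborel. \<psi> t * cis (- 1 * a * t)))"
    by (simp add: v_def fourier_def mult.commute)
  also have "\<dots> = (LINT t|lborel. \<psi> t * (LINT a|lborel. v (0 + - 1 * a) * cis (- 1 * a * t)))"
    by (intro fubini_cis Cc_inf_integrable[OF \<psi>] lborel_integrable_real_affine[OF intv]) simp
  also have "\<dots> = (LINT t|lborel. \<psi> t * moment_transform v 0 t)" by (simp only: inner)
  also have "complex_of_real (1 / (2 * pi)) * (LINT t|lborel. \<psi> t * moment_transform v 0 t) = (LINT t|lborel. g t * \<psi> t)"
    by (subst integral_mult_right_zero[symmetric]) (simp add: g_def mult_ac)
  finally show "V \<psi> = (LINT t|lborel. g t * \<psi> t)" .
qed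

text \<open>By completing a square, \<open>2 |\<xi>|\<^sup>j |v| \<le> (1 + \<xi>\<^sup>2) |\<xi>|\<^sup>2\<^sup>j |v|\<^sup>2 + 1 / (1 + \<xi>\<^sup>2)\<close>, so square integrability
  with all weights implies integrability with all weights.\<close>

lemma all_moments_sobolev:
  assumes [measurable]: "v \<in> borel_measurable borel"
    and int: "\<And>s::real. integrable lborel (\<lambda>\<xi>. (1 + \<xi>\<^sup>2) powr s * (cmod (v \<xi>))\<^sup>2)"
  shows "all_moments v"
  unfolding all_moments_def
proof (intro conjI allI)
  fix j
  show "integrable lborel (\<lambda>\<xi>. \<bar>\<xi>\<bar> ^ j * cmod (v \<xi>))"
  proof (rule Bochner_Integration.integrable_bound)
    show "integrable lborel (\<lambda>\<xi>. (1 + \<xi>\<^sup>2) powr real (Suc j) * (cmod (v \<xi>))\<^sup>2 + inverse (1 + \<xi>\<^sup>2))"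
      by (intro Bochner_Integration.integrable_add int integrable_inverse_square)
    show "AE \<xi> in lborel. norm (\<bar>\<xi>\<bar> ^ j * cmod (v \<xi>)) \<le>
        norm ((1 + \<xi>\<^sup>2) powr real (Suc j) * (cmod (v \<xi>))\<^sup>2 + inverse (1 + \<xi>\<^sup>2))"
    proof (rule AE_I2)
      fix \<xi> :: real
      define p where "p = 1 + \<xi>\<^sup>2"
      have p: "p > 0" by (simp add: p_def add_pos_nonneg)
      define a where "a = \<bar>\<xi>\<bar> ^ j * cmod (v \<xi>)"
      have "2 * a \<le> p * a\<^sup>2 + inverse p"
      proof -
        have "0 \<le> inverse p * (p * a - 1)\<^sup>2" using p by simp
        also have "\<dots> = p * a\<^sup>2 - 2 * a + inverse p"
          using p by (simp add: power2_eq_square field_simps)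
        finally show ?thesis by simp
      qed
      moreover have "a\<^sup>2 \<le> p ^ j * (cmod (v \<xi>))\<^sup>2"
      proof -
        have "(\<bar>\<xi>\<bar> ^ j)\<^sup>2 = (\<xi>\<^sup>2) ^ j" by (metis power2_abs power_mult mult.commute)
        also have "\<dots> \<le> p ^ j" unfolding p_def by (intro power_mono) auto
        finally show ?thesis unfolding a_def power_mult_distrib by (intro mult_right_mono) auto
      qed
      then have "p * a\<^sup>2 \<le> p ^ Suc j * (cmod (v \<xi>))\<^sup>2" using p by (simp add: mult.assoc)
      moreover have "0 \<le> a" "0 \<le> inverse p" using p by (auto simp: a_def)
      ultimately have "a \<le> p powr real (Suc j) * (cmod (v \<xi>))\<^sup>2 + inverse p"
        using powr_realpow[OF p, of "Suc j"] by simp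
      then show "norm (\<bar>\<xi>\<bar> ^ j * cmod (v \<xi>)) \<le>
          norm ((1 + \<xi>\<^sup>2) powr real (Suc j) * (cmod (v \<xi>))\<^sup>2 + inverse (1 + \<xi>\<^sup>2))"
        using \<open>0 \<le> a\<close> unfolding p_def a_def by simp
    qed
  qed measurable
qed simp

text \<open>The exponent leaves the integrable factor \<open>1 / (1 + \<xi>\<^sup>2)\<close>.\<close>

lemma sobolev_integrable_of_poly_bound:
  assumes [measurable]: "v \<in> borel_measurable borel" and "\<And>\<xi>. cmod (v \<xi>) \<le> C * (1 + \<bar>\<xi>\<bar>) ^ n"
  shows "integrable lborel (\<lambda>\<xi>. (1 + \<xi>\<^sup>2) powr (- real (Suc n)) * (cmod (v \<xi>))\<^sup>2)"
proof (rule Bochner_Integration.integrable_bound)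
  show "integrable lborel (\<lambda>\<xi>::real. (C\<^sup>2 * 2 ^ n) * inverse (1 + \<xi>\<^sup>2))"
    by (intro integrable_mult_right integrable_inverse_square)
  show "AE \<xi> in lborel. norm ((1 + \<xi>\<^sup>2) powr (- real (Suc n)) * (cmod (v \<xi>))\<^sup>2)
      \<le> norm ((C\<^sup>2 * 2 ^ n) * inverse (1 + \<xi>\<^sup>2))"
  proof (rule AE_I2)
    fix \<xi> :: real
    define p where "p = 1 + \<xi>\<^sup>2"
    have p: "p > 0" by (simp add: p_def add_pos_nonneg)
    have "(1 + \<bar>\<xi>\<bar>)\<^sup>2 \<le> 2 * p"
      using zero_le_power2[of "1 - \<bar>\<xi>\<bar>"] by (simp add: p_def power2_eq_square algebra_simps)
    then have "((1 + \<bar>\<xi>\<bar>)\<^sup>2) ^ n \<le> (2 * p) ^ n" by (intro power_mono) auto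
    then have "C\<^sup>2 * ((1 + \<bar>\<xi>\<bar>) ^ n)\<^sup>2 \<le> C\<^sup>2 * (2 * p) ^ n"
      by (intro mult_left_mono) (auto simp flip: power_mult simp: mult.commute)
    moreover have "(cmod (v \<xi>))\<^sup>2 \<le> (C * (1 + \<bar>\<xi>\<bar>) ^ n)\<^sup>2"
      using assms(2) by (intro power_mono) auto
    ultimately have "(cmod (v \<xi>))\<^sup>2 \<le> C\<^sup>2 * 2 ^ n * p ^ n" by (simp add: power_mult_distrib mult.assoc)
    moreover have pw: "p powr (- real (Suc n)) = inverse (p ^ n) * inverse p"
      using powr_minus[of p "real (Suc n)"] powr_realpow[OF p, of "Suc n"]
      by (simp only: power_Suc inverse_mult_distrib mult.commute)
    ultimately have "p powr (- real (Suc n)) * (cmod (v \<xi>))\<^sup>2 \<le> (inverse (p ^ n) * inverse p) * (C\<^sup>2 * 2 ^ n * p ^ n)"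
      using p by (intro mult_mono) auto
    also have "\<dots> = (C\<^sup>2 * 2 ^ n) * inverse p" using p by (simp add: field_simps)
    finally show "norm ((1 + \<xi>\<^sup>2) powr (- real (Suc n)) * (cmod (v \<xi>))\<^sup>2)
        \<le> norm ((C\<^sup>2 * 2 ^ n) * inverse (1 + \<xi>\<^sup>2))"
      unfolding p_def[symmetric] using p by simp
  qed
qed measurable

text \<open>The Cauchy--Schwarz inequality for the weight \<open>1 + \<xi>\<^sup>2\<close>: the \<open>H\<^sup>1\<close> norm dominates the \<open>L\<^sup>1\<close>
  norm of the Fourier transform.\<close>

lemma L1_le_H1:
  assumes [measurable]: "v \<in> borel_measurable borel" and int: "integrable lborel (\<lambda>\<xi>. (1 + \<xi>\<^sup>2) * (cmod (v \<xi>))\<^sup>2)"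
    and N: "sqrt (LINT \<xi>|lborel. (1 + \<xi>\<^sup>2) * (cmod (v \<xi>))\<^sup>2) \<le> N" "N > 0"
  shows "(LINT \<xi>|lborel. cmod (v \<xi>)) \<le> (1 + (LINT \<xi>|lborel. inverse (1 + \<xi>\<^sup>2))) * N"
proof -
  let ?h = "\<lambda>\<xi>. (1 + \<xi>\<^sup>2) * (cmod (v \<xi>))\<^sup>2"
  have le: "cmod (v \<xi>) \<le> inverse N * ?h \<xi> + N * inverse (1 + \<xi>\<^sup>2)" for \<xi>
  proof -
    define p a where "p = 1 + \<xi>\<^sup>2" and "a = cmod (v \<xi>)"
    have p: "p > 0" by (simp add: p_def add_pos_nonneg)
    have "0 \<le> inverse N * inverse p * (p * a - N)\<^sup>2" using p N by simp
    also have "\<dots> = inverse N * (p * a\<^sup>2) - 2 * a + N * inverse p"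
      using p N(2) by (simp add: power2_eq_square field_simps)
    finally have "2 * a \<le> inverse N * (p * a\<^sup>2) + N * inverse p" by simp
    moreover have "0 \<le> a" by (simp add: a_def)
    ultimately have "a \<le> inverse N * (p * a\<^sup>2) + N * inverse p" by linarith
    then show ?thesis by (simp only: p_def a_def)
  qed
  have nonneg: "0 \<le> inverse N * ?h \<xi> + N * inverse (1 + \<xi>\<^sup>2)" for \<xi>
    using N(2) by (intro add_nonneg_nonneg mult_nonneg_nonneg) auto
  have int2: "integrable lborel (\<lambda>\<xi>. inverse N * ?h \<xi> + N * inverse (1 + \<xi>\<^sup>2))"
    by (intro Bochner_Integration.integrable_add integrable_mult_right int integrable_inverse_square)
  have "integrable lborel (\<lambda>\<xi>. cmod (v \<xi>))"
    by (rule Bochner_Integration.integrable_bound[OF int2]) (use le nonneg in auto)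
  then have "(LINT \<xi>|lborel. cmod (v \<xi>)) \<le> (LINT \<xi>|lborel. inverse N * ?h \<xi> + N * inverse (1 + \<xi>\<^sup>2))"
    by (intro integral_mono int2 le)
  also have "\<dots> = inverse N * (LINT \<xi>|lborel. ?h \<xi>) + N * (LINT \<xi>|lborel. inverse (1 + \<xi>\<^sup>2))"
    using int integrable_inverse_square by simp
  also have "(LINT \<xi>|lborel. ?h \<xi>) \<le> N\<^sup>2"
    using N by (metis real_le_lsqrt real_sqrt_le_iff real_sqrt_abs abs_of_pos)
  then have "inverse N * (LINT \<xi>|lborel. ?h \<xi>) \<le> inverse N * N\<^sup>2" using N(2) by (intro mult_left_mono) auto
  also have "inverse N * N\<^sup>2 = N" using N(2) by (simp add: power2_eq_square)
  finally show ?thesis by (simp add: algebra_simps)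
qed

section \<open>Charts of a plane curve\<close>

lemma chartsD:
  assumes "(c, J) \<in> charts \<Gamma>"
  shows "open J" "smooth_on J c" "\<And>t. t \<in> J \<Longrightarrow> vderiv c t \<noteq> 0" "inj_on c J"
    "homeomorphism J (c ` J) c (inv_into J c)" "openin (top_of_set \<Gamma>) (c ` J)" "c ` J \<subseteq> \<Gamma>"
proof -
  show *: "open J" "smooth_on J c" "\<And>t. t \<in> J \<Longrightarrow> vderiv c t \<noteq> 0"
    "homeomorphism J (c ` J) c (inv_into J c)" "openin (top_of_set \<Gamma>) (c ` J)"
    using assms by (auto simp: charts_def)
  show "inj_on c J"
    by (rule inj_on_inverseI[of _ "inv_into J c"]) (rule homeomorphism_apply1[OF *(4)])
  show "c ` J \<subseteq> \<Gamma>" by (rule openin_imp_subset[OF *(5)])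
qed

text \<open>Here the second chart is the source: its parameters \<open>t\<close> are sent to the parameters of the same
  points in the first chart.\<close>

definition overlap :: "chart \<Rightarrow> chart \<Rightarrow> real set" where
  "overlap = (\<lambda>(c, J) (c', J'). {t \<in> J'. c' t \<in> c ` J})"

definition transition :: "chart \<Rightarrow> chart \<Rightarrow> real \<Rightarrow> real" where
  "transition = (\<lambda>(c, J) (c', J') t. inv_into J c (c' t))"

lemma overlap_iff: "t \<in> overlap (c, J) (c', J') \<longleftrightarrow> t \<in> J' \<and> c' t \<in> c ` J"
  by (simp add: overlap_def)

lemma transition_in:
  assumes "t \<in> overlap (c, J) (c', J')"
  shows "transition (c, J) (c', J') t \<in> J" "c (transition (c, J) (c', J') t) = c' t"
  using assms by (auto simp: overlap_def transition_def inv_into_into f_inv_into_f)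

lemma open_overlap:
  assumes "(c, J) \<in> charts \<Gamma>" "(c', J') \<in> charts \<Gamma>" shows "open (overlap (c, J) (c', J'))"
proof -
  have "openin (top_of_set J') (J' \<inter> c' -` (c ` J))"
    by (rule continuous_openin_preimage[OF smooth_on_continuous[OF chartsD(2)[OF assms(2)]]])
      (use chartsD(6)[OF assms(1)] chartsD(7)[OF assms(2)] in auto)
  moreover have "J' \<inter> c' -` (c ` J) = overlap (c, J) (c', J')" by (auto simp: overlap_def)
  ultimately show ?thesis using chartsD(1)[OF assms(2)] openin_open_eq by fastforce
qed

text \<open>A transition map \<open>\<sigma>\<close> is continuous, since charts are homeomorphisms, and satisfies
  \<open>c (\<sigma> t) = c' t\<close>. Taking the component along the tangent vector \<open>e\<close> of \<open>c\<close> at the point in question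
  gives a scalar equation in which the left hand side has a derivative different from zero; in terms
  of difference quotients it can be solved for that of \<open>\<sigma>\<close>. Smoothness follows, because the formula
  expresses the derivative of \<open>\<sigma>\<close> by smooth functions and \<open>\<sigma>\<close> itself.\<close>

lemma transition_derivative:
  assumes \<kappa>: "(c, J) \<in> charts \<Gamma>" and \<kappa>': "(c', J') \<in> charts \<Gamma>" and t0: "t0 \<in> overlap (c, J) (c', J')"
  defines "\<sigma> \<equiv> transition (c, J) (c', J')"
  shows "(\<sigma> has_real_derivative
      (vderiv c' t0 \<bullet> vderiv c (\<sigma> t0)) / (vderiv c (\<sigma> t0) \<bullet> vderiv c (\<sigma> t0))) (at t0)"
    and "isCont \<sigma> t0"
proof -
  let ?O = "overlap (c, J) (c', J')"
  have O: "open ?O" by (rule open_overlap[OF \<kappa> \<kappa>'])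
  have "continuous_on ?O (\<lambda>t. inv_into J c (c' t))"
  proof (rule continuous_on_compose2[of "c ` J"])
    show "continuous_on (c ` J) (inv_into J c)" using chartsD(5)[OF \<kappa>] homeomorphism_def by blast
    show "continuous_on ?O c'"
      using smooth_on_continuous[OF chartsD(2)[OF \<kappa>']] by (rule continuous_on_subset) (auto simp: overlap_def)
  qed (auto simp: overlap_def)
  then show cont: "isCont \<sigma> t0"
    using t0 by (simp add: continuous_on_eq_continuous_at[OF O] \<sigma>_def transition_def)
  define s0 e where "s0 = \<sigma> t0" and "e = vderiv c s0"
  have s0: "s0 \<in> J" using transition_in(1)[OF t0] by (simp add: s0_def \<sigma>_def)
  have e: "e \<bullet> e \<noteq> 0" using chartsD(3)[OF \<kappa> s0] by (simp add: e_def)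
  have "((\<lambda>s. c s \<bullet> e) has_real_derivative (e \<bullet> e)) (at s0)"
    unfolding has_real_derivative_iff_has_vector_derivative
    using bounded_linear.has_vector_derivative[OF bounded_linear_inner_left smooth_on_has_vderiv[OF chartsD(2)[OF \<kappa>] s0]]
    by (simp add: e_def)
  then obtain q where "(\<forall>s. c s \<bullet> e - c s0 \<bullet> e = q s * (s - s0)) \<and> isCont q s0 \<and> q s0 = e \<bullet> e"
    unfolding CARAT_DERIV by (elim exE)
  then have q: "\<And>s. c s \<bullet> e - c s0 \<bullet> e = q s * (s - s0)" "isCont q s0" "q s0 = e \<bullet> e" by auto
  have "t0 \<in> J'" using t0 by (simp add: overlap_iff)
  then have "((\<lambda>t. c' t \<bullet> e) has_real_derivative (vderiv c' t0 \<bullet> e)) (at t0)"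
    unfolding has_real_derivative_iff_has_vector_derivative
    by (rule bounded_linear.has_vector_derivative[OF bounded_linear_inner_left smooth_on_has_vderiv[OF chartsD(2)[OF \<kappa>']]])
  then obtain p where "(\<forall>t. c' t \<bullet> e - c' t0 \<bullet> e = p t * (t - t0)) \<and> isCont p t0 \<and> p t0 = vderiv c' t0 \<bullet> e"
    unfolding CARAT_DERIV by (elim exE)
  then have p: "\<And>t. c' t \<bullet> e - c' t0 \<bullet> e = p t * (t - t0)" "isCont p t0" "p t0 = vderiv c' t0 \<bullet> e" by auto
  have q\<sigma>: "isCont (\<lambda>t. q (\<sigma> t)) t0"
    using isCont_o2[OF cont, of q] q(2) by (simp add: s0_def)
  have "((\<lambda>t. p t / q (\<sigma> t)) \<longlongrightarrow> p t0 / q (\<sigma> t0)) (at t0)"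
    using p(2) q\<sigma> q(3) e by (intro tendsto_divide) (auto simp: isCont_def s0_def)
  moreover have "\<forall>\<^sub>F t in at t0. p t / q (\<sigma> t) = (\<sigma> t - \<sigma> t0) / (t - t0)"
  proof -
    have "\<forall>\<^sub>F t in at t0. q (\<sigma> t) \<noteq> 0"
      using q\<sigma> q(3) e tendsto_imp_eventually_ne[of "\<lambda>t. q (\<sigma> t)" "q (\<sigma> t0)"] by (auto simp: isCont_def s0_def)
    moreover have "\<forall>\<^sub>F t in at t0. t \<in> ?O" using O t0 by (auto simp: eventually_at_topological)
    moreover have "\<forall>\<^sub>F t in at t0. t \<noteq> t0" by (simp add: eventually_at_filter)
    ultimately show ?thesis
    proof eventually_elim
      case (elim t)
      have "c (\<sigma> t) = c' t" "c s0 = c' t0"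
        using transition_in(2) elim(2) t0 by (auto simp: \<sigma>_def s0_def)
      then have "p t * (t - t0) = q (\<sigma> t) * (\<sigma> t - \<sigma> t0)"
        using p(1)[of t] q(1)[of "\<sigma> t"] by (simp add: s0_def)
      then show ?case using elim by (simp add: frac_eq_eq mult.commute)
    qed
  qed
  ultimately have "((\<lambda>t. (\<sigma> t - \<sigma> t0) / (t - t0)) \<longlongrightarrow> p t0 / q (\<sigma> t0)) (at t0)"
    by (rule Lim_transform_eventually)
  then show "(\<sigma> has_real_derivative
      (vderiv c' t0 \<bullet> vderiv c (\<sigma> t0)) / (vderiv c (\<sigma> t0) \<bullet> vderiv c (\<sigma> t0))) (at t0)"
    using p(3) q(3) by (simp add: has_field_derivative_iff s0_def e_def)
qed

lemma smooth_transition: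
  assumes \<kappa>: "(c, J) \<in> charts \<Gamma>" and \<kappa>': "(c', J') \<in> charts \<Gamma>"
  shows "smooth_on (overlap (c, J) (c', J')) (transition (c, J) (c', J'))"
proof -
  let ?O = "overlap (c, J) (c', J')" and ?\<sigma> = "transition (c, J) (c', J')"
  have O: "open ?O" by (rule open_overlap[OF \<kappa> \<kappa>'])
  have sub: "?O \<subseteq> J'" by (auto simp: overlap_iff)
  have "Ck_on k ?O ?\<sigma>" for k
  proof (induction k)
    case 0
    show ?case using transition_derivative(2)[OF assms] by (auto intro!: continuous_at_imp_continuous_on)
  next
    case (Suc k)
    have dc: "Ck_on k J (vderiv c)" "Ck_on k ?O (vderiv c')"
      using smooth_on_vderiv[OF chartsD(2,1)[OF \<kappa>]] smooth_on_vderiv[OF chartsD(2,1)[OF \<kappa>']] Ck_on_subset[OF _ sub]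
      by (auto simp: smooth_on_def)
    have dc\<sigma>: "Ck_on k ?O (\<lambda>t. vderiv c (?\<sigma> t))"
      by (rule Ck_on_compose[OF O dc(1) Suc]) (rule transition_in)
    show ?case
    proof (rule Ck_on_SucI_real[OF O])
      show "(?\<sigma> has_vector_derivative (vderiv c' t \<bullet> vderiv c (?\<sigma> t)) *
          inverse (vderiv c (?\<sigma> t) \<bullet> vderiv c (?\<sigma> t))) (at t)" if "t \<in> ?O" for t
        using transition_derivative(1)[OF assms that]
        by (simp add: has_real_derivative_iff_has_vector_derivative divide_inverse)
      show "Ck_on k ?O (\<lambda>t. (vderiv c' t \<bullet> vderiv c (?\<sigma> t)) * inverse (vderiv c (?\<sigma> t) \<bullet> vderiv c (?\<sigma> t)))"
      proof (intro bounded_bilinear.Ck_on_bilinear[OF bounded_bilinear_mult O]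
          bounded_bilinear.Ck_on_bilinear[OF bounded_bilinear_inner O] dc dc\<sigma>)
        show "Ck_on k ?O (\<lambda>t. inverse (vderiv c (?\<sigma> t) \<bullet> vderiv c (?\<sigma> t)))"
          by (rule Ck_on_compose[OF O Ck_on_inverse])
            (use chartsD(3)[OF \<kappa>] transition_in in
              \<open>auto intro!: bounded_bilinear.Ck_on_bilinear[OF bounded_bilinear_inner O] dc\<sigma>\<close>)
      qed
    qed
  qed
  then show ?thesis by (simp add: smooth_on_def)
qed

lemma transition_chain_rule:
  assumes \<kappa>: "(c, J) \<in> charts \<Gamma>" and \<kappa>': "(c', J') \<in> charts \<Gamma>" and t: "t \<in> overlap (c, J) (c', J')"
  defines "\<sigma> \<equiv> transition (c, J) (c', J')"
  shows "vderiv c' t = vderiv \<sigma> t *\<^sub>R vderiv c (\<sigma> t)"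
proof -
  let ?O = "overlap (c, J) (c', J')"
  have O: "open ?O" by (rule open_overlap[OF \<kappa> \<kappa>'])
  have "(\<sigma> has_vector_derivative vderiv \<sigma> t) (at t)"
    unfolding \<sigma>_def using smooth_on_has_vderiv[OF smooth_transition[OF \<kappa> \<kappa>'] t] .
  moreover have "(c has_vector_derivative vderiv c (\<sigma> t)) (at (\<sigma> t))"
    using smooth_on_has_vderiv[OF chartsD(2)[OF \<kappa>]] transition_in(1)[OF t] by (simp add: \<sigma>_def)
  ultimately have "((c \<circ> \<sigma>) has_vector_derivative vderiv \<sigma> t *\<^sub>R vderiv c (\<sigma> t)) (at t)"
    by (rule vector_diff_chain_at)
  then have "(c' has_vector_derivative vderiv \<sigma> t *\<^sub>R vderiv c (\<sigma> t)) (at t)"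
    by (rule has_vector_derivative_transform_within_open[OF _ O t]) (use transition_in(2) in \<open>auto simp: \<sigma>_def\<close>)
  then show ?thesis by (rule vector_derivative_at)
qed

lemma push_chart: "(c, J) \<in> charts \<Gamma> \<Longrightarrow> t \<in> J \<Longrightarrow> push (c, J) \<psi> (c t) = \<psi> t"
  using chartsD(4) by (auto simp: push_def inv_into_f_f)

lemma push_off: "x \<notin> c ` J \<Longrightarrow> push (c, J) \<psi> x = 0"
  by (simp add: push_def)

lemma push_overlap:
  "t \<in> overlap (c, J) (c', J') \<Longrightarrow> push (c, J) \<psi> (c' t) = \<psi> (transition (c, J) (c', J') t)"
  by (simp add: push_def overlap_iff transition_def)

lemma push_mult:
  assumes "(c, J) \<in> charts \<Gamma>"
  shows "push (c, J) \<psi> x * f x = push (c, J) (\<lambda>t. \<psi> t * f (c t)) x"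
  by (auto simp: push_def f_inv_into_f)

lemma push_cong: "(\<And>t. t \<in> J \<Longrightarrow> \<psi> t = \<psi>' t) \<Longrightarrow> push (c, J) \<psi> = push (c, J) \<psi>'"
  by (auto simp: push_def inv_into_into fun_eq_iff)

lemma CinfD:
  assumes "f \<in> Cinf \<Gamma>"
  shows "(c, J) \<in> charts \<Gamma> \<Longrightarrow> smooth_on J (\<lambda>t. f (c t))" "x \<notin> \<Gamma> \<Longrightarrow> f x = 0"
  using assms by (auto simp: Cinf_def)

lemma CinfI:
  assumes "\<And>c J. (c, J) \<in> charts \<Gamma> \<Longrightarrow> smooth_on J (\<lambda>t. f (c t))" "\<And>x. x \<notin> \<Gamma> \<Longrightarrow> f x = 0"
  shows "f \<in> Cinf \<Gamma>"
  using assms by (auto simp: Cinf_def)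

text \<open>In another chart a pushed forward function is a composition with the transition map near points of
  the first chart, and it vanishes near all other points, because its support is compact.\<close>

lemma push_Cinf:
  assumes \<kappa>: "(c, J) \<in> charts \<Gamma>" and \<psi>: "\<psi> \<in> Cc_inf J"
  shows "push (c, J) \<psi> \<in> Cinf \<Gamma>"
proof (rule CinfI)
  show "push (c, J) \<psi> x = 0" if "x \<notin> \<Gamma>" for x using chartsD(7)[OF \<kappa>] that by (intro push_off) auto
  fix c' J' assume \<kappa>': "(c', J') \<in> charts \<Gamma>"
  obtain K where K: "compact K" "K \<subseteq> J" "\<And>t. t \<notin> K \<Longrightarrow> \<psi> t = 0" using Cc_infE[OF \<psi>] by metis
  have "closed (c ` K)"
    using K smooth_on_continuous[OF chartsD(2)[OF \<kappa>]] continuous_on_subset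
    by (intro compact_imp_closed compact_continuous_image) blast+
  show "smooth_on J' (\<lambda>t. push (c, J) \<psi> (c' t))"
  proof (rule smooth_on_local)
    fix t assume t: "t \<in> J'"
    show "\<exists>V. open V \<and> t \<in> V \<and> smooth_on V (\<lambda>t. push (c, J) \<psi> (c' t))"
    proof (cases "c' t \<in> c ` J")
      case True
      let ?O = "overlap (c, J) (c', J')"
      have "smooth_on ?O (\<lambda>t. \<psi> (transition (c, J) (c', J') t))"
        by (rule smooth_on_compose[OF Cc_infD(1)[OF \<psi>] smooth_transition[OF \<kappa> \<kappa>'] open_overlap[OF \<kappa> \<kappa>']]) simp
      then have "smooth_on ?O (\<lambda>t. push (c, J) \<psi> (c' t))"
        by (rule smooth_on_cong[OF _ open_overlap[OF \<kappa> \<kappa>']]) (simp add: push_overlap)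
      then show ?thesis using True t
        by (intro exI[of _ ?O]) (auto simp: overlap_iff open_overlap[OF \<kappa> \<kappa>'])
    next
      case False
      let ?V = "J' \<inter> c' -` (- c ` K)"
      have V: "open ?V"
        using smooth_on_continuous[OF chartsD(2)[OF \<kappa>']] chartsD(1)[OF \<kappa>'] \<open>closed (c ` K)\<close>
        by (intro continuous_open_preimage) auto
      have zero: "0 = push (c, J) \<psi> (c' s)" if "s \<in> ?V" for s
      proof (cases "c' s \<in> c ` J")
        case True
        then have "inv_into J c (c' s) \<notin> K" using that f_inv_into_f[OF True] by (metis ComplD IntD2 imageI vimageD)
        then show ?thesis by (simp add: push_def K(3))
      qed (simp add: push_off)
      have "smooth_on ?V (\<lambda>t. push (c, J) \<psi> (c' t))"
        by (rule smooth_on_cong[OF smooth_on_const[of _ 0] V zero])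
      moreover have "t \<in> ?V" using False K(2) t by auto
      ultimately show ?thesis using V by (intro exI[of _ ?V]) simp
    qed
  qed
qed

lemma Cinf_add: "f \<in> Cinf \<Gamma> \<Longrightarrow> g \<in> Cinf \<Gamma> \<Longrightarrow> (\<lambda>x. f x + g x) \<in> Cinf \<Gamma>"
  by (rule CinfI) (simp_all add: smooth_on_add CinfD(1) chartsD(1) CinfD(2))

lemma Cinf_scale: "f \<in> Cinf \<Gamma> \<Longrightarrow> (\<lambda>x. k * f x) \<in> Cinf \<Gamma>"
  by (rule CinfI) (simp_all add: smooth_on_scale CinfD(1) chartsD(1) CinfD(2))

lemma Cinf_cnj: "f \<in> Cinf \<Gamma> \<Longrightarrow> (\<lambda>x. cnj (f x)) \<in> Cinf \<Gamma>"
  by (rule CinfI) (simp_all add: smooth_on_linear[OF _ _ bounded_linear_cnj] CinfD(1) chartsD(1) CinfD(2))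

lemma Cinf_zero: "(\<lambda>x. 0) \<in> Cinf \<Gamma>"
  by (intro CinfI) auto

lemma Cinf_sum: "(\<And>i. i \<in> I \<Longrightarrow> f i \<in> Cinf \<Gamma>) \<Longrightarrow> (\<lambda>x. \<Sum>i\<in>I. f i x) \<in> Cinf \<Gamma>"
  by (induction I rule: infinite_finite_induct) (auto intro: Cinf_add Cinf_zero)

text \<open>Cutoffs equal to \<open>1\<close> at given points are positive on relatively open sets, finitely many of which
  cover the compact curve. Division by the sum of the corresponding cutoffs normalizes them.\<close>

lemma partition_of_unity:
  assumes "compact \<Gamma>" "smooth_curve_manifold \<Gamma>"
  obtains P c J \<eta> where "finite (P :: (real^2) set)" "\<And>p. p \<in> P \<Longrightarrow> (c p, J p) \<in> charts \<Gamma>"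
    "\<And>p. p \<in> P \<Longrightarrow> \<eta> p \<in> Cc_inf (J p)"
    "\<And>x. x \<in> \<Gamma> \<Longrightarrow> (\<Sum>p\<in>P. push (c p, J p) (\<eta> p) x) = 1"
proof -
  define Q where "Q = (\<lambda>p (c, J, t, b :: real \<Rightarrow> real). (c, J) \<in> charts \<Gamma> \<and> t \<in> J \<and> c t = p \<and>
      (\<lambda>t. complex_of_real (b t)) \<in> Cc_inf J \<and> (\<forall>t. 0 \<le> b t) \<and> b t = 1)"
  have "\<exists>q. Q p q" if "p \<in> \<Gamma>" for p
  proof -
    obtain c J t where \<kappa>: "(c, J) \<in> charts \<Gamma>" "t \<in> J" "c t = p"
      using bspec[OF assms(2)[unfolded smooth_curve_manifold_def] \<open>p \<in> \<Gamma>\<close>] by (auto simp del: split_paired_Ex)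
    obtain b :: "real \<Rightarrow> real" where "(\<lambda>t. complex_of_real (b t)) \<in> Cc_inf J" "\<And>t. 0 \<le> b t" "\<And>s. s \<in> {t} \<Longrightarrow> b s = 1"
      using Cc_inf_cutoff[OF chartsD(1)[OF \<kappa>(1)], of "{t}"] \<kappa>(2) by auto
    then show ?thesis using \<kappa> by (intro exI[of _ "(c, J, t, b)"]) (simp add: Q_def)
  qed
  then obtain q where q: "\<And>p. p \<in> \<Gamma> \<Longrightarrow> Q p (q p)" by metis
  define c J t b where "c p = fst (q p)" and "J p = fst (snd (q p))" and "t p = fst (snd (snd (q p)))"
    and "b p = snd (snd (snd (q p)))" for p
  have *: "(c p, J p) \<in> charts \<Gamma>" "t p \<in> J p" "c p (t p) = p" "(\<lambda>t. complex_of_real (b p t)) \<in> Cc_inf (J p)"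
    "0 \<le> b p s" "b p (t p) = 1" if "p \<in> \<Gamma>" for p s
    using q[OF that] by (auto simp: Q_def c_def J_def t_def b_def split: prod.splits)
  define B where "B p = push (c p, J p) (\<lambda>t. complex_of_real (b p t))" for p
  define V where "V p = c p ` {s \<in> J p. 0 < b p s}" for p
  have "\<exists>T. open T \<and> V p = \<Gamma> \<inter> T" if p: "p \<in> \<Gamma>" for p
  proof -
    have "open {s. 0 < b p s}"
    proof -
      have "continuous_on UNIV (\<lambda>s. Re (complex_of_real (b p s)))"
        using Cc_infD(3)[OF *(4)[OF p]] by (intro continuous_on_Re)
      then show ?thesis by (simp add: open_Collect_less)
    qed
    then have "openin (top_of_set (J p)) {s \<in> J p. 0 < b p s}"
      by (auto simp: openin_open intro!: exI[of _ "{s. 0 < b p s}"])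
    then have "openin (top_of_set (c p ` J p)) (V p)"
      unfolding V_def by (rule homeomorphism_imp_open_map[OF chartsD(5)[OF *(1)[OF p]]])
    then have "openin (top_of_set \<Gamma>) (V p)" using chartsD(6)[OF *(1)[OF p]] openin_trans by blast
    then show ?thesis by (auto simp: openin_open)
  qed
  then obtain T where T: "\<And>p. p \<in> \<Gamma> \<Longrightarrow> open (T p)" "\<And>p. p \<in> \<Gamma> \<Longrightarrow> V p = \<Gamma> \<inter> T p" by metis
  obtain P where P: "P \<subseteq> \<Gamma>" "finite P" "\<Gamma> \<subseteq> (\<Union>p\<in>P. T p)"
  proof (rule compactE_image[OF assms(1), of \<Gamma> T])
    have "p \<in> V p" if "p \<in> \<Gamma>" for p
      unfolding V_def by (rule image_eqI[of _ _ "t p"]) (use *[OF that] in auto)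
    then show "\<Gamma> \<subseteq> (\<Union>p\<in>\<Gamma>. T p)" using T by blast
  qed (use T in auto)
  define S where "S x = Re (\<Sum>p\<in>P. B p x)" for x
  have B_nonneg: "B p x = complex_of_real (Re (B p x))" "0 \<le> Re (B p x)" if "p \<in> P" for p x
    using *(5)[of p "inv_into (J p) (c p) x"] that P(1) by (auto simp: B_def push_def)
  have S_eq: "(\<Sum>p\<in>P. B p x) = complex_of_real (S x)" for x
    unfolding S_def Re_sum of_real_sum using B_nonneg(1) by (intro sum.cong) auto
  have S_pos: "0 < S x" if x: "x \<in> \<Gamma>" for x
  proof -
    obtain p where p: "p \<in> P" "x \<in> V p" using P T x by blast
    then obtain s where s: "s \<in> J p" "0 < b p s" "x = c p s" by (auto simp: V_def)
    have "B p x = b p s" using push_chart[OF *(1)] P(1) p(1) s by (auto simp: B_def)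
    then show ?thesis unfolding S_def Re_sum using s(2) p(1) P(2) B_nonneg(2)
      by (intro sum_pos2[of P p]) auto
  qed
  define \<eta> where "\<eta> p s = complex_of_real (b p s) * complex_of_real (inverse (S (c p s)))" for p s
  show ?thesis
  proof (rule that[of P c J \<eta>])
    show \<kappa>: "(c p, J p) \<in> charts \<Gamma>" if "p \<in> P" for p using that P *(1) by auto
    show "\<eta> p \<in> Cc_inf (J p)" if p: "p \<in> P" for p
      unfolding \<eta>_def[abs_def]
    proof (rule Cc_inf_mult(1))
      show "(\<lambda>s. complex_of_real (b p s)) \<in> Cc_inf (J p)" using p P *(4) by auto
      show J: "open (J p)" by (rule chartsD[OF \<kappa>[OF p]])
      have "(\<lambda>x. \<Sum>p\<in>P. B p x) \<in> Cinf \<Gamma>"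
        unfolding B_def using P(1) *(1,4) by (intro Cinf_sum push_Cinf) auto
      then have "smooth_on (J p) (\<lambda>s. Re (\<Sum>q\<in>P. B q (c p s)))"
        by (intro smooth_on_linear[OF _ J bounded_linear_Re] CinfD(1)[OF _ \<kappa>[OF p]])
      then have "smooth_on (J p) (\<lambda>s. S (c p s))" by (simp only: S_def)
      moreover have "S (c p s) \<noteq> 0" if "s \<in> J p" for s
        using S_pos[of "c p s"] chartsD(7)[OF \<kappa>[OF p]] that by force
      ultimately show "smooth_on (J p) (\<lambda>s. complex_of_real (inverse (S (c p s))))"
        by (intro smooth_on_of_real smooth_on_inverse J)
    qed
    fix x assume x: "x \<in> \<Gamma>"
    have "push (c p, J p) (\<eta> p) x = B p x * complex_of_real (inverse (S x))" if "p \<in> P" for p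
      using push_mult[OF \<kappa>[OF that], of _ x "\<lambda>x. complex_of_real (inverse (S x))"]
      by (simp add: B_def \<eta>_def[abs_def])
    then have "(\<Sum>p\<in>P. push (c p, J p) (\<eta> p) x) = (\<Sum>p\<in>P. B p x) * complex_of_real (inverse (S x))"
      by (simp add: sum_distrib_right)
    also have "\<dots> = 1" using S_pos[OF x] by (simp add: S_eq flip: of_real_mult)
    finally show "(\<Sum>p\<in>P. push (c p, J p) (\<eta> p) x) = 1" .
  qed (rule P(2))
qed

lemma partition_decompose:
  assumes "h \<in> Cinf \<Gamma>" "\<And>p. p \<in> P \<Longrightarrow> (c p, J p) \<in> charts \<Gamma>"
    "\<And>x. x \<in> \<Gamma> \<Longrightarrow> (\<Sum>p\<in>P. push (c p, J p) (\<eta> p) x) = 1"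
  shows "h = (\<lambda>x. \<Sum>p\<in>P. push (c p, J p) (\<lambda>t. \<eta> p t * h (c p t)) x)"
proof
  fix x
  have "(\<Sum>p\<in>P. push (c p, J p) (\<lambda>t. \<eta> p t * h (c p t)) x) = (\<Sum>p\<in>P. push (c p, J p) (\<eta> p) x * h x)"
    by (intro sum.cong refl) (simp add: push_mult[OF assms(2)])
  also have "\<dots> = h x" using assms(3)[of x] CinfD(2)[OF assms(1), of x]
    by (cases "x \<in> \<Gamma>") (auto simp flip: sum_distrib_right)
  finally show "h x = (\<Sum>p\<in>P. push (c p, J p) (\<lambda>t. \<eta> p t * h (c p t)) x)" ..
qed

section \<open>Integration over a curve\<close>

text \<open>The assumptions on the line element are what is needed for a measure on the curve: homogeneity
  makes it independent of the parametrization, smoothness and positivity of the speed make the passage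
  between densities and functions harmless.\<close>

locale curve =
  fixes L :: line_element and \<Gamma> :: "(real^2) set"
  assumes compact: "compact \<Gamma>" and manifold: "smooth_curve_manifold \<Gamma>"
    and L_scale: "\<And>x k v. x \<in> \<Gamma> \<Longrightarrow> L x (k *\<^sub>R v) = \<bar>k\<bar> * L x v"
    and speed_smooth: "\<And>c J. (c, J) \<in> charts \<Gamma> \<Longrightarrow> smooth_on J (speed L (c, J))"
    and speed_pos: "\<And>c J t. (c, J) \<in> charts \<Gamma> \<Longrightarrow> t \<in> J \<Longrightarrow> 0 < speed L (c, J) t"
begin

lemma smooth_speed_complex:
  "(c, J) \<in> charts \<Gamma> \<Longrightarrow> smooth_on J (\<lambda>t. complex_of_real (speed L (c, J) t))"
  by (intro smooth_on_of_real speed_smooth chartsD)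

lemma smooth_inverse_speed:
  "(c, J) \<in> charts \<Gamma> \<Longrightarrow> smooth_on J (\<lambda>t. complex_of_real (inverse (speed L (c, J) t)))"
  by (intro smooth_on_of_real smooth_on_inverse speed_smooth chartsD) (auto dest: speed_pos)

lemma Cc_inf_mult_speed:
  "(c, J) \<in> charts \<Gamma> \<Longrightarrow> \<psi> \<in> Cc_inf J \<Longrightarrow> (\<lambda>t. \<psi> t * complex_of_real (speed L (c, J) t)) \<in> Cc_inf J"
  by (intro Cc_inf_mult smooth_speed_complex chartsD)

lemma Cc_inf_div_speed:
  "(c, J) \<in> charts \<Gamma> \<Longrightarrow> \<psi> \<in> Cc_inf J \<Longrightarrow> (\<lambda>t. \<psi> t / complex_of_real (speed L (c, J) t)) \<in> Cc_inf J"
  using Cc_inf_mult(1)[OF _ _ smooth_inverse_speed] chartsD(1)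
  by (simp add: divide_inverse)

lemma Cc_inf_mult_Cinf:
  "(c, J) \<in> charts \<Gamma> \<Longrightarrow> \<psi> \<in> Cc_inf J \<Longrightarrow> f \<in> Cinf \<Gamma> \<Longrightarrow> (\<lambda>t. \<psi> t * f (c t)) \<in> Cc_inf J"
  by (intro Cc_inf_mult CinfD chartsD)

text \<open>Two charts induce the same measure on their overlap: this is the substitution rule for the
  transition map \<open>\<sigma>\<close>, since \<open>|\<sigma>'|\<close> is the ratio of the speeds by the chain rule. The functions \<open>a\<close> and
  \<open>b\<close> confine the integrands to the overlap.\<close>

lemma chart_change:
  assumes \<kappa>: "(c, J) \<in> charts \<Gamma>" and \<kappa>': "(c', J') \<in> charts \<Gamma>" and a: "a \<in> Cc_inf J" and b: "b \<in> Cc_inf J'"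
  shows "(LINT t|lborel. a t * push (c', J') b (c t) * speed L (c, J) t) =
         (LINT t|lborel. b t * push (c, J) a (c' t) * speed L (c', J') t)"
proof -
  let ?O = "overlap (c', J') (c, J)" and ?O' = "overlap (c, J) (c', J')"
  let ?\<sigma> = "transition (c', J') (c, J)"
  define F where "F t = a t * push (c', J') b (c t) * speed L (c, J) t" for t
  define F' where "F' t = b t * push (c, J) a (c' t) * speed L (c', J') t" for t
  have F_Cc: "F \<in> Cc_inf J"
    unfolding F_def[abs_def] by (intro Cc_inf_mult_speed Cc_inf_mult_Cinf push_Cinf \<kappa> \<kappa>' a b)
  have F'_Cc: "F' \<in> Cc_inf J'"
    unfolding F'_def[abs_def] by (intro Cc_inf_mult_speed Cc_inf_mult_Cinf push_Cinf \<kappa> \<kappa>' a b)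
  have F_off: "F t = 0" if "t \<notin> ?O" for t
    using that Cc_infD(2)[OF a] by (cases "t \<in> J") (auto simp: F_def overlap_iff push_off)
  have F'_off: "F' t = 0" if "t \<notin> ?O'" for t
    using that Cc_infD(2)[OF b] by (cases "t \<in> J'") (auto simp: F'_def overlap_iff push_off)
  have abs_int: "G absolutely_integrable_on A" "integral A G = (LINT t|lborel. G t)"
    if "G \<in> Cc_inf I" "\<And>t. t \<notin> A \<Longrightarrow> G t = 0" for G I and A :: "real set"
  proof -
    have "(\<lambda>t. indicator A t *\<^sub>R G t) = G" using that(2) by (auto simp: indicator_def fun_eq_iff)
    moreover have "integrable lebesgue G"
      using Cc_inf_integrable[OF that(1)] by (intro integrable_completion[THEN iffD2]) auto
    ultimately show "G absolutely_integrable_on A" by (simp add: set_integrable_def)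
    have "integral A G = integral UNIV (\<lambda>t. if t \<in> A then G t else 0)" by (simp add: integral_restrict_UNIV)
    also have "(\<lambda>t. if t \<in> A then G t else 0) = G" using that(2) by auto
    finally show "integral A G = (LINT t|lborel. G t)" using integral_lborel[OF Cc_inf_integrable[OF that(1)]] by simp
  qed
  have inv: "transition (c, J) (c', J') (?\<sigma> t) = t" "?\<sigma> t \<in> ?O'" if "t \<in> ?O" for t
    using transition_in[OF that] that chartsD(4)[OF \<kappa>] by (auto simp: overlap_iff transition_def)
  have inv': "?\<sigma> (transition (c, J) (c', J') t) = t" "transition (c, J) (c', J') t \<in> ?O" if "t \<in> ?O'" for t
    using transition_in[OF that] that chartsD(4)[OF \<kappa>'] by (auto simp: overlap_iff transition_def)
  have image: "?\<sigma> ` ?O = ?O'"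
  proof (intro subset_antisym image_subsetI subsetI)
    show "t \<in> ?\<sigma> ` ?O" if "t \<in> ?O'" for t
      using inv'[OF that] by (intro image_eqI[of _ _ "transition (c, J) (c', J') t"]) auto
  qed (rule inv(2))
  have "inj_on ?\<sigma> ?O"
    by (rule inj_on_inverseI[of _ "transition (c, J) (c', J')"]) (rule inv(1))
  moreover have "(?\<sigma> has_field_derivative vderiv ?\<sigma> t) (at t within ?O)" if "t \<in> ?O" for t
    using smooth_on_has_vderiv[OF smooth_transition[OF \<kappa>' \<kappa>] that]
    by (simp add: has_real_derivative_iff_has_vector_derivative[symmetric] has_field_derivative_at_within)
  moreover have "?O \<in> sets lebesgue" using open_overlap[OF \<kappa>' \<kappa>] by simp
  ultimately have "integral ?O (\<lambda>t. \<bar>vderiv ?\<sigma> t\<bar> *\<^sub>R F' (?\<sigma> t)) = integral (?\<sigma> ` ?O) F'"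
    using has_absolute_integral_change_of_variables_real[of ?O ?\<sigma> "vderiv ?\<sigma>" F' "integral (?\<sigma> ` ?O) F'"]
      abs_int(1)[OF F'_Cc F'_off] image by simp
  moreover have "integral ?O (\<lambda>t. \<bar>vderiv ?\<sigma> t\<bar> *\<^sub>R F' (?\<sigma> t)) = integral ?O F"
  proof (rule Henstock_Kurzweil_Integration.integral_cong)
    fix t assume t: "t \<in> ?O"
    have in_J: "t \<in> J" "c t \<in> \<Gamma>" using t chartsD(7)[OF \<kappa>] by (auto simp: overlap_iff)
    have "\<bar>vderiv ?\<sigma> t\<bar> * speed L (c', J') (?\<sigma> t) = speed L (c, J) t"
      using transition_chain_rule[OF \<kappa>' \<kappa> t] L_scale[OF in_J(2)] transition_in(2)[OF t]
      by (simp add: speed_def)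
    moreover have "push (c, J) a (c' (?\<sigma> t)) = a t"
      using transition_in(2)[OF t] push_chart[OF \<kappa> in_J(1)] by simp
    ultimately show "\<bar>vderiv ?\<sigma> t\<bar> *\<^sub>R F' (?\<sigma> t) = F t"
      by (simp add: F_def F'_def push_overlap[OF t] scaleR_conv_of_real mult_ac flip: of_real_mult)
  qed
  ultimately have "(LINT t|lborel. F t) = (LINT t|lborel. F' t)"
    using abs_int(2)[OF F_Cc F_off] abs_int(2)[OF F'_Cc F'_off] image by simp
  then show ?thesis by (simp add: F_def F'_def)
qed

end

section \<open>Distributions on a curve\<close>

text \<open>The continuity estimate in the definition of a distribution, with its data: finitely many compact
  subsets of charts, the order and the constant.\<close>

definition seminorm_bound :: "(real^2) set \<Rightarrow> (chart \<times> real set) set \<Rightarrow> nat \<Rightarrow> real \<Rightarrow> dist \<Rightarrow> bool" where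
  "seminorm_bound \<Gamma> S n C u \<longleftrightarrow> finite S \<and> 0 \<le> C \<and>
     (\<forall>c J K. ((c, J), K) \<in> S \<longrightarrow> (c, J) \<in> charts \<Gamma> \<and> compact K \<and> K \<subseteq> J) \<and>
     (\<forall>f B. f \<in> Cinf \<Gamma> \<longrightarrow> 0 \<le> B \<longrightarrow>
        (\<forall>c J K j t. ((c, J), K) \<in> S \<longrightarrow> j \<le> n \<longrightarrow> t \<in> K \<longrightarrow> cmod ((vderiv ^^ j) (\<lambda>s. f (c s)) t) \<le> B) \<longrightarrow>
        cmod (u f) \<le> C * B)"

lemma seminorm_boundI:
  assumes "finite S" "0 \<le> C" "\<And>c J K. ((c, J), K) \<in> S \<Longrightarrow> (c, J) \<in> charts \<Gamma> \<and> compact K \<and> K \<subseteq> J"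
    "\<And>f B. f \<in> Cinf \<Gamma> \<Longrightarrow> 0 \<le> B \<Longrightarrow>
      (\<And>c J K j t. ((c, J), K) \<in> S \<Longrightarrow> j \<le> n \<Longrightarrow> t \<in> K \<Longrightarrow> cmod ((vderiv ^^ j) (\<lambda>s. f (c s)) t) \<le> B) \<Longrightarrow>
      cmod (u f) \<le> C * B"
  shows "seminorm_bound \<Gamma> S n C u"
  using assms unfolding seminorm_bound_def by simp

lemma seminorm_boundD:
  assumes "seminorm_bound \<Gamma> S n C u"
  shows "finite S" "0 \<le> C" "\<And>c J K. ((c, J), K) \<in> S \<Longrightarrow> (c, J) \<in> charts \<Gamma> \<and> compact K \<and> K \<subseteq> J"
    "\<And>f B. f \<in> Cinf \<Gamma> \<Longrightarrow> 0 \<le> B \<Longrightarrow>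
      (\<And>c J K j t. ((c, J), K) \<in> S \<Longrightarrow> j \<le> n \<Longrightarrow> t \<in> K \<Longrightarrow> cmod ((vderiv ^^ j) (\<lambda>s. f (c s)) t) \<le> B) \<Longrightarrow>
      cmod (u f) \<le> C * B"
  using assms unfolding seminorm_bound_def by simp_all

lemma seminorm_bound_add:
  assumes "seminorm_bound \<Gamma> S n C u" "seminorm_bound \<Gamma> S' n C' v"
  shows "seminorm_bound \<Gamma> (S \<union> S') n (C + C') (\<lambda>h. u h + v h)"
proof (rule seminorm_boundI)
  fix f B assume f: "f \<in> Cinf \<Gamma>" "0 \<le> B"
    "\<And>c J K j t. ((c, J), K) \<in> S \<union> S' \<Longrightarrow> j \<le> n \<Longrightarrow> t \<in> K \<Longrightarrow> cmod ((vderiv ^^ j) (\<lambda>s. f (c s)) t) \<le> B"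
  have "cmod (u f) \<le> C * B"
    by (rule seminorm_boundD(4)[OF assms(1) f(1,2)], rule f(3)[OF UnI1])
  moreover have "cmod (v f) \<le> C' * B"
    by (rule seminorm_boundD(4)[OF assms(2) f(1,2)], rule f(3)[OF UnI2])
  ultimately show "cmod (u f + v f) \<le> (C + C') * B"
    using norm_triangle_ineq[of "u f" "v f"] by (simp add: distrib_right)
next
  show "(c, J) \<in> charts \<Gamma> \<and> compact K \<and> K \<subseteq> J" if "((c, J), K) \<in> S \<union> S'" for c J K
    using that seminorm_boundD(3)[OF assms(1)] seminorm_boundD(3)[OF assms(2)] by (elim UnE) simp_all
qed (use seminorm_boundD(1,2)[OF assms(1)] seminorm_boundD(1,2)[OF assms(2)] in auto)

lemma seminorm_bound_scale:
  assumes "seminorm_bound \<Gamma> S n C u"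
  shows "seminorm_bound \<Gamma> S n (cmod k * C) (\<lambda>h. k * u h)"
proof (rule seminorm_boundI)
  fix f B assume f: "f \<in> Cinf \<Gamma>" "0 \<le> B"
    "\<And>c J K j t. ((c, J), K) \<in> S \<Longrightarrow> j \<le> n \<Longrightarrow> t \<in> K \<Longrightarrow> cmod ((vderiv ^^ j) (\<lambda>s. f (c s)) t) \<le> B"
  have "cmod (u f) \<le> C * B" by (rule seminorm_boundD(4)[OF assms f])
  then show "cmod (k * u f) \<le> cmod k * C * B"
    by (simp add: norm_mult mult.assoc mult_left_mono)
qed (use seminorm_boundD(1-3)[OF assms] in auto)

lemma distributionE:
  assumes "u \<in> distributions \<Gamma>"
  obtains S n C where "seminorm_bound \<Gamma> S n C u"
proof -
  from assms obtain S n C where S: "finite S"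
    "\<forall>((c, J), K)\<in>S. (c, J) \<in> charts \<Gamma> \<and> compact K \<and> K \<subseteq> J"
    "\<forall>f\<in>Cinf \<Gamma>. \<forall>B\<ge>0. (\<forall>((c, J), K)\<in>S. \<forall>j\<le>n. \<forall>t\<in>K. cmod ((vderiv ^^ j) (\<lambda>s. f (c s)) t) \<le> B) \<longrightarrow> cmod (u f) \<le> C * B"
    unfolding distributions_def mem_Collect_eq by (elim conjE exE) simp
  have "seminorm_bound \<Gamma> S n (max C 0) u"
  proof (rule seminorm_boundI)
    fix f B assume f: "f \<in> Cinf \<Gamma>" "0 \<le> B"
      and le: "\<And>c J K j t. ((c, J), K) \<in> S \<Longrightarrow> j \<le> n \<Longrightarrow> t \<in> K \<Longrightarrow> cmod ((vderiv ^^ j) (\<lambda>s. f (c s)) t) \<le> B"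
    have "\<forall>((c, J), K)\<in>S. \<forall>j\<le>n. \<forall>t\<in>K. cmod ((vderiv ^^ j) (\<lambda>s. f (c s)) t) \<le> B"
      using le by (simp add: Ball_def split_paired_All)
    then have "cmod (u f) \<le> C * B" using S(3) f by simp
    also have "\<dots> \<le> max C 0 * B" using f(2) by (intro mult_right_mono) auto
    finally show "cmod (u f) \<le> max C 0 * B" .
  qed (use S in \<open>auto simp: Ball_def split_paired_All\<close>)
  then show ?thesis by (rule that)
qed

lemma distributionI:
  assumes "\<And>f g. f \<in> Cinf \<Gamma> \<Longrightarrow> g \<in> Cinf \<Gamma> \<Longrightarrow> u (\<lambda>x. f x + g x) = u f + u g"
    "\<And>k f. f \<in> Cinf \<Gamma> \<Longrightarrow> u (\<lambda>x. k * f x) = k * u f" "\<And>f. f \<notin> Cinf \<Gamma> \<Longrightarrow> u f = 0"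
    "seminorm_bound \<Gamma> S n C u"
  shows "u \<in> distributions \<Gamma>"
  unfolding distributions_def mem_Collect_eq
proof (intro conjI exI[of _ S] exI[of _ n] exI[of _ C])
  show "\<forall>((c, J), K)\<in>S. (c, J) \<in> charts \<Gamma> \<and> compact K \<and> K \<subseteq> J"
    using seminorm_boundD(3)[OF assms(4)] by auto
  show "\<forall>f\<in>Cinf \<Gamma>. \<forall>B\<ge>0. (\<forall>((c, J), K)\<in>S. \<forall>j\<le>n. \<forall>t\<in>K. cmod ((vderiv ^^ j) (\<lambda>s. f (c s)) t) \<le> B) \<longrightarrow>
      cmod (u f) \<le> C * B"
  proof (intro ballI allI impI)
    fix f B assume f: "f \<in> Cinf \<Gamma>" "(0::real) \<le> B"
      and le: "\<forall>((c, J), K)\<in>S. \<forall>j\<le>n. \<forall>t\<in>K. cmod ((vderiv ^^ j) (\<lambda>s. f (c s)) t) \<le> B"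
    show "cmod (u f) \<le> C * B"
    proof (rule seminorm_boundD(4)[OF assms(4) f])
      fix c J K j t assume "((c, J), K) \<in> S" "j \<le> n" "t \<in> K"
      then show "cmod ((vderiv ^^ j) (\<lambda>s. f (c s)) t) \<le> B" using bspec[OF le, of "((c, J), K)"] by simp
    qed
  qed
qed (use assms(1-3) seminorm_boundD(1)[OF assms(4)] in auto)

lemma distribution_add: "u \<in> distributions \<Gamma> \<Longrightarrow> f \<in> Cinf \<Gamma> \<Longrightarrow> g \<in> Cinf \<Gamma> \<Longrightarrow> u (\<lambda>x. f x + g x) = u f + u g"
  and distribution_scale: "u \<in> distributions \<Gamma> \<Longrightarrow> f \<in> Cinf \<Gamma> \<Longrightarrow> u (\<lambda>x. k * f x) = k * u f"
  and distribution_off: "u \<in> distributions \<Gamma> \<Longrightarrow> f \<notin> Cinf \<Gamma> \<Longrightarrow> u f = 0"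
  by (auto simp: distributions_def)

lemma distribution_sum:
  assumes "u \<in> distributions \<Gamma>" "\<And>i. i \<in> I \<Longrightarrow> f i \<in> Cinf \<Gamma>"
  shows "u (\<lambda>x. \<Sum>i\<in>I. f i x) = (\<Sum>i\<in>I. u (f i))"
proof -
  have zero: "u (\<lambda>x. 0) = 0" using distribution_scale[OF assms(1) Cinf_zero, of 0] by simp
  show ?thesis using assms(2)
    by (induction I rule: infinite_finite_induct)
      (simp_all add: zero distribution_add[OF assms(1)] Cinf_sum)
qed

text \<open>By the product rule and the chain rule, the derivative of \<open>m \<cdot> (\<psi> \<circ> \<sigma>)\<close> is a sum of two functions of
  the same form, in one of which \<open>\<psi>\<close> is replaced by its derivative. Both changes of charts and
  multiplications by cutoffs are of this form.\<close>

lemma product_compose_bound: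
  fixes m :: "real \<Rightarrow> complex" and \<sigma> :: "real \<Rightarrow> real"
  assumes "open I" "smooth_on I \<sigma>" "open J" "\<And>s. s \<in> I \<Longrightarrow> \<sigma> s \<in> J"
    and K: "compact K" "K \<subseteq> I" and T: "\<And>s. s \<in> K \<Longrightarrow> \<sigma> s \<in> T" and "smooth_on I m"
  shows "\<exists>M\<ge>0. \<forall>(\<psi> :: real \<Rightarrow> complex) B. smooth_on J \<psi> \<longrightarrow> 0 \<le> B \<longrightarrow>
      (\<forall>i\<le>j. \<forall>t\<in>T. cmod ((vderiv ^^ i) \<psi> t) \<le> B) \<longrightarrow>
      (\<forall>s\<in>K. cmod ((vderiv ^^ j) (\<lambda>s. m s * \<psi> (\<sigma> s)) s) \<le> M * B)"
  using \<open>smooth_on I m\<close>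
proof (induction j arbitrary: m)
  case 0
  have "bounded (m ` K)"
    using smooth_on_continuous[OF 0] K
    by (intro compact_imp_bounded compact_continuous_image) (auto intro: continuous_on_subset)
  then obtain M where M: "\<And>s. s \<in> K \<Longrightarrow> cmod (m s) \<le> M" unfolding bounded_iff by auto
  have "cmod (m s * \<psi> (\<sigma> s)) \<le> \<bar>M\<bar> * B"
    if "\<forall>t\<in>T. cmod (\<psi> t) \<le> B" "0 \<le> B" "s \<in> K" for \<psi> :: "real \<Rightarrow> complex" and B s
    unfolding norm_mult using that M[of s] T by (intro mult_mono) auto
  then show ?case by (intro exI[of _ "\<bar>M\<bar>"]) simp
next
  case (Suc j)
  define m1 where "m1 = vderiv m"
  define m2 where "m2 s = m s * complex_of_real (vderiv \<sigma> s)" for s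
  have m1: "smooth_on I m1" unfolding m1_def by (intro smooth_on_vderiv Suc.prems assms)
  have m2: "smooth_on I m2" unfolding m2_def[abs_def]
    by (intro smooth_on_mult smooth_on_of_real smooth_on_vderiv Suc.prems assms)
  obtain M1 where M1: "0 \<le> M1" "\<And>(\<psi> :: real \<Rightarrow> complex) B s. smooth_on J \<psi> \<Longrightarrow> 0 \<le> B \<Longrightarrow>
      (\<And>i t. i \<le> j \<Longrightarrow> t \<in> T \<Longrightarrow> cmod ((vderiv ^^ i) \<psi> t) \<le> B) \<Longrightarrow> s \<in> K \<Longrightarrow>
      cmod ((vderiv ^^ j) (\<lambda>s. m1 s * \<psi> (\<sigma> s)) s) \<le> M1 * B"
    using Suc.IH[OF m1] by (elim exE conjE) auto
  obtain M2 where M2: "0 \<le> M2" "\<And>(\<psi> :: real \<Rightarrow> complex) B s. smooth_on J \<psi> \<Longrightarrow> 0 \<le> B \<Longrightarrow>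
      (\<And>i t. i \<le> j \<Longrightarrow> t \<in> T \<Longrightarrow> cmod ((vderiv ^^ i) \<psi> t) \<le> B) \<Longrightarrow> s \<in> K \<Longrightarrow>
      cmod ((vderiv ^^ j) (\<lambda>s. m2 s * \<psi> (\<sigma> s)) s) \<le> M2 * B"
    using Suc.IH[OF m2] by (elim exE conjE) auto
  have "cmod ((vderiv ^^ Suc j) (\<lambda>s. m s * \<psi> (\<sigma> s)) s) \<le> (M1 + M2) * B"
    if \<psi>: "smooth_on J \<psi>" and B: "0 \<le> B" and le: "\<forall>i\<le>Suc j. \<forall>t\<in>T. cmod ((vderiv ^^ i) \<psi> t) \<le> B" and s: "s \<in> K"
    for \<psi> :: "real \<Rightarrow> complex" and B s
  proof -
    have d: "vderiv (\<lambda>s. m s * \<psi> (\<sigma> s)) r = m1 r * \<psi> (\<sigma> r) + m2 r * vderiv \<psi> (\<sigma> r)" if r: "r \<in> I" for r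
    proof -
      have "((\<psi> \<circ> \<sigma>) has_vector_derivative vderiv \<sigma> r *\<^sub>R vderiv \<psi> (\<sigma> r)) (at r)"
        using smooth_on_has_vderiv[OF assms(2) r] smooth_on_has_vderiv[OF \<psi> assms(4)[OF r]]
        by (rule vector_diff_chain_at)
      from has_vector_derivative_mult[OF smooth_on_has_vderiv[OF Suc.prems r] this]
      show ?thesis by (intro vector_derivative_at) (simp add: m1_def m2_def scaleR_conv_of_real o_def algebra_simps)
    qed
    have smooth1: "smooth_on I (\<lambda>r. m1 r * \<psi> (\<sigma> r))"
      by (intro smooth_on_mult m1 assms smooth_on_compose[OF \<psi>])
    have smooth2: "smooth_on I (\<lambda>r. m2 r * vderiv \<psi> (\<sigma> r))"
      by (intro smooth_on_mult m2 assms smooth_on_compose[OF smooth_on_vderiv[OF \<psi>]])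
    have sI: "s \<in> I" using s K by auto
    have "(vderiv ^^ Suc j) (\<lambda>s. m s * \<psi> (\<sigma> s)) s = (vderiv ^^ j) (vderiv (\<lambda>s. m s * \<psi> (\<sigma> s))) s"
      by (simp only: funpow_Suc_right o_apply)
    also have "\<dots> = (vderiv ^^ j) (\<lambda>r. m1 r * \<psi> (\<sigma> r) + m2 r * vderiv \<psi> (\<sigma> r)) s"
      by (rule vderiv_pow_cong[OF assms(1) d sI])
    also have "\<dots> = (vderiv ^^ j) (\<lambda>r. m1 r * \<psi> (\<sigma> r)) s + (vderiv ^^ j) (\<lambda>r. m2 r * vderiv \<psi> (\<sigma> r)) s"
      by (rule vderiv_pow_add[OF smooth1 smooth2 assms(1) sI])
    finally have eq: "(vderiv ^^ Suc j) (\<lambda>s. m s * \<psi> (\<sigma> s)) s =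
      (vderiv ^^ j) (\<lambda>r. m1 r * \<psi> (\<sigma> r)) s + (vderiv ^^ j) (\<lambda>r. m2 r * vderiv \<psi> (\<sigma> r)) s" .
    have "cmod ((vderiv ^^ j) (\<lambda>r. m1 r * \<psi> (\<sigma> r)) s) \<le> M1 * B"
      using le by (intro M1(2) \<psi> B s) simp
    moreover have "cmod ((vderiv ^^ j) (\<lambda>r. m2 r * vderiv \<psi> (\<sigma> r)) s) \<le> M2 * B"
    proof (rule M2(2)[OF smooth_on_vderiv[OF \<psi> assms(3)] B _ s])
      fix i t assume "i \<le> j" "t \<in> T"
      then have "cmod ((vderiv ^^ Suc i) \<psi> t) \<le> B" using le by (metis Suc_le_mono)
      then show "cmod ((vderiv ^^ i) (vderiv \<psi>) t) \<le> B" by (simp only: funpow_Suc_right o_apply)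
    qed
    ultimately show ?thesis
      unfolding eq using norm_triangle_mono by (simp add: distrib_right)
  qed
  then show ?case using M1(1) M2(1) by (intro exI[of _ "M1 + M2"]) simp
qed

lemma product_compose_bound_uniform:
  fixes m :: "real \<Rightarrow> complex" and \<sigma> :: "real \<Rightarrow> real"
  assumes "open I" "smooth_on I \<sigma>" "open J" "\<And>s. s \<in> I \<Longrightarrow> \<sigma> s \<in> J"
    and K: "compact K" "K \<subseteq> I" and T: "\<And>s. s \<in> K \<Longrightarrow> \<sigma> s \<in> T" and "smooth_on I m"
  obtains M where "0 \<le> M" "\<And>(\<psi> :: real \<Rightarrow> complex) B j s. smooth_on J \<psi> \<Longrightarrow> 0 \<le> B \<Longrightarrow>
      (\<And>i t. i \<le> n \<Longrightarrow> t \<in> T \<Longrightarrow> cmod ((vderiv ^^ i) \<psi> t) \<le> B) \<Longrightarrow> j \<le> n \<Longrightarrow> s \<in> K \<Longrightarrow>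
      cmod ((vderiv ^^ j) (\<lambda>s. m s * \<psi> (\<sigma> s)) s) \<le> M * B"
proof -
  define Q where "Q j M \<longleftrightarrow> 0 \<le> M \<and> (\<forall>(\<psi> :: real \<Rightarrow> complex) B. smooth_on J \<psi> \<longrightarrow> 0 \<le> B \<longrightarrow>
      (\<forall>i\<le>j. \<forall>t\<in>T. cmod ((vderiv ^^ i) \<psi> t) \<le> B) \<longrightarrow>
      (\<forall>s\<in>K. cmod ((vderiv ^^ j) (\<lambda>s. m s * \<psi> (\<sigma> s)) s) \<le> M * B))" for j M
  have "\<exists>M. Q j M" for j unfolding Q_def by (rule product_compose_bound[OF assms])
  then obtain M where "\<And>j. Q j (M j)" by metis
  then have M: "0 \<le> M j" "\<And>(\<psi> :: real \<Rightarrow> complex) B s. smooth_on J \<psi> \<Longrightarrow> 0 \<le> B \<Longrightarrow>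
      (\<forall>i\<le>j. \<forall>t\<in>T. cmod ((vderiv ^^ i) \<psi> t) \<le> B) \<Longrightarrow> s \<in> K \<Longrightarrow>
      cmod ((vderiv ^^ j) (\<lambda>s. m s * \<psi> (\<sigma> s)) s) \<le> M j * B" for j
    by (simp_all add: Q_def)
  show ?thesis
  proof (rule that[of "\<Sum>j\<le>n. M j"])
    show "0 \<le> (\<Sum>j\<le>n. M j)" using M(1) by (intro sum_nonneg)
    fix \<psi> :: "real \<Rightarrow> complex" and B j s
    assume *: "smooth_on J \<psi>" "0 \<le> B" "\<And>i t. i \<le> n \<Longrightarrow> t \<in> T \<Longrightarrow> cmod ((vderiv ^^ i) \<psi> t) \<le> B" "j \<le> n" "s \<in> K"
    have "\<forall>i\<le>j. \<forall>t\<in>T. cmod ((vderiv ^^ i) \<psi> t) \<le> B" using * by simp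
    then have "cmod ((vderiv ^^ j) (\<lambda>s. m s * \<psi> (\<sigma> s)) s) \<le> M j * B"
      by (rule M(2)[OF *(1,2) _ *(5)])
    also have "\<dots> \<le> (\<Sum>j\<le>n. M j) * B"
      using *(2,4) M(1) by (intro mult_right_mono member_le_sum) auto
    finally show "cmod ((vderiv ^^ j) (\<lambda>s. m s * \<psi> (\<sigma> s)) s) \<le> (\<Sum>j\<le>n. M j) * B" .
  qed
qed

context curve
begin

text \<open>The definition of \<open>pull\<close> divides by the speed, which is undone here.\<close>

lemma apply_push:
  assumes "(c, J) \<in> charts \<Gamma>"
  shows "u (push (c, J) \<psi>) = pull L (c, J) u (\<lambda>t. \<psi> t * speed L (c, J) t)"
proof -
  have "push (c, J) \<psi> = push (c, J) (\<lambda>t. \<psi> t * speed L (c, J) t / speed L (c, J) t)"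
    using speed_pos[OF assms] by (intro push_cong) force
  then show ?thesis by (simp add: pull_def)
qed

text \<open>A partition of unity writes every smooth function as a sum of functions supported in charts.\<close>

lemma distribution_eqI:
  assumes u: "u \<in> distributions \<Gamma>" and v: "v \<in> distributions \<Gamma>"
    and eq: "\<And>c J \<psi>. (c, J) \<in> charts \<Gamma> \<Longrightarrow> \<psi> \<in> Cc_inf J \<Longrightarrow> pull L (c, J) u \<psi> = pull L (c, J) v \<psi>"
  shows "u = v"
proof
  fix h
  show "u h = v h"
  proof (cases "h \<in> Cinf \<Gamma>")
    case True
    obtain P c J \<eta> where P: "finite (P :: (real^2) set)" "\<And>p. p \<in> P \<Longrightarrow> (c p, J p) \<in> charts \<Gamma>"
      "\<And>p. p \<in> P \<Longrightarrow> \<eta> p \<in> Cc_inf (J p)" "\<And>x. x \<in> \<Gamma> \<Longrightarrow> (\<Sum>p\<in>P. push (c p, J p) (\<eta> p) x) = 1"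
      by (rule partition_of_unity[OF compact manifold]) (rule that)
    define \<psi> where "\<psi> p t = \<eta> p t * h (c p t)" for p t
    have \<psi>: "\<psi> p \<in> Cc_inf (J p)" if "p \<in> P" for p
      unfolding \<psi>_def[abs_def] using P(2,3)[OF that] True by (intro Cc_inf_mult_Cinf)
    have h: "h = (\<lambda>x. \<Sum>p\<in>P. push (c p, J p) (\<psi> p) x)"
      unfolding \<psi>_def by (rule partition_decompose[OF True P(2,4)])
    have "u (push (c p, J p) (\<psi> p)) = v (push (c p, J p) (\<psi> p))" if "p \<in> P" for p
      unfolding apply_push[OF P(2)[OF that]]
      by (intro eq P(2) that Cc_inf_mult_speed \<psi>)
    then show ?thesis
      by (subst (1 2) h) (simp add: distribution_sum[OF u] distribution_sum[OF v] push_Cinf[OF P(2) \<psi>])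
  qed (simp add: distribution_off[OF u] distribution_off[OF v])
qed

lemma dist_of_eqI:
  assumes "u \<in> distributions \<Gamma>"
    and "\<And>c J \<psi>. (c, J) \<in> charts \<Gamma> \<Longrightarrow> \<psi> \<in> Cc_inf J \<Longrightarrow> pull L (c, J) u \<psi> = (LINT t|lborel. f (c t) * \<psi> t)"
  shows "dist_of L \<Gamma> f = u"
  unfolding dist_of_def
proof (rule the_equality)
  show "u \<in> distributions \<Gamma> \<and> (\<forall>(c, J)\<in>charts \<Gamma>. \<forall>\<psi>\<in>Cc_inf J. pull L (c, J) u \<psi> = (LINT t|lborel. f (c t) * \<psi> t))"
    using assms by auto
next
  fix v assume v: "v \<in> distributions \<Gamma> \<and> (\<forall>(c, J)\<in>charts \<Gamma>. \<forall>\<psi>\<in>Cc_inf J. pull L (c, J) v \<psi> = (LINT t|lborel. f (c t) * \<psi> t))"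
  show "v = u"
  proof (rule distribution_eqI)
    fix c J \<psi> assume "(c, J) \<in> charts \<Gamma>" "\<psi> \<in> Cc_inf J"
    then show "pull L (c, J) v \<psi> = pull L (c, J) u \<psi>" using v assms(2) by auto
  qed (use v assms in auto)
qed

text \<open>The form in which the independence of the chart is used: integrals of pieces, each in its own
  chart, against a function supported in one further chart add up to an integral in that chart.\<close>

lemma sum_chart_change:
  assumes \<kappa>: "(c, J) \<in> charts \<Gamma>" "\<psi> \<in> Cc_inf J"
    and P: "\<And>p. p \<in> P \<Longrightarrow> (c' p, J' p) \<in> charts \<Gamma>" "\<And>p. p \<in> P \<Longrightarrow> a p \<in> Cc_inf (J' p)"
  shows "(\<Sum>p\<in>P. LINT t|lborel. a p t * push (c, J) (\<lambda>t. \<psi> t / speed L (c, J) t) (c' p t) * speed L (c' p, J' p) t)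
    = (LINT t|lborel. (\<Sum>p\<in>P. push (c' p, J' p) (a p) (c t)) * \<psi> t)"
proof -
  have int: "integrable lborel (\<lambda>t. push (c' p, J' p) (a p) (c t) * \<psi> t)" if "p \<in> P" for p
    using Cc_inf_integrable[OF Cc_inf_mult_Cinf[OF \<kappa> push_Cinf[OF P[OF that]]]] by (simp add: mult.commute)
  have "(LINT t|lborel. a p t * push (c, J) (\<lambda>t. \<psi> t / speed L (c, J) t) (c' p t) * speed L (c' p, J' p) t)
      = (LINT t|lborel. push (c' p, J' p) (a p) (c t) * \<psi> t)" if "p \<in> P" for p
    unfolding chart_change[OF P(1)[OF that] \<kappa>(1) P(2)[OF that] Cc_inf_div_speed[OF \<kappa>]]
  proof (intro Bochner_Integration.integral_cong refl)
    fix t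
    show "\<psi> t / speed L (c, J) t * push (c' p, J' p) (a p) (c t) * speed L (c, J) t = push (c' p, J' p) (a p) (c t) * \<psi> t"
      using speed_pos[OF \<kappa>(1), of t] Cc_infD(2)[OF \<kappa>(2), of t] by (cases "t \<in> J") auto
  qed
  then have "(\<Sum>p\<in>P. LINT t|lborel. a p t * push (c, J) (\<lambda>t. \<psi> t / speed L (c, J) t) (c' p t) * speed L (c' p, J' p) t)
    = (\<Sum>p\<in>P. LINT t|lborel. push (c' p, J' p) (a p) (c t) * \<psi> t)" by simp
  also have "\<dots> = (LINT t|lborel. (\<Sum>p\<in>P. push (c' p, J' p) (a p) (c t) * \<psi> t))"
    by (rule Bochner_Integration.integral_sum[symmetric]) (rule int)
  finally show ?thesis by (simp add: sum_distrib_right)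
qed

text \<open>A smooth function defines a distribution of order zero, namely integration against it,
  assembled from charts by a partition of unity.\<close>

lemma dist_of_exists:
  assumes f: "f \<in> Cinf \<Gamma>"
  obtains u S C where "u \<in> distributions \<Gamma>"
    "\<And>c J \<psi>. (c, J) \<in> charts \<Gamma> \<Longrightarrow> \<psi> \<in> Cc_inf J \<Longrightarrow> pull L (c, J) u \<psi> = (LINT t|lborel. f (c t) * \<psi> t)"
    "seminorm_bound \<Gamma> S 0 C u"
proof -
  obtain P c J \<eta> where P: "finite (P :: (real^2) set)" "\<And>p. p \<in> P \<Longrightarrow> (c p, J p) \<in> charts \<Gamma>"
    "\<And>p. p \<in> P \<Longrightarrow> \<eta> p \<in> Cc_inf (J p)" "\<And>x. x \<in> \<Gamma> \<Longrightarrow> (\<Sum>p\<in>P. push (c p, J p) (\<eta> p) x) = 1"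
    by (rule partition_of_unity[OF compact manifold]) (rule that)
  define a where "a p t = \<eta> p t * f (c p t)" for p t
  have a: "a p \<in> Cc_inf (J p)" if "p \<in> P" for p
    unfolding a_def[abs_def] using P(2,3)[OF that] f by (intro Cc_inf_mult_Cinf)
  have f_eq: "(\<Sum>p\<in>P. push (c p, J p) (a p) x) = f x" for x
    unfolding a_def[abs_def] by (rule fun_cong[OF partition_decompose[OF f P(2,4)], symmetric])
  define w where "w p t = a p t * speed L (c p, J p) t" for p t
  have w: "w p \<in> Cc_inf (J p)" if "p \<in> P" for p
    unfolding w_def[abs_def] using P(2)[OF that] a[OF that] by (intro Cc_inf_mult_speed)
  have "\<exists>K. compact K \<and> K \<subseteq> J p \<and> (\<forall>t. t \<notin> K \<longrightarrow> w p t = 0)" if "p \<in> P" for p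
    using Cc_infE[OF w[OF that]] by metis
  then obtain K where K: "\<And>p. p \<in> P \<Longrightarrow> compact (K p)" "\<And>p. p \<in> P \<Longrightarrow> K p \<subseteq> J p"
    "\<And>p t. p \<in> P \<Longrightarrow> t \<notin> K p \<Longrightarrow> w p t = 0" by metis
  define S where "S = (\<lambda>p. ((c p, J p), K p)) ` P"
  define C where "C = (\<Sum>p\<in>P. LINT t|lborel. cmod (w p t))"
  define u where "u h = (if h \<in> Cinf \<Gamma> then \<Sum>p\<in>P. LINT t|lborel. w p t * h (c p t) else 0)" for h
  have int: "integrable lborel (\<lambda>t. w p t * h (c p t))" if "p \<in> P" "h \<in> Cinf \<Gamma>" for p h
    using Cc_inf_integrable[OF Cc_inf_mult_Cinf[OF P(2)[OF that(1)] w[OF that(1)] that(2)]] .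
  have S: "finite S" "\<And>c J K. ((c, J), K) \<in> S \<Longrightarrow> (c, J) \<in> charts \<Gamma> \<and> compact K \<and> K \<subseteq> J"
    using P(1,2) K by (auto simp: S_def)
  have bound: "cmod (u h) \<le> C * B"
    if h: "h \<in> Cinf \<Gamma>" and B: "0 \<le> B"
      and le: "\<And>c J K t. ((c, J), K) \<in> S \<Longrightarrow> t \<in> K \<Longrightarrow> cmod (h (c t)) \<le> B" for h B
  proof -
    have "cmod (LINT t|lborel. w p t * h (c p t)) \<le> (LINT t|lborel. cmod (w p t)) * B" if p: "p \<in> P" for p
    proof -
      have "cmod (w p t * h (c p t)) \<le> cmod (w p t) * B" for t
        using K(3)[OF p, of t] le[of "c p" "J p" "K p" t] p
        by (cases "t \<in> K p") (auto simp: S_def norm_mult intro!: mult_left_mono)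
      then have "cmod (LINT t|lborel. w p t * h (c p t)) \<le> (LINT t|lborel. cmod (w p t) * B)"
        by (intro Bochner_Integration.integral_norm_bound_integral int p h integrable_mult_left
            integrable_norm Cc_inf_integrable[OF w]) auto
      then show ?thesis by simp
    qed
    then show ?thesis
      unfolding u_def C_def sum_distrib_right using h by (simp add: sum_norm_le)
  qed
  have C: "0 \<le> C" by (auto simp: C_def intro!: sum_nonneg)
  have sb: "seminorm_bound \<Gamma> S 0 C u"
  proof (rule seminorm_boundI[OF S(1) C S(2)])
    show "cmod (u h) \<le> C * B" if "h \<in> Cinf \<Gamma>" "0 \<le> B"
      "\<And>c J K j t. ((c, J), K) \<in> S \<Longrightarrow> j \<le> 0 \<Longrightarrow> t \<in> K \<Longrightarrow> cmod ((vderiv ^^ j) (\<lambda>s. h (c s)) t) \<le> B" for h B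
      using that(3)[of _ _ _ 0] by (intro bound that) simp
  qed
  show ?thesis
  proof (rule that[of u S C])
    show "u \<in> distributions \<Gamma>"
    proof (rule distributionI[OF _ _ _ sb])
      show "u (\<lambda>x. h x + k x) = u h + u k" if "h \<in> Cinf \<Gamma>" "k \<in> Cinf \<Gamma>" for h k
        using that int by (simp add: u_def Cinf_add distrib_left sum.distrib)
      show "u (\<lambda>x. k * h x) = k * u h" if "h \<in> Cinf \<Gamma>" for k h
        using that by (simp add: u_def Cinf_scale sum_distrib_left mult.left_commute[of _ k])
      show "u h = 0" if "h \<notin> Cinf \<Gamma>" for h using that by (simp add: u_def)
    qed
    fix c' J' \<psi> assume \<kappa>: "(c', J') \<in> charts \<Gamma>" "\<psi> \<in> Cc_inf J'"
    let ?h = "push (c', J') (\<lambda>t. \<psi> t / speed L (c', J') t)"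
    have "?h \<in> Cinf \<Gamma>" by (intro push_Cinf Cc_inf_div_speed \<kappa>)
    then have "pull L (c', J') u \<psi> = (\<Sum>p\<in>P. LINT t|lborel. a p t * ?h (c p t) * speed L (c p, J p) t)"
      by (simp add: pull_def u_def w_def mult_ac)
    also have "\<dots> = (LINT t|lborel. (\<Sum>p\<in>P. push (c p, J p) (a p) (c' t)) * \<psi> t)"
      by (rule sum_chart_change[OF \<kappa> P(2) a])
    also have "\<dots> = (LINT t|lborel. f (c' t) * \<psi> t)"
      unfolding f_eq ..
    finally show "pull L (c', J') u \<psi> = (LINT t|lborel. f (c' t) * \<psi> t)" .
  qed (rule sb)
qed

lemma dist_of_properties:
  assumes "f \<in> Cinf \<Gamma>"
  shows "dist_of L \<Gamma> f \<in> distributions \<Gamma> \<and> (\<exists>S C. seminorm_bound \<Gamma> S 0 C (dist_of L \<Gamma> f)) \<and>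
    (\<forall>c J \<psi>. (c, J) \<in> charts \<Gamma> \<longrightarrow> \<psi> \<in> Cc_inf J \<longrightarrow>
      pull L (c, J) (dist_of L \<Gamma> f) \<psi> = (LINT t|lborel. f (c t) * \<psi> t))"
proof (rule dist_of_exists[OF assms])
  fix u S C
  assume *: "u \<in> distributions \<Gamma>"
    "\<And>c J \<psi>. (c, J) \<in> charts \<Gamma> \<Longrightarrow> \<psi> \<in> Cc_inf J \<Longrightarrow> pull L (c, J) u \<psi> = (LINT t|lborel. f (c t) * \<psi> t)"
    "seminorm_bound \<Gamma> S 0 C u"
  have "dist_of L \<Gamma> f = u" by (rule dist_of_eqI[OF *(1,2)])
  then show ?thesis using * by auto
qed

lemma dist_of_distribution: "f \<in> Cinf \<Gamma> \<Longrightarrow> dist_of L \<Gamma> f \<in> distributions \<Gamma>"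
  and dist_of_order_zero: "f \<in> Cinf \<Gamma> \<Longrightarrow> \<exists>S C. seminorm_bound \<Gamma> S 0 C (dist_of L \<Gamma> f)"
  and pull_dist_of: "f \<in> Cinf \<Gamma> \<Longrightarrow> (c, J) \<in> charts \<Gamma> \<Longrightarrow> \<psi> \<in> Cc_inf J \<Longrightarrow>
    pull L (c, J) (dist_of L \<Gamma> f) \<psi> = (LINT t|lborel. f (c t) * \<psi> t)"
  using dist_of_properties[of f] by simp_all

lemma local_fourier_dist_of:
  assumes "f \<in> Cinf \<Gamma>" "(c, J) \<in> charts \<Gamma>" "\<eta> \<in> Cc_inf J"
  shows "local_fourier L (c, J) \<eta> (dist_of L \<Gamma> f) = fourier (\<lambda>t. \<eta> t * f (c t))"
proof
  fix \<xi>
  have "smooth_on J (\<lambda>t. cis (- (\<xi> * t)))" using smooth_on_subset[OF smooth_on_cis_neg] by blast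
  then have "(\<lambda>t. \<eta> t * cis (- (\<xi> * t))) \<in> Cc_inf J"
    by (intro Cc_inf_mult assms chartsD(1)[OF assms(2)])
  then show "local_fourier L (c, J) \<eta> (dist_of L \<Gamma> f) \<xi> = fourier (\<lambda>t. \<eta> t * f (c t)) \<xi>"
    by (simp add: local_fourier_def fourier_def pull_dist_of[OF assms(1,2)] mult_ac)
qed

text \<open>The local Fourier transforms of the distribution determine the function, by Fourier inversion.\<close>

lemma dist_of_inj:
  assumes f: "f \<in> Cinf \<Gamma>" and g: "g \<in> Cinf \<Gamma>" and eq: "dist_of L \<Gamma> f = dist_of L \<Gamma> g"
  shows "f = g"
proof
  fix x
  show "f x = g x"
  proof (cases "x \<in> \<Gamma>")
    case True
    obtain c J t where \<kappa>: "(c, J) \<in> charts \<Gamma>" "t \<in> J" "c t = x"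
      using bspec[OF manifold[unfolded smooth_curve_manifold_def] True] by (auto simp del: split_paired_Ex)
    obtain e :: "real \<Rightarrow> real" where e: "(\<lambda>t. complex_of_real (e t)) \<in> Cc_inf J" "\<And>s. s \<in> {t} \<Longrightarrow> e s = 1"
      using Cc_inf_cutoff[OF chartsD(1)[OF \<kappa>(1)], of "{t}"] \<kappa>(2) by auto
    have "fourier (\<lambda>t. complex_of_real (e t) * f (c t)) = fourier (\<lambda>t. complex_of_real (e t) * g (c t))"
      using local_fourier_dist_of[OF f \<kappa>(1) e(1)] local_fourier_dist_of[OF g \<kappa>(1) e(1)] eq by simp
    then have "complex_of_real (2 * pi) * (complex_of_real (e t) * f (c t)) = complex_of_real (2 * pi) * (complex_of_real (e t) * g (c t))"
      using fourier_inversion[OF Cc_inf_mult_Cinf[OF \<kappa>(1) e(1) f], of t]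
        fourier_inversion[OF Cc_inf_mult_Cinf[OF \<kappa>(1) e(1) g], of t] by metis
    then show ?thesis using e(2)[of t] \<kappa>(3) by simp
  qed (simp add: CinfD(2)[OF f] CinfD(2)[OF g])
qed

lemma dist_of_add:
  assumes "f \<in> Cinf \<Gamma>" "g \<in> Cinf \<Gamma>"
  shows "dist_of L \<Gamma> (\<lambda>x. f x + g x) = (\<lambda>h. dist_of L \<Gamma> f h + dist_of L \<Gamma> g h)"
proof (rule dist_of_eqI)
  obtain S1 C1 S2 C2 where "seminorm_bound \<Gamma> S1 0 C1 (dist_of L \<Gamma> f)" "seminorm_bound \<Gamma> S2 0 C2 (dist_of L \<Gamma> g)"
    using dist_of_order_zero assms by metis
  note sb = seminorm_bound_add[OF this]
  show "(\<lambda>h. dist_of L \<Gamma> f h + dist_of L \<Gamma> g h) \<in> distributions \<Gamma>"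
    using distribution_add[OF dist_of_distribution] distribution_scale[OF dist_of_distribution]
      distribution_off[OF dist_of_distribution] assms
    by (intro distributionI[OF _ _ _ sb]) (simp_all add: distrib_left)
next
  fix c J \<psi> assume \<kappa>: "(c, J) \<in> charts \<Gamma>" "\<psi> \<in> Cc_inf J"
  have "integrable lborel (\<lambda>t. f (c t) * \<psi> t)" "integrable lborel (\<lambda>t. g (c t) * \<psi> t)"
    using Cc_inf_integrable[OF Cc_inf_mult_Cinf[OF \<kappa>]] assms by (simp_all add: mult.commute)
  then show "pull L (c, J) (\<lambda>h. dist_of L \<Gamma> f h + dist_of L \<Gamma> g h) \<psi> = (LINT t|lborel. (f (c t) + g (c t)) * \<psi> t)"
    using pull_dist_of[OF assms(1) \<kappa>] pull_dist_of[OF assms(2) \<kappa>] by (simp add: pull_def distrib_right)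
qed

lemma dist_of_scale:
  assumes "f \<in> Cinf \<Gamma>"
  shows "dist_of L \<Gamma> (\<lambda>x. k * f x) = (\<lambda>h. k * dist_of L \<Gamma> f h)"
proof (rule dist_of_eqI)
  obtain S C where "seminorm_bound \<Gamma> S 0 C (dist_of L \<Gamma> f)"
    using dist_of_order_zero assms by metis
  note sb = seminorm_bound_scale[OF this]
  show "(\<lambda>h. k * dist_of L \<Gamma> f h) \<in> distributions \<Gamma>"
    using distribution_add[OF dist_of_distribution] distribution_scale[OF dist_of_distribution]
      distribution_off[OF dist_of_distribution] assms
    by (intro distributionI[OF _ _ _ sb]) (simp_all add: distrib_left)
next
  fix c J \<psi> assume \<kappa>: "(c, J) \<in> charts \<Gamma>" "\<psi> \<in> Cc_inf J"
  show "pull L (c, J) (\<lambda>h. k * dist_of L \<Gamma> f h) \<psi> = (LINT t|lborel. k * f (c t) * \<psi> t)"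
    using pull_dist_of[OF assms(1) \<kappa>] by (simp add: pull_def mult.assoc)
qed

text \<open>In a chart, and cut off there, a distribution is a functional of finite order on the line. The
  order is the same for all charts and cutoffs, since it is read off from finitely many seminorms.\<close>

lemma distribution_finite_order:
  assumes u: "u \<in> distributions \<Gamma>"
  obtains n where "\<And>c J \<eta>. (c, J) \<in> charts \<Gamma> \<Longrightarrow> \<eta> \<in> Cc_inf J \<Longrightarrow>
    finite_order n (\<lambda>\<psi>. pull L (c, J) u (\<lambda>t. \<eta> t * \<psi> t))"
proof -
  obtain S n C where "seminorm_bound \<Gamma> S n C u" using distributionE[OF u] by metis
  note S = seminorm_boundD[OF this]
  have "finite_order n (\<lambda>\<psi>. pull L (c, J) u (\<lambda>t. \<eta> t * \<psi> t))" if \<kappa>: "(c, J) \<in> charts \<Gamma>" and \<eta>: "\<eta> \<in> Cc_inf J"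
    for c J \<eta>
  proof -
    have J: "open J" by (rule chartsD[OF \<kappa>])
    define \<beta> where "\<beta> \<psi> t = \<eta> t * \<psi> t / speed L (c, J) t" for \<psi> t
    have \<beta>: "\<beta> \<psi> \<in> Cc_inf J" if "smooth_on UNIV \<psi>" for \<psi>
      unfolding \<beta>_def[abs_def] using smooth_on_subset[OF that]
      by (intro Cc_inf_div_speed \<kappa> Cc_inf_mult \<eta> J) blast
    have pull: "pull L (c, J) u (\<lambda>t. \<eta> t * \<psi> t) = u (push (c, J) (\<beta> \<psi>))" for \<psi>
      by (simp add: pull_def \<beta>_def[abs_def])
    obtain K0 where K0: "compact K0" "K0 \<subseteq> J" "\<And>t. t \<notin> K0 \<Longrightarrow> \<eta> t = 0" using Cc_infE[OF \<eta>] by metis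
    obtain e :: "real \<Rightarrow> real" where e: "(\<lambda>t. complex_of_real (e t)) \<in> Cc_inf J" "\<And>t. t \<in> K0 \<Longrightarrow> e t = 1"
      using Cc_inf_cutoff[OF J K0(1,2)] by metis
    \<comment> \<open>On the support of \<open>\<eta>\<close>, \<open>X\<close> is the coordinate of the chart, extended smoothly to the whole curve;
      so in any other chart the argument of \<open>u\<close> becomes \<open>(Y \<circ> c') \<cdot> (\<psi> \<circ> Re X \<circ> c')\<close>.\<close>
    define X where "X = push (c, J) (\<lambda>t. complex_of_real (e t) * complex_of_real t)"
    define Y where "Y = push (c, J) (\<lambda>t. \<eta> t / speed L (c, J) t)"
    have X: "X \<in> Cinf \<Gamma>"
      unfolding X_def by (intro push_Cinf \<kappa> Cc_inf_mult e J smooth_on_of_real smooth_on_ident)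
    have Y: "Y \<in> Cinf \<Gamma>" unfolding Y_def by (intro push_Cinf \<kappa> Cc_inf_div_speed \<eta>)
    have factor: "push (c, J) (\<beta> \<psi>) x = Y x * \<psi> (Re (X x))" for \<psi> x
    proof (cases "x \<in> c ` J")
      case True
      define t where "t = inv_into J c x"
      have "push (c, J) \<theta> x = \<theta> t" for \<theta> using True by (simp add: push_def t_def)
      then show ?thesis using K0(3)[of t] e(2)[of t]
        by (cases "t \<in> K0") (simp_all add: X_def Y_def \<beta>_def)
    qed (simp add: push_off Y_def)
    \<comment> \<open>The constant \<open>M\<close> serves as a bound for the coordinate and as the constant of the estimate.\<close>
    define good where "good s M \<longleftrightarrow> (\<forall>\<psi> B. smooth_on UNIV \<psi> \<longrightarrow> 0 \<le> B \<longrightarrow>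
        (\<forall>i\<le>n. \<forall>t. \<bar>t\<bar> \<le> M \<longrightarrow> cmod ((vderiv ^^ i) \<psi> t) \<le> B) \<longrightarrow>
        (\<forall>j\<le>n. \<forall>t\<in>snd s. cmod ((vderiv ^^ j) (\<lambda>t. push (c, J) (\<beta> \<psi>) (fst (fst s) t)) t) \<le> M * B))" for s :: "chart \<times> real set" and M
    have "\<exists>M\<ge>0. good s M" if s: "s \<in> S" for s
    proof -
      obtain c' J' K' where s_eq: "s = ((c', J'), K')" by (metis surj_pair)
      have \<kappa>': "(c', J') \<in> charts \<Gamma>" "compact K'" "K' \<subseteq> J'" using S(3) s by (auto simp: s_eq)
      define \<sigma> where "\<sigma> t = Re (X (c' t))" for t
      have J': "open J'" by (rule chartsD[OF \<kappa>'(1)])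
      have \<sigma>: "smooth_on J' \<sigma>" unfolding \<sigma>_def[abs_def]
        by (intro smooth_on_linear[OF _ J' bounded_linear_Re] CinfD(1)[OF X \<kappa>'(1)])
      have "bounded (\<sigma> ` K')"
        using smooth_on_continuous[OF \<sigma>] \<kappa>'(2,3)
        by (intro compact_imp_bounded compact_continuous_image) (auto intro: continuous_on_subset)
      then obtain R where R: "\<And>t. t \<in> K' \<Longrightarrow> \<bar>\<sigma> t\<bar> \<le> R" unfolding bounded_iff by auto
      obtain M where M: "0 \<le> M" "\<And>(\<psi> :: real \<Rightarrow> complex) B j s. smooth_on UNIV \<psi> \<Longrightarrow> 0 \<le> B \<Longrightarrow>
          (\<And>i t. i \<le> n \<Longrightarrow> t \<in> {t. \<bar>t\<bar> \<le> R} \<Longrightarrow> cmod ((vderiv ^^ i) \<psi> t) \<le> B) \<Longrightarrow> j \<le> n \<Longrightarrow> s \<in> K' \<Longrightarrow>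
          cmod ((vderiv ^^ j) (\<lambda>s. Y (c' s) * \<psi> (\<sigma> s)) s) \<le> M * B"
        by (rule product_compose_bound_uniform[OF J' \<sigma> open_UNIV UNIV_I \<kappa>'(2,3) _ CinfD(1)[OF Y \<kappa>'(1)],
              of "{t. \<bar>t\<bar> \<le> R}" n]) (use R in \<open>simp, blast\<close>)
      have "good s (max M R)"
        unfolding good_def s_eq fst_conv snd_conv factor \<sigma>_def[symmetric]
      proof (intro allI impI ballI)
        fix \<psi> :: "real \<Rightarrow> complex" and B j t
        assume *: "smooth_on UNIV \<psi>" "0 \<le> B" "\<forall>i\<le>n. \<forall>t. \<bar>t\<bar> \<le> max M R \<longrightarrow> cmod ((vderiv ^^ i) \<psi> t) \<le> B" "j \<le> n" "t \<in> K'"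
        have "cmod ((vderiv ^^ j) (\<lambda>s. Y (c' s) * \<psi> (\<sigma> s)) t) \<le> M * B"
          using *(3) by (intro M(2) *(1,2,4,5)) simp
        also have "\<dots> \<le> max M R * B" using *(2) by (intro mult_right_mono) auto
        finally show "cmod ((vderiv ^^ j) (\<lambda>s. Y (c' s) * \<psi> (\<sigma> s)) t) \<le> max M R * B" .
      qed
      then show ?thesis using M(1) by (intro exI[of _ "max M R"]) simp
    qed
    then obtain M where M: "\<And>s. s \<in> S \<Longrightarrow> 0 \<le> M s" "\<And>s. s \<in> S \<Longrightarrow> good s (M s)" by metis
    define N where "N = (\<Sum>s\<in>S. M s)"
    have N: "M s \<le> N" if "s \<in> S" for s
      unfolding N_def using M(1) S(1) that by (intro member_le_sum) auto
    have bound: "cmod (u (push (c, J) (\<beta> \<psi>))) \<le> (C * N) * B"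
      if \<psi>: "smooth_on UNIV \<psi>" "0 \<le> B" "\<forall>i\<le>n. \<forall>t. \<bar>t\<bar> \<le> N \<longrightarrow> cmod ((vderiv ^^ i) \<psi> t) \<le> B" for \<psi> B
    proof -
      have "cmod (u (push (c, J) (\<beta> \<psi>))) \<le> C * (N * B)"
      proof (rule S(4)[OF push_Cinf[OF \<kappa> \<beta>[OF \<psi>(1)]]])
        have "0 \<le> N" unfolding N_def using M(1) by (intro sum_nonneg)
        then show "0 \<le> N * B" using \<psi>(2) by simp
        fix c' J' K' j t assume s: "((c', J'), K') \<in> S" "j \<le> n" "t \<in> K'"
        have "\<forall>i\<le>n. \<forall>t. \<bar>t\<bar> \<le> M ((c', J'), K') \<longrightarrow> cmod ((vderiv ^^ i) \<psi> t) \<le> B"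
          using \<psi>(3) N[OF s(1)] by auto
        then have "cmod ((vderiv ^^ j) (\<lambda>t. push (c, J) (\<beta> \<psi>) (c' t)) t) \<le> M ((c', J'), K') * B"
          using M(2)[OF s(1)] \<psi>(1,2) s(2,3) unfolding good_def fst_conv snd_conv by simp
        also have "\<dots> \<le> N * B" using N[OF s(1)] \<psi>(2) by (intro mult_right_mono)
        finally show "cmod ((vderiv ^^ j) (\<lambda>t. push (c, J) (\<beta> \<psi>) (c' t)) t) \<le> N * B" .
      qed
      then show ?thesis by (simp add: mult.assoc)
    qed
    show ?thesis
      unfolding finite_order_def pull
    proof (intro conjI allI impI)
      fix f g :: "real \<Rightarrow> complex" assume fg: "smooth_on UNIV f" "smooth_on UNIV g"
      have "push (c, J) (\<beta> (\<lambda>t. f t + g t)) = (\<lambda>x. push (c, J) (\<beta> f) x + push (c, J) (\<beta> g) x)"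
        by (auto simp: push_def \<beta>_def add_divide_distrib distrib_left)
      then show "u (push (c, J) (\<beta> (\<lambda>t. f t + g t))) = u (push (c, J) (\<beta> f)) + u (push (c, J) (\<beta> g))"
        using distribution_add[OF u push_Cinf[OF \<kappa> \<beta>[OF fg(1)]] push_Cinf[OF \<kappa> \<beta>[OF fg(2)]]] by simp
    next
      fix k and f :: "real \<Rightarrow> complex" assume f: "smooth_on UNIV f"
      have "push (c, J) (\<beta> (\<lambda>t. k * f t)) = (\<lambda>x. k * push (c, J) (\<beta> f) x)"
        by (auto simp: push_def \<beta>_def)
      then show "u (push (c, J) (\<beta> (\<lambda>t. k * f t))) = k * u (push (c, J) (\<beta> f))"
        using distribution_scale[OF u push_Cinf[OF \<kappa> \<beta>[OF f]]] by simp
    next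
      show "\<exists>C R. \<forall>f B. smooth_on UNIV f \<longrightarrow> 0 \<le> B \<longrightarrow>
          (\<forall>j\<le>n. \<forall>t. \<bar>t\<bar> \<le> R \<longrightarrow> cmod ((vderiv ^^ j) f t) \<le> B) \<longrightarrow> cmod (u (push (c, J) (\<beta> f))) \<le> C * B"
        by (rule exI[of _ "C * N"], rule exI[of _ N], intro allI impI bound) auto
    qed
  qed
  then show ?thesis by (rule that)
qed

end

section \<open>Sobolev spaces on a curve\<close>

context curve
begin

lemma local_fourier_as_functional:
  "local_fourier L (c, J) \<eta> u = (\<lambda>\<xi>. (\<lambda>\<psi>. pull L (c, J) u (\<lambda>t. \<eta> t * \<psi> t)) (\<lambda>t. cis (- (\<xi> * t))))"
  by (simp add: local_fourier_def fun_eq_iff)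

lemma local_fourier_measurable:
  assumes "u \<in> distributions \<Gamma>" "(c, J) \<in> charts \<Gamma>" "\<eta> \<in> Cc_inf J"
  shows "local_fourier L (c, J) \<eta> u \<in> borel_measurable borel"
proof -
  obtain n where "finite_order n (\<lambda>\<psi>. pull L (c, J) u (\<lambda>t. \<eta> t * \<psi> t))"
    using distribution_finite_order[OF assms(1)] assms(2,3) by metis
  from finite_order_transform_continuous[OF this] show ?thesis
    unfolding local_fourier_as_functional by (rule borel_measurable_continuous_onI)
qed

text \<open>A distribution of order \<open>n\<close> has local Fourier transforms that grow at most like \<open>|\<xi>|\<^sup>n\<close>.\<close>

theorem distribution_in_sobolev:
  assumes u: "u \<in> distributions \<Gamma>"
  shows "\<exists>s. u \<in> sobolev L \<Gamma> s"
proof -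
  obtain n where n: "\<And>c J \<eta>. (c, J) \<in> charts \<Gamma> \<Longrightarrow> \<eta> \<in> Cc_inf J \<Longrightarrow>
    finite_order n (\<lambda>\<psi>. pull L (c, J) u (\<lambda>t. \<eta> t * \<psi> t))"
    using distribution_finite_order[OF u] by metis
  have "integrable lborel (\<lambda>\<xi>. (1 + \<xi>\<^sup>2) powr (- real (Suc n)) * (cmod (local_fourier L (c, J) \<eta> u \<xi>))\<^sup>2)"
    if \<kappa>: "(c, J) \<in> charts \<Gamma>" "\<eta> \<in> Cc_inf J" for c J \<eta>
  proof -
    obtain C where C: "\<And>a. cmod (pull L (c, J) u (\<lambda>t. \<eta> t * cis (a * t))) \<le> C * (1 + \<bar>a\<bar>) ^ n"
      using finite_order_cis_bound[OF n[OF \<kappa>]] by metis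
    have "cmod (local_fourier L (c, J) \<eta> u \<xi>) \<le> C * (1 + \<bar>\<xi>\<bar>) ^ n" for \<xi>
      using C[of "- \<xi>"] by (simp add: local_fourier_def)
    then show ?thesis by (rule sobolev_integrable_of_poly_bound[OF local_fourier_measurable[OF u \<kappa>]])
  qed
  then have "u \<in> sobolev L \<Gamma> (- real (Suc n))" using u by (auto simp: sobolev_def)
  then show ?thesis ..
qed

lemma sobolevD:
  assumes "u \<in> sobolev L \<Gamma> s"
  shows "u \<in> distributions \<Gamma>" "\<And>c J \<eta>. (c, J) \<in> charts \<Gamma> \<Longrightarrow> \<eta> \<in> Cc_inf J \<Longrightarrow>
    integrable lborel (\<lambda>\<xi>. (1 + \<xi>\<^sup>2) powr s * (cmod (local_fourier L (c, J) \<eta> u \<xi>))\<^sup>2)"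
  using assms by (auto simp: sobolev_def)

text \<open>Regularity: in every chart the distribution is a smooth function by the representation theorem
  for functionals on the line, and the local pieces are glued by a partition of unity.\<close>

theorem sobolev_smooth:
  assumes u: "\<And>s. u \<in> sobolev L \<Gamma> s"
  shows "u \<in> dist_of L \<Gamma> ` Cinf \<Gamma>"
proof -
  have ud: "u \<in> distributions \<Gamma>" using sobolevD(1)[OF u] .
  obtain n where n: "\<And>c J \<eta>. (c, J) \<in> charts \<Gamma> \<Longrightarrow> \<eta> \<in> Cc_inf J \<Longrightarrow>
    finite_order n (\<lambda>\<psi>. pull L (c, J) u (\<lambda>t. \<eta> t * \<psi> t))"
    using distribution_finite_order[OF ud] by metis
  obtain P c J \<eta> where P: "finite (P :: (real^2) set)" "\<And>p. p \<in> P \<Longrightarrow> (c p, J p) \<in> charts \<Gamma>"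
    "\<And>p. p \<in> P \<Longrightarrow> \<eta> p \<in> Cc_inf (J p)" "\<And>x. x \<in> \<Gamma> \<Longrightarrow> (\<Sum>p\<in>P. push (c p, J p) (\<eta> p) x) = 1"
    by (rule partition_of_unity[OF compact manifold]) (rule that)
  have "\<exists>g. smooth_on UNIV g \<and> (\<forall>\<psi>\<in>Cc_inf UNIV. pull L (c p, J p) u (\<lambda>t. \<eta> p t * \<psi> t) = (LINT t|lborel. g t * \<psi> t))"
    if p: "p \<in> P" for p
  proof -
    have "all_moments (local_fourier L (c p, J p) (\<eta> p) u)"
      by (rule all_moments_sobolev[OF local_fourier_measurable[OF ud P(2,3)[OF p]] sobolevD(2)[OF u P(2,3)[OF p]]])
    from finite_order_representation[OF n[OF P(2,3)[OF p]] this[unfolded local_fourier_as_functional]]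
    show ?thesis by metis
  qed
  then obtain g where g: "\<And>p. p \<in> P \<Longrightarrow> smooth_on UNIV (g p)" "\<And>p \<psi>. p \<in> P \<Longrightarrow> \<psi> \<in> Cc_inf UNIV \<Longrightarrow>
      pull L (c p, J p) u (\<lambda>t. \<eta> p t * \<psi> t) = (LINT t|lborel. g p t * \<psi> t)" by metis
  have "\<exists>e. e \<in> Cc_inf (J p) \<and> (\<forall>t. \<eta> p t * e t = \<eta> p t)" if p: "p \<in> P" for p
  proof -
    obtain K where K: "compact K" "K \<subseteq> J p" "\<And>t. t \<notin> K \<Longrightarrow> \<eta> p t = 0" using Cc_infE[OF P(3)[OF p]] by metis
    obtain e :: "real \<Rightarrow> real" where e: "(\<lambda>t. complex_of_real (e t)) \<in> Cc_inf (J p)" "\<And>t. t \<in> K \<Longrightarrow> e t = 1"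
      using Cc_inf_cutoff[OF chartsD(1)[OF P(2)[OF p]] K(1,2)] by metis
    have "\<eta> p t * complex_of_real (e t) = \<eta> p t" for t using K(3)[of t] e(2)[of t] by (cases "t \<in> K") auto
    then show ?thesis using e(1) by (intro exI[of _ "\<lambda>t. complex_of_real (e t)"]) simp
  qed
  then obtain e where e: "\<And>p. p \<in> P \<Longrightarrow> e p \<in> Cc_inf (J p)" "\<And>p t. p \<in> P \<Longrightarrow> \<eta> p t * e p t = \<eta> p t" by metis
  define a where "a p t = e p t * g p t" for p t
  have a: "a p \<in> Cc_inf (J p)" if "p \<in> P" for p
    unfolding a_def[abs_def]
    by (intro Cc_inf_mult e that chartsD(1)[OF P(2)] smooth_on_subset[OF g(1)]) simp
  define f where "f x = (\<Sum>p\<in>P. push (c p, J p) (a p) x)" for x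
  have f: "f \<in> Cinf \<Gamma>" unfolding f_def[abs_def] by (intro Cinf_sum push_Cinf P a)
  have "dist_of L \<Gamma> f = u"
  proof (rule dist_of_eqI[OF ud])
    fix c' J' \<psi> assume \<kappa>: "(c', J') \<in> charts \<Gamma>" "\<psi> \<in> Cc_inf J'"
    define h where "h = push (c', J') (\<lambda>t. \<psi> t / speed L (c', J') t)"
    have h: "h \<in> Cinf \<Gamma>" unfolding h_def by (intro push_Cinf Cc_inf_div_speed \<kappa>)
    have piece: "u (push (c p, J p) (\<lambda>t. \<eta> p t * h (c p t))) =
        (LINT t|lborel. a p t * h (c p t) * speed L (c p, J p) t)" if p: "p \<in> P" for p
    proof -
      define \<theta> where "\<theta> t = e p t * h (c p t) * speed L (c p, J p) t" for t
      have "\<theta> \<in> Cc_inf (J p)"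
        unfolding \<theta>_def[abs_def] by (intro Cc_inf_mult_speed Cc_inf_mult_Cinf P e p h)
      then have \<theta>: "\<theta> \<in> Cc_inf UNIV" by (rule Cc_inf_mono) simp
      have eq: "(\<lambda>t. \<eta> p t * h (c p t) * speed L (c p, J p) t) = (\<lambda>t. \<eta> p t * \<theta> t)"
      proof
        fix t
        have "\<eta> p t * \<theta> t = (\<eta> p t * e p t) * h (c p t) * speed L (c p, J p) t" by (simp add: \<theta>_def)
        then show "\<eta> p t * h (c p t) * speed L (c p, J p) t = \<eta> p t * \<theta> t" unfolding e(2)[OF p] ..
      qed
      have "u (push (c p, J p) (\<lambda>t. \<eta> p t * h (c p t))) = pull L (c p, J p) u (\<lambda>t. \<eta> p t * \<theta> t)"
        unfolding apply_push[OF P(2)[OF p]] eq ..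
      also have "\<dots> = (LINT t|lborel. g p t * \<theta> t)" by (rule g(2)[OF p \<theta>])
      finally show ?thesis by (simp add: \<theta>_def a_def mult_ac)
    qed
    have "pull L (c', J') u \<psi> = u h" by (simp add: pull_def h_def)
    also have "\<dots> = u (\<lambda>x. \<Sum>p\<in>P. push (c p, J p) (\<lambda>t. \<eta> p t * h (c p t)) x)"
      by (rule arg_cong[OF partition_decompose[OF h P(2,4)]])
    also have "\<dots> = (\<Sum>p\<in>P. u (push (c p, J p) (\<lambda>t. \<eta> p t * h (c p t))))"
      by (intro distribution_sum[OF ud] push_Cinf Cc_inf_mult_Cinf P h)
    also have "\<dots> = (\<Sum>p\<in>P. LINT t|lborel. a p t * h (c p t) * speed L (c p, J p) t)"
      by (simp add: piece)
    also have "\<dots> = (LINT t|lborel. f (c' t) * \<psi> t)"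
      unfolding h_def f_def by (rule sum_chart_change[OF \<kappa> P(2) a])
    finally show "pull L (c', J') u \<psi> = (LINT t|lborel. f (c' t) * \<psi> t)" .
  qed
  then show ?thesis using f by blast
qed

end

text \<open>Four derivatives in \<open>L\<^sup>1\<close> bound \<open>(1 + \<xi>\<^sup>2)\<^sup>2\<close> times the Fourier transform. In the square of this
  estimate a factor \<open>(1 + \<xi>\<^sup>2)\<^sup>3\<close> can be spent on the Sobolev weight, and an integrable factor is left.\<close>

lemma fourier_sobolev_bound:
  assumes \<psi>: "\<psi> \<in> Cc_inf J" and s: "s \<le> 3"
    and M: "\<And>j. j \<le> 4 \<Longrightarrow> (LINT t|lborel. cmod ((vderiv ^^ j) \<psi> t)) \<le> M"
  shows "integrable lborel (\<lambda>\<xi>. (1 + \<xi>\<^sup>2) powr s * (cmod (fourier \<psi> \<xi>))\<^sup>2)"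
    and "sqrt (LINT \<xi>|lborel. (1 + \<xi>\<^sup>2) powr s * (cmod (fourier \<psi> \<xi>))\<^sup>2)
      \<le> 4 * M * sqrt (LINT \<xi>|lborel. inverse (1 + \<xi>\<^sup>2))"
proof -
  have "0 \<le> (LINT t|lborel. cmod ((vderiv ^^ 0) \<psi> t))" by simp
  then have M0: "0 \<le> M" using M[of 0] by linarith
  have pow: "\<bar>\<xi>\<bar> ^ j * cmod (fourier \<psi> \<xi>) \<le> M" if "j \<le> 4" for \<xi> j
    using fourier_le[of "(vderiv ^^ j) \<psi>" \<xi>] M[OF that]
    by (simp add: fourier_vderiv_pow[OF \<psi>] norm_mult norm_power)
  have le: "(1 + \<xi>\<^sup>2) powr s * (cmod (fourier \<psi> \<xi>))\<^sup>2 \<le> (4 * M)\<^sup>2 * inverse (1 + \<xi>\<^sup>2)" for \<xi>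
  proof -
    define p F where "p = 1 + \<xi>\<^sup>2" and "F = cmod (fourier \<psi> \<xi>)"
    have p: "1 \<le> p" by (simp add: p_def)
    have F: "0 \<le> F" by (simp add: F_def)
    have "p\<^sup>2 * F = \<bar>\<xi>\<bar> ^ 0 * F + 2 * (\<bar>\<xi>\<bar> ^ 2 * F) + \<bar>\<xi>\<bar> ^ 4 * F"
      by (simp add: p_def power2_eq_square power4_eq_xxxx algebra_simps)
    also have "\<dots> \<le> 4 * M" using pow[of 0 \<xi>] pow[of 2 \<xi>] pow[of 4 \<xi>] by (simp add: F_def)
    finally have "(p\<^sup>2 * F)\<^sup>2 \<le> (4 * M)\<^sup>2" using F by (intro power_mono) auto
    then have "p ^ 3 * F\<^sup>2 * p \<le> (4 * M)\<^sup>2" by (simp add: power_mult_distrib algebra_simps power2_eq_square power3_eq_cube)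
    then have "p ^ 3 * F\<^sup>2 \<le> (4 * M)\<^sup>2 * inverse p" using p by (simp add: field_simps)
    moreover have "p powr s \<le> p ^ 3"
      using powr_mono[OF s p] powr_realpow[of p 3] p by simp
    ultimately have "p powr s * F\<^sup>2 \<le> (4 * M)\<^sup>2 * inverse p"
      by (meson mult_right_mono order_trans zero_le_power2)
    then show ?thesis by (simp add: p_def F_def)
  qed
  have int: "integrable lborel (\<lambda>\<xi>::real. (4 * M)\<^sup>2 * inverse (1 + \<xi>\<^sup>2))"
    by (intro integrable_mult_right integrable_inverse_square)
  have [measurable]: "fourier \<psi> \<in> borel_measurable borel"
    using fourier_continuous[OF \<psi>] by (rule borel_measurable_continuous_onI)
  show int': "integrable lborel (\<lambda>\<xi>. (1 + \<xi>\<^sup>2) powr s * (cmod (fourier \<psi> \<xi>))\<^sup>2)"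
  proof (rule Bochner_Integration.integrable_bound[OF int])
    show "AE \<xi> in lborel. norm ((1 + \<xi>\<^sup>2) powr s * (cmod (fourier \<psi> \<xi>))\<^sup>2) \<le> norm ((4 * M)\<^sup>2 * inverse (1 + \<xi>\<^sup>2))"
      by (intro AE_I2) (use le in \<open>simp add: abs_of_nonneg add_nonneg_nonneg\<close>)
  qed measurable
  have "(LINT \<xi>|lborel. (1 + \<xi>\<^sup>2) powr s * (cmod (fourier \<psi> \<xi>))\<^sup>2) \<le> (LINT \<xi>|lborel. (4 * M)\<^sup>2 * inverse (1 + \<xi>\<^sup>2))"
    by (rule integral_mono[OF int' int le])
  also have "\<dots> = (4 * M)\<^sup>2 * (LINT \<xi>|lborel. inverse (1 + \<xi>\<^sup>2))" by simp
  finally have "sqrt (LINT \<xi>|lborel. (1 + \<xi>\<^sup>2) powr s * (cmod (fourier \<psi> \<xi>))\<^sup>2)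
      \<le> sqrt ((4 * M)\<^sup>2 * (LINT \<xi>|lborel. inverse (1 + \<xi>\<^sup>2)))" by (rule real_sqrt_le_mono)
  then show "sqrt (LINT \<xi>|lborel. (1 + \<xi>\<^sup>2) powr s * (cmod (fourier \<psi> \<xi>))\<^sup>2)
      \<le> 4 * M * sqrt (LINT \<xi>|lborel. inverse (1 + \<xi>\<^sup>2))"
    using M0 by (simp add: real_sqrt_mult)
qed

context curve
begin

text \<open>On a compact curve the \<open>C\<^sup>4\<close> norm dominates the Sobolev norms of order at most \<open>3\<close>.\<close>

lemma dist_of_sobolev_bound:
  assumes \<kappa>: "(c, J) \<in> charts \<Gamma>" and \<eta>: "\<eta> \<in> Cc_inf J" and s: "s \<le> 3"
  obtains K C where "compact K" "K \<subseteq> J" "0 \<le> C"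
    "\<And>f B. f \<in> Cinf \<Gamma> \<Longrightarrow> 0 \<le> B \<Longrightarrow> (\<And>j t. j \<le> 4 \<Longrightarrow> t \<in> K \<Longrightarrow> cmod ((vderiv ^^ j) (\<lambda>t. f (c t)) t) \<le> B) \<Longrightarrow>
      sobolev_seminorm L s (c, J) \<eta> (dist_of L \<Gamma> f) \<le> C * B"
proof -
  obtain K where K: "compact K" "K \<subseteq> J" "\<And>t. t \<notin> K \<Longrightarrow> \<eta> t = 0" using Cc_infE[OF \<eta>] by metis
  have J: "open J" by (rule chartsD[OF \<kappa>])
  \<comment> \<open>The interval \<open>[-R, R]\<close> of length \<open>2 R\<close> turns bounds for derivatives into bounds for their integrals.\<close>
  obtain R where R: "0 < R" "\<And>t. t \<in> K \<Longrightarrow> \<bar>t\<bar> \<le> R"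
    using compact_imp_bounded[OF K(1)] unfolding bounded_pos by auto
  have \<eta>J: "smooth_on J \<eta>" using smooth_on_subset[OF Cc_infD(1)[OF \<eta>]] by simp
  obtain M where M: "0 \<le> M" "\<And>(\<psi> :: real \<Rightarrow> complex) B j t. smooth_on J \<psi> \<Longrightarrow> 0 \<le> B \<Longrightarrow>
      (\<And>i t. i \<le> 4 \<Longrightarrow> t \<in> K \<Longrightarrow> cmod ((vderiv ^^ i) \<psi> t) \<le> B) \<Longrightarrow> j \<le> 4 \<Longrightarrow> t \<in> K \<Longrightarrow>
      cmod ((vderiv ^^ j) (\<lambda>t. \<eta> t * \<psi> t) t) \<le> M * B"
    by (rule product_compose_bound_uniform[OF J smooth_on_ident[OF J] J _ K(1,2) _ \<eta>J, of K 4]) (simp, simp, blast)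
  define I where "I = (LINT \<xi>|lborel. inverse (1 + \<xi>\<^sup>2) :: real)"
  show ?thesis
  proof (rule that[OF K(1,2), of "4 * (2 * R * M) * sqrt I"])
    have "0 \<le> I" unfolding I_def by simp
    then show "0 \<le> 4 * (2 * R * M) * sqrt I" using M(1) R(1) by simp
    fix f B assume f: "f \<in> Cinf \<Gamma>" and B: "0 \<le> B"
      and le: "\<And>j t. j \<le> 4 \<Longrightarrow> t \<in> K \<Longrightarrow> cmod ((vderiv ^^ j) (\<lambda>t. f (c t)) t) \<le> B"
    let ?\<psi> = "\<lambda>t. \<eta> t * f (c t)"
    have \<psi>: "?\<psi> \<in> Cc_inf J" by (rule Cc_inf_mult_Cinf[OF \<kappa> \<eta> f])
    have "(LINT t|lborel. cmod ((vderiv ^^ j) ?\<psi> t)) \<le> 2 * R * M * B" if j: "j \<le> 4" for j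
    proof -
      have bound: "cmod ((vderiv ^^ j) ?\<psi> t) \<le> M * B * indicator {-R..R} t" for t
      proof (cases "t \<in> K")
        case True
        then show ?thesis using M(2)[OF CinfD(1)[OF f \<kappa>] B le j True] R(2)[OF True]
          by (auto simp: indicator_def abs_le_iff)
      next
        case False
        have "(vderiv ^^ j) ?\<psi> t = (vderiv ^^ j) (\<lambda>_. 0) t"
          by (rule vderiv_pow_cong[of "- K"]) (use K False in \<open>auto simp: compact_imp_closed\<close>)
        also have "\<dots> = 0" using vderiv_pow_sequence[of UNIV "\<lambda>_ _. 0 :: complex" t j] by simp
        finally show ?thesis using M(1) B by simp
      qed
      have ind: "integrable lborel (indicator {-R..R} :: real \<Rightarrow> real)"
        by (rule integrable_real_indicator) (use R(1) in auto)
      have "(LINT t|lborel. cmod ((vderiv ^^ j) ?\<psi> t)) \<le> (LINT t|lborel. M * B * indicator {-R..R} t)"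
        by (rule integral_mono[OF integrable_norm[OF Cc_inf_integrable[OF Cc_inf_vderiv_pow[OF \<psi>]]]
            integrable_mult_right[OF ind] bound])
      also have "\<dots> = 2 * R * M * B" using R(1) by simp
      finally show ?thesis .
    qed
    from fourier_sobolev_bound(2)[OF \<psi> s this]
    show "sobolev_seminorm L s (c, J) \<eta> (dist_of L \<Gamma> f) \<le> 4 * (2 * R * M) * sqrt I * B"
      by (simp add: sobolev_seminorm_def local_fourier_dist_of[OF f \<kappa> \<eta>] I_def mult_ac)
  qed
qed

lemma dist_of_sobolev:
  assumes f: "f \<in> Cinf \<Gamma>" and s: "s \<le> 3"
  shows "dist_of L \<Gamma> f \<in> sobolev L \<Gamma> s"
proof -
  have "integrable lborel (\<lambda>\<xi>. (1 + \<xi>\<^sup>2) powr s * (cmod (local_fourier L (c, J) \<eta> (dist_of L \<Gamma> f) \<xi>))\<^sup>2)"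
    if \<kappa>: "(c, J) \<in> charts \<Gamma>" and \<eta>: "\<eta> \<in> Cc_inf J" for c J \<eta>
  proof -
    let ?I = "\<lambda>j. LINT t|lborel. cmod ((vderiv ^^ j) (\<lambda>t. \<eta> t * f (c t)) t)"
    have "?I j \<le> (\<Sum>j\<le>4. ?I j)" if "j \<le> 4" for j
      using that by (intro member_le_sum[of j "{..4}" ?I]) auto
    from fourier_sobolev_bound(1)[OF Cc_inf_mult_Cinf[OF \<kappa> \<eta> f] s this] show ?thesis
      by (simp add: local_fourier_dist_of[OF f \<kappa> \<eta>])
  qed
  then show ?thesis using dist_of_distribution[OF f] by (auto simp: sobolev_def)
qed

text \<open>The Sobolev embedding of \<open>H\<^sup>1\<close> into the bounded functions, by Fourier inversion.\<close>

lemma sup_le_sobolev_seminorm: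
  assumes \<kappa>: "(c, J) \<in> charts \<Gamma>" and \<eta>: "\<eta> \<in> Cc_inf J" and f: "f \<in> Cinf \<Gamma>"
    and N: "sobolev_seminorm L 1 (c, J) \<eta> (dist_of L \<Gamma> f) \<le> N" "0 < N"
  shows "cmod (\<eta> t * f (c t)) \<le> (1 + (LINT \<xi>|lborel. inverse (1 + \<xi>\<^sup>2))) * N"
proof -
  let ?\<psi> = "\<lambda>t. \<eta> t * f (c t)"
  have \<psi>: "?\<psi> \<in> Cc_inf J" by (rule Cc_inf_mult_Cinf[OF \<kappa> \<eta> f])
  have pow1: "(1 + \<xi>\<^sup>2) powr 1 = 1 + \<xi>\<^sup>2" for \<xi> :: real by (simp add: add_nonneg_nonneg)
  have "dist_of L \<Gamma> f \<in> sobolev L \<Gamma> 1" by (rule dist_of_sobolev[OF f]) simp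
  from sobolevD(2)[OF this \<kappa> \<eta>]
  have int: "integrable lborel (\<lambda>\<xi>. (1 + \<xi>\<^sup>2) * (cmod (fourier ?\<psi> \<xi>))\<^sup>2)"
    by (simp add: local_fourier_dist_of[OF f \<kappa> \<eta>] pow1)
  have "fourier ?\<psi> \<in> borel_measurable borel"
    using fourier_continuous[OF \<psi>] by (rule borel_measurable_continuous_onI)
  moreover have "sqrt (LINT \<xi>|lborel. (1 + \<xi>\<^sup>2) * (cmod (fourier ?\<psi> \<xi>))\<^sup>2) \<le> N"
    using N(1) by (simp add: sobolev_seminorm_def local_fourier_dist_of[OF f \<kappa> \<eta>] pow1)
  ultimately have L1: "(LINT \<xi>|lborel. cmod (fourier ?\<psi> \<xi>)) \<le> (1 + (LINT \<xi>|lborel. inverse (1 + \<xi>\<^sup>2))) * N"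
    by (rule L1_le_H1[OF _ int _ N(2)])
  have "2 * pi * cmod (?\<psi> t) = cmod (moment_transform (fourier ?\<psi>) 0 t)"
    unfolding fourier_inversion[OF \<psi>] norm_mult by simp
  also have "\<dots> \<le> (LINT \<xi>|lborel. cmod (fourier ?\<psi> \<xi>))"
    unfolding moment_transform_def
    using integral_norm_bound[of lborel "\<lambda>\<xi>. (\<i> * \<xi>) ^ 0 * fourier ?\<psi> \<xi> * cis (\<xi> * t)"] by (simp add: norm_mult)
  finally have "2 * pi * cmod (?\<psi> t) \<le> (1 + (LINT \<xi>|lborel. inverse (1 + \<xi>\<^sup>2))) * N" using L1 by simp
  moreover have "1 * cmod (?\<psi> t) \<le> 2 * pi * cmod (?\<psi> t)"
    using pi_gt3 by (intro mult_right_mono) auto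
  ultimately show ?thesis by simp
qed

section \<open>The adjoint of a smoothness preserving operator\<close>

context
  fixes T :: "dist \<Rightarrow> dist"
  assumes T_smooth: "\<And>f. f \<in> Cinf \<Gamma> \<Longrightarrow> T (dist_of L \<Gamma> f) \<in> dist_of L \<Gamma> ` Cinf \<Gamma>"
begin

lemma smooth_action_works:
  assumes "f \<in> Cinf \<Gamma>"
  shows "smooth_action L \<Gamma> \<Gamma> T f \<in> Cinf \<Gamma>" "dist_of L \<Gamma> (smooth_action L \<Gamma> \<Gamma> T f) = T (dist_of L \<Gamma> f)"
proof -
  obtain g where "g \<in> Cinf \<Gamma>" "dist_of L \<Gamma> g = T (dist_of L \<Gamma> f)" using T_smooth[OF assms] by force
  then have "\<exists>!g. g \<in> Cinf \<Gamma> \<and> dist_of L \<Gamma> g = T (dist_of L \<Gamma> f)"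
    using dist_of_inj by (intro ex1I[of _ g]) auto
  from theI'[OF this] show "smooth_action L \<Gamma> \<Gamma> T f \<in> Cinf \<Gamma>"
    "dist_of L \<Gamma> (smooth_action L \<Gamma> \<Gamma> T f) = T (dist_of L \<Gamma> f)"
    unfolding smooth_action_def by auto
qed

lemma smooth_action_add:
  assumes T: "bounded_op L \<Gamma> s \<Gamma> r T" "s \<le> 3" and f: "f \<in> Cinf \<Gamma>" and g: "g \<in> Cinf \<Gamma>"
  shows "smooth_action L \<Gamma> \<Gamma> T (\<lambda>x. f x + g x) = (\<lambda>x. smooth_action L \<Gamma> \<Gamma> T f x + smooth_action L \<Gamma> \<Gamma> T g x)"
proof (rule dist_of_inj)
  have "T (\<lambda>h. dist_of L \<Gamma> f h + dist_of L \<Gamma> g h) = (\<lambda>h. T (dist_of L \<Gamma> f) h + T (dist_of L \<Gamma> g) h)"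
    using T(1) dist_of_sobolev[OF f T(2)] dist_of_sobolev[OF g T(2)] unfolding bounded_op_def by simp
  then show "dist_of L \<Gamma> (smooth_action L \<Gamma> \<Gamma> T (\<lambda>x. f x + g x)) =
      dist_of L \<Gamma> (\<lambda>x. smooth_action L \<Gamma> \<Gamma> T f x + smooth_action L \<Gamma> \<Gamma> T g x)"
    using f g by (simp add: smooth_action_works Cinf_add dist_of_add)
qed (simp_all add: smooth_action_works Cinf_add f g)

lemma smooth_action_scale:
  assumes T: "bounded_op L \<Gamma> s \<Gamma> r T" "s \<le> 3" and f: "f \<in> Cinf \<Gamma>"
  shows "smooth_action L \<Gamma> \<Gamma> T (\<lambda>x. k * f x) = (\<lambda>x. k * smooth_action L \<Gamma> \<Gamma> T f x)"
proof (rule dist_of_inj)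
  have "T (\<lambda>h. k * dist_of L \<Gamma> f h) = (\<lambda>h. k * T (dist_of L \<Gamma> f) h)"
    using T(1) dist_of_sobolev[OF f T(2)] unfolding bounded_op_def by simp
  then show "dist_of L \<Gamma> (smooth_action L \<Gamma> \<Gamma> T (\<lambda>x. k * f x)) =
      dist_of L \<Gamma> (\<lambda>x. k * smooth_action L \<Gamma> \<Gamma> T f x)"
    using f by (simp add: smooth_action_works Cinf_scale dist_of_scale)
qed (simp_all add: smooth_action_works Cinf_scale f)

text \<open>Continuity of the action on smooth functions, from \<open>C\<^sup>4\<close> to \<open>C\<^sup>0\<close>, by composition of the embedding
  of \<open>C\<^sup>4\<close> into \<open>H\<^sup>s\<close>, the operator, and the embedding of \<open>H\<^sup>1\<close> into \<open>C\<^sup>0\<close>.\<close>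

lemma smooth_action_sup_bound:
  assumes T: "bounded_op L \<Gamma> s \<Gamma> 1 T" "s \<le> 3"
    and \<kappa>: "(c, J) \<in> charts \<Gamma>" and K: "compact K" "K \<subseteq> J"
  shows "\<exists>S C. \<forall>t\<in>K. seminorm_bound \<Gamma> S 4 C (\<lambda>f. smooth_action L \<Gamma> \<Gamma> T f (c t))"
proof -
  obtain e :: "real \<Rightarrow> real" where e: "(\<lambda>t. complex_of_real (e t)) \<in> Cc_inf J" "\<And>t. t \<in> K \<Longrightarrow> e t = 1"
    using Cc_inf_cutoff[OF chartsD(1)[OF \<kappa>] K] by metis
  have "\<exists>S0 C0. finite S0 \<and> (\<forall>((c', J'), \<eta>')\<in>S0. (c', J') \<in> charts \<Gamma> \<and> \<eta>' \<in> Cc_inf J') \<and>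
      (\<forall>u\<in>sobolev L \<Gamma> s. sobolev_seminorm L 1 (c, J) (\<lambda>t. complex_of_real (e t)) (T u)
        \<le> C0 * (\<Sum>(\<kappa>', \<eta>')\<in>S0. sobolev_seminorm L s \<kappa>' \<eta>' u))"
    using T(1) \<kappa> e(1) unfolding bounded_op_def by fast
  then obtain S0 C0 where S0: "finite S0" "\<forall>((c', J'), \<eta>')\<in>S0. (c', J') \<in> charts \<Gamma> \<and> \<eta>' \<in> Cc_inf J'"
    "\<forall>u\<in>sobolev L \<Gamma> s. sobolev_seminorm L 1 (c, J) (\<lambda>t. complex_of_real (e t)) (T u)
        \<le> C0 * (\<Sum>(\<kappa>', \<eta>')\<in>S0. sobolev_seminorm L s \<kappa>' \<eta>' u)"
    by (elim exE conjE)
  define good where "good q K' A \<longleftrightarrow> compact K' \<and> K' \<subseteq> snd (fst q) \<and> 0 \<le> A \<and>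
      (\<forall>f B. f \<in> Cinf \<Gamma> \<longrightarrow> 0 \<le> B \<longrightarrow> (\<forall>j t. j \<le> 4 \<longrightarrow> t \<in> K' \<longrightarrow> cmod ((vderiv ^^ j) (\<lambda>t. f (fst (fst q) t)) t) \<le> B) \<longrightarrow>
        sobolev_seminorm L s (fst q) (snd q) (dist_of L \<Gamma> f) \<le> A * B)" for q :: "chart \<times> (real \<Rightarrow> complex)" and K' and A :: real
  have "\<exists>K' A. good q K' A" if "q \<in> S0" for q
  proof -
    obtain c' J' \<eta>' where q: "q = ((c', J'), \<eta>')" by (metis surj_pair)
    have \<kappa>': "(c', J') \<in> charts \<Gamma>" "\<eta>' \<in> Cc_inf J'" using bspec[OF S0(2) that] by (auto simp: q)
    show ?thesis
    proof (rule dist_of_sobolev_bound[OF \<kappa>' T(2)])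
      fix K' C
      assume *: "compact K'" "K' \<subseteq> J'" "0 \<le> C" "\<And>f B. f \<in> Cinf \<Gamma> \<Longrightarrow> 0 \<le> B \<Longrightarrow>
        (\<And>j t. j \<le> 4 \<Longrightarrow> t \<in> K' \<Longrightarrow> cmod ((vderiv ^^ j) (\<lambda>t. f (c' t)) t) \<le> B) \<Longrightarrow>
        sobolev_seminorm L s (c', J') \<eta>' (dist_of L \<Gamma> f) \<le> C * B"
      then have "good q K' C" unfolding good_def q by simp
      then show ?thesis by blast
    qed
  qed
  then obtain K' A where good: "\<And>q. q \<in> S0 \<Longrightarrow> good q (K' q) (A q)" by metis
  define S where "S = (\<lambda>q. (fst q, K' q)) ` S0"
  define D where "D = \<bar>C0\<bar> * (\<Sum>q\<in>S0. A q)"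
  define E where "E = (1 + (LINT \<xi>|lborel. inverse (1 + \<xi>\<^sup>2) :: real))"
  have A: "0 \<le> A q" if "q \<in> S0" for q using good[OF that] by (simp add: good_def)
  then have D: "0 \<le> D" by (auto simp: D_def intro!: mult_nonneg_nonneg sum_nonneg)
  have E: "0 \<le> E" by (auto simp: E_def intro!: add_nonneg_nonneg)
  \<comment> \<open>With \<open>D + 1\<close> in place of \<open>D\<close> the bound for the \<open>H\<^sup>1\<close> norm is positive, as the embedding requires;
    the case \<open>B = 0\<close> is recovered below as a limit.\<close>
  have bound: "cmod (smooth_action L \<Gamma> \<Gamma> T f (c t)) \<le> E * (D + 1) * B"
    if t: "t \<in> K" and f: "f \<in> Cinf \<Gamma>" and B: "0 < B"
      and le: "\<And>c J K j t. ((c, J), K) \<in> S \<Longrightarrow> j \<le> 4 \<Longrightarrow> t \<in> K \<Longrightarrow> cmod ((vderiv ^^ j) (\<lambda>s. f (c s)) t) \<le> B" for t f B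
  proof -
    have q_le: "sobolev_seminorm L s (fst q) (snd q) (dist_of L \<Gamma> f) \<le> A q * B" if q: "q \<in> S0" for q
    proof -
      have "((fst (fst q), snd (fst q)), K' q) \<in> S" using q by (auto simp: S_def)
      then have "cmod ((vderiv ^^ j) (\<lambda>t. f (fst (fst q) t)) t) \<le> B" if "j \<le> 4" "t \<in> K' q" for j t
        using le that by blast
      then show ?thesis using good[OF q] f B unfolding good_def by simp
    qed
    have "sobolev_seminorm L 1 (c, J) (\<lambda>t. complex_of_real (e t)) (T (dist_of L \<Gamma> f))
        \<le> C0 * (\<Sum>(\<kappa>', \<eta>')\<in>S0. sobolev_seminorm L s \<kappa>' \<eta>' (dist_of L \<Gamma> f))"
      using S0(3) dist_of_sobolev[OF f T(2)] by blast
    also have "\<dots> \<le> \<bar>C0\<bar> * (\<Sum>(\<kappa>', \<eta>')\<in>S0. sobolev_seminorm L s \<kappa>' \<eta>' (dist_of L \<Gamma> f))"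
      by (intro mult_right_mono sum_nonneg) (auto simp: sobolev_seminorm_def)
    also have "\<dots> \<le> \<bar>C0\<bar> * (\<Sum>q\<in>S0. A q * B)"
      using q_le by (intro mult_left_mono sum_mono) (auto simp: case_prod_unfold)
    also have "\<dots> \<le> (D + 1) * B" using B by (simp add: D_def sum_distrib_right distrib_right mult.assoc)
    finally have "sobolev_seminorm L 1 (c, J) (\<lambda>t. complex_of_real (e t)) (dist_of L \<Gamma> (smooth_action L \<Gamma> \<Gamma> T f)) \<le> (D + 1) * B"
      by (simp add: smooth_action_works f)
    from sup_le_sobolev_seminorm[OF \<kappa> e(1) smooth_action_works(1)[OF f] this, of t] show ?thesis
      using B D e(2)[OF t] by (simp add: E_def mult.assoc)
  qed
  have "seminorm_bound \<Gamma> S 4 (E * (D + 1)) (\<lambda>f. smooth_action L \<Gamma> \<Gamma> T f (c t))" if t: "t \<in> K" for t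
  proof (rule seminorm_boundI)
    show "finite S" using S0(1) by (simp add: S_def)
    show "0 \<le> E * (D + 1)" using D E by simp
    show "(c', J') \<in> charts \<Gamma> \<and> compact K1 \<and> K1 \<subseteq> J'" if S: "((c', J'), K1) \<in> S" for c' J' K1
    proof -
      obtain \<eta>' where q: "((c', J'), \<eta>') \<in> S0" "K1 = K' ((c', J'), \<eta>')" using S by (auto simp: S_def)
      show ?thesis using bspec[OF S0(2) q(1)] good[OF q(1)] by (auto simp: good_def q(2))
    qed
    fix f B assume f: "f \<in> Cinf \<Gamma>" and B: "0 \<le> B"
      and le: "\<And>c J K j t. ((c, J), K) \<in> S \<Longrightarrow> j \<le> 4 \<Longrightarrow> t \<in> K \<Longrightarrow> cmod ((vderiv ^^ j) (\<lambda>s. f (c s)) t) \<le> B"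
    show "cmod (smooth_action L \<Gamma> \<Gamma> T f (c t)) \<le> E * (D + 1) * B"
    proof (rule field_le_epsilon)
      fix \<epsilon> :: real assume \<epsilon>: "0 < \<epsilon>"
      define \<delta> where "\<delta> = \<epsilon> / (E * (D + 1) + 1)"
      have pos: "0 < E * (D + 1) + 1" using D E by (simp add: add_nonneg_pos)
      have \<delta>: "0 < \<delta>" using \<epsilon> pos by (simp add: \<delta>_def)
      have "cmod (smooth_action L \<Gamma> \<Gamma> T f (c t)) \<le> E * (D + 1) * (B + \<delta>)"
      proof (rule bound[OF t f])
        show "0 < B + \<delta>" using B \<delta> by simp
        show "cmod ((vderiv ^^ j) (\<lambda>s. f (c s)) t) \<le> B + \<delta>" if "((c, J), K) \<in> S" "j \<le> 4" "t \<in> K" for c J K j t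
          using le[OF that] \<delta> by simp
      qed
      also have "\<dots> \<le> E * (D + 1) * B + (E * (D + 1) + 1) * \<delta>" using \<delta> by (simp add: algebra_simps)
      also have "(E * (D + 1) + 1) * \<delta> = \<epsilon>" using pos by (simp add: \<delta>_def)
      finally show "cmod (smooth_action L \<Gamma> \<Gamma> T f (c t)) \<le> E * (D + 1) * B + \<epsilon>" .
    qed
  qed
  then show ?thesis by blast
qed

text \<open>Up to complex conjugations, the adjoint applied to a distribution is the composition of the
  distribution with the action of \<open>T\<close> on smooth functions. The distribution of a smooth function has order zero, so the continuity of the action from \<open>C\<^sup>4\<close> to \<open>C\<^sup>0\<close> suffices.\<close>

lemma adjoint_of_smooth_distribution:
  assumes T: "bounded_op L \<Gamma> s \<Gamma> 1 T" "s \<le> 3" and g: "g \<in> Cinf \<Gamma>"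
  shows "adjoint_op L \<Gamma> \<Gamma> T (dist_of L \<Gamma> g) \<in> distributions \<Gamma>"
proof -
  define A where "A = smooth_action L \<Gamma> \<Gamma> T"
  define v where "v = dist_of L \<Gamma> g"
  define u where "u = adjoint_op L \<Gamma> \<Gamma> T v"
  have u_eq: "u h = v (\<lambda>y. cnj (A (\<lambda>x. cnj (h x)) y))" if "h \<in> Cinf \<Gamma>" for h
    using that by (simp add: u_def adjoint_op_def A_def)
  have k: "(\<lambda>y. cnj (A (\<lambda>x. cnj (h x)) y)) \<in> Cinf \<Gamma>" if "h \<in> Cinf \<Gamma>" for h
    unfolding A_def by (intro Cinf_cnj smooth_action_works that)
  have v: "v \<in> distributions \<Gamma>" unfolding v_def by (rule dist_of_distribution[OF g])
  obtain S C where "seminorm_bound \<Gamma> S 0 C v" unfolding v_def using dist_of_order_zero[OF g] by metis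
  note S = seminorm_boundD[OF this]
  \<comment> \<open>An empty set \<open>K\<close> imposes no condition, so the data obtained for it could be arbitrary.\<close>
  define S1 where "S1 = {q \<in> S. snd q \<noteq> {}}"
  have "\<exists>S' C'. \<forall>t\<in>snd q. seminorm_bound \<Gamma> S' 4 C' (\<lambda>f. A f (fst (fst q) t))" if q: "q \<in> S1" for q
  proof -
    obtain c J K where q_eq: "q = ((c, J), K)" by (metis surj_pair)
    have \<kappa>: "(c, J) \<in> charts \<Gamma>" "compact K" "K \<subseteq> J" using q S(3) by (auto simp: q_eq S1_def)
    show ?thesis using smooth_action_sup_bound[OF T \<kappa>] by (simp add: q_eq A_def)
  qed
  then obtain S' C' where sb: "\<And>q t. q \<in> S1 \<Longrightarrow> t \<in> snd q \<Longrightarrow> seminorm_bound \<Gamma> (S' q) 4 (C' q) (\<lambda>f. A f (fst (fst q) t))"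
    by metis
  have S': "finite (S' q)" "0 \<le> C' q" "\<And>c J K. ((c, J), K) \<in> S' q \<Longrightarrow> (c, J) \<in> charts \<Gamma> \<and> compact K \<and> K \<subseteq> J" if q: "q \<in> S1" for q
  proof -
    obtain t where "t \<in> snd q" using q by (auto simp: S1_def)
    note D = seminorm_boundD[OF sb[OF q this]]
    show "finite (S' q)" "0 \<le> C' q" "\<And>c J K. ((c, J), K) \<in> S' q \<Longrightarrow> (c, J) \<in> charts \<Gamma> \<and> compact K \<and> K \<subseteq> J"
      by (rule D(1) D(2) D(3), assumption?)+
  qed
  define N where "N = (\<Sum>q\<in>S1. C' q)"
  have fin: "finite S1" using S(1) by (simp add: S1_def)
  have N: "0 \<le> N" unfolding N_def using S'(2) by (intro sum_nonneg)
  have N_le: "C' q \<le> N" if "q \<in> S1" for q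
    unfolding N_def using S'(2) fin that by (intro member_le_sum) auto
  have "seminorm_bound \<Gamma> (\<Union>q\<in>S1. S' q) 4 (C * N) u"
  proof (rule seminorm_boundI)
    show "finite (\<Union>q\<in>S1. S' q)" using fin S'(1) by auto
    show "0 \<le> C * N" using S(2) N by simp
    show "(c, J) \<in> charts \<Gamma> \<and> compact K \<and> K \<subseteq> J" if "((c, J), K) \<in> (\<Union>q\<in>S1. S' q)" for c J K
      using that S'(3) by (elim UN_E)
    fix h B assume h: "h \<in> Cinf \<Gamma>" and B: "0 \<le> B"
      and le: "\<And>c J K j t. ((c, J), K) \<in> (\<Union>q\<in>S1. S' q) \<Longrightarrow> j \<le> 4 \<Longrightarrow> t \<in> K \<Longrightarrow>
        cmod ((vderiv ^^ j) (\<lambda>s. h (c s)) t) \<le> B"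
    have "cmod (v (\<lambda>y. cnj (A (\<lambda>x. cnj (h x)) y))) \<le> C * (N * B)"
    proof (rule S(4)[OF k[OF h]])
      show "0 \<le> N * B" using N B by simp
      fix c J K and j :: nat and t assume q: "((c, J), K) \<in> S" "j \<le> 0" "t \<in> K"
      define q where "q = ((c, J), K)"
      have q1: "q \<in> S1" using q by (auto simp: S1_def q_def)
      have "cmod (A (\<lambda>x. cnj (h x)) (fst (fst q) t)) \<le> C' q * B"
      proof (rule seminorm_boundD(4)[OF sb[OF q1] Cinf_cnj[OF h] B])
        show "t \<in> snd q" using q by (simp add: q_def)
        fix c J K and j :: nat and t assume *: "((c, J), K) \<in> S' q" "j \<le> 4" "t \<in> K"
        have \<kappa>: "(c, J) \<in> charts \<Gamma>" "t \<in> J" using S'(3)[OF q1 *(1)] *(3) by auto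
        have in_union: "((c, J), K) \<in> (\<Union>q\<in>S1. S' q)" using q1 *(1) by auto
        show "cmod ((vderiv ^^ j) (\<lambda>s. cnj (h (c s))) t) \<le> B"
          unfolding vderiv_pow_linear[OF CinfD(1)[OF h \<kappa>(1)] chartsD(1)[OF \<kappa>(1)] \<kappa>(2) bounded_linear_cnj] complex_mod_cnj
          by (rule le[OF in_union *(2,3)])
      qed
      also have "\<dots> \<le> N * B" using N_le[OF q1] B by (rule mult_right_mono)
      finally show "cmod ((vderiv ^^ j) (\<lambda>s. cnj (A (\<lambda>x. cnj (h x)) (c s))) t) \<le> N * B"
        using q(2) by (simp add: q_def)
    qed
    then show "cmod (u h) \<le> C * N * B" by (simp add: u_eq[OF h] mult.assoc)
  qed
  then have "u \<in> distributions \<Gamma>"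
  proof (rule distributionI[rotated 3])
    show "u (\<lambda>x. f x + h x) = u f + u h" if f: "f \<in> Cinf \<Gamma>" and h: "h \<in> Cinf \<Gamma>" for f h
      using smooth_action_add[OF T Cinf_cnj[OF f] Cinf_cnj[OF h]]
        distribution_add[OF v k[OF f] k[OF h]]
      by (simp add: u_eq f h Cinf_add A_def)
    show "u (\<lambda>x. z * f x) = z * u f" if f: "f \<in> Cinf \<Gamma>" for z f
      using smooth_action_scale[OF T Cinf_cnj[OF f], of "cnj z"] distribution_scale[OF v k[OF f]]
      by (simp add: u_eq f Cinf_scale A_def)
    show "u f = 0" if "f \<notin> Cinf \<Gamma>" for f using that by (simp add: u_def adjoint_op_def)
  qed
  then show ?thesis by (simp add: u_def v_def)
qed

end

end

section \<open>The boundary of the surface\<close>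

text \<open>The speed of a boundary curve in this line element is the speed of its image on the surface, which
  is regular because the tangent vectors of the surface are linearly independent.\<close>

lemma curve_surface_length:
  assumes "regular_surface \<Omega> \<phi>" "\<Gamma> \<subseteq> closure \<Omega>" "compact \<Gamma>" "smooth_curve_manifold \<Gamma>"
  shows "curve (surface_length \<phi>) \<Gamma>"
proof -
  obtain U where U: "open U" "closure \<Omega> \<subseteq> U" "smooth_on U \<phi>"
    using assms(1) by (auto simp: regular_surface_def smooth_upto_def)
  have der: "(\<phi> has_derivative frechet_derivative \<phi> (at x)) (at x)" if "x \<in> \<Gamma>" for x
    using smooth_on_differentiable[OF U(3)] U(2) assms(2) that by (auto simp: frechet_derivative_works[symmetric])
  have lin: "linear (frechet_derivative \<phi> (at x))" if "x \<in> \<Gamma>" for x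
    using has_derivative_linear[OF der[OF that]] .
  have nonzero: "frechet_derivative \<phi> (at x) w \<noteq> 0" if x: "x \<in> \<Gamma>" and w: "w \<noteq> 0" for x w
  proof
    have w_eq: "w = w $ 1 *\<^sub>R axis 1 1 + w $ 2 *\<^sub>R axis 2 1"
      by (simp add: vec_eq_iff forall_2 axis_def)
    assume "frechet_derivative \<phi> (at x) w = 0"
    then have "w $ 1 *\<^sub>R tangent \<phi> 1 x + w $ 2 *\<^sub>R tangent \<phi> 2 x = 0"
      by (subst (asm) w_eq) (simp add: linear_add[OF lin[OF x]] linear_cmul[OF lin[OF x]] tangent_def partial_def)
    then have "w $ 1 = 0" "w $ 2 = 0" using assms(1,2) x by (auto simp: regular_surface_def)
    then show False using w by (simp add: vec_eq_iff forall_2)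
  qed
  have velocity: "frechet_derivative \<phi> (at (c t)) (vderiv c t) = vderiv (\<lambda>t. \<phi> (c t)) t"
    if \<kappa>: "(c, J) \<in> charts \<Gamma>" and t: "t \<in> J" for c J t
  proof -
    have "c t \<in> \<Gamma>" using chartsD(7)[OF \<kappa>] t by auto
    then have "((\<phi> \<circ> c) has_vector_derivative frechet_derivative \<phi> (at (c t)) (vderiv c t)) (at t)"
      using vector_derivative_diff_chain_within[OF smooth_on_has_vderiv[OF chartsD(2)[OF \<kappa>] t]
          has_derivative_at_withinI[OF der]] by simp
    then show ?thesis by (simp add: vector_derivative_at o_def)
  qed
  have smooth: "smooth_on J (vderiv (\<lambda>t. \<phi> (c t)))" if \<kappa>: "(c, J) \<in> charts \<Gamma>" for c J
    using chartsD(7)[OF \<kappa>] U(2) assms(2)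
    by (intro smooth_on_vderiv smooth_on_compose[OF U(3)] chartsD[OF \<kappa>]) auto
  have speed: "speed (surface_length \<phi>) (c, J) t = norm (vderiv (\<lambda>t. \<phi> (c t)) t)"
    and velocity_nonzero: "vderiv (\<lambda>t. \<phi> (c t)) t \<noteq> 0"
    if \<kappa>: "(c, J) \<in> charts \<Gamma>" and t: "t \<in> J" for c J t
    using velocity[OF \<kappa> t] nonzero[OF _ chartsD(3)[OF \<kappa> t], of "c t"] chartsD(7)[OF \<kappa>] t
    by (auto simp: speed_def surface_length_def)
  show ?thesis
  proof (rule curve.intro)
    show "surface_length \<phi> x (k *\<^sub>R w) = \<bar>k\<bar> * surface_length \<phi> x w" if "x \<in> \<Gamma>" for x k w
      by (simp add: surface_length_def linear_cmul[OF lin[OF that]])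
    fix c J assume \<kappa>: "(c, J) \<in> charts \<Gamma>"
    have "smooth_on J (\<lambda>t. norm (vderiv (\<lambda>t. \<phi> (c t)) t))"
      by (rule smooth_on_norm[OF smooth[OF \<kappa>] chartsD(1)[OF \<kappa>] velocity_nonzero[OF \<kappa>]])
    then show "smooth_on J (speed (surface_length \<phi>) (c, J))"
      by (rule smooth_on_cong[OF _ chartsD(1)[OF \<kappa>]]) (simp add: speed[OF \<kappa>])
    show "0 < speed (surface_length \<phi>) (c, J) t" if "t \<in> J" for t
      using speed[OF \<kappa> that] velocity_nonzero[OF \<kappa> that] by simp
  qed (rule assms)+
qed

section \<open>Nonexistence of solutions\<close>

theorem proposition6p1:
  fixes \<Omega> \<Gamma>0 \<Gamma>1 :: "(real^2) set"
    and \<phi> :: "real^2 \<Rightarrow> real^3"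
    and \<theta> :: "real^2 \<Rightarrow> complex"
    and R0 P :: "dist \<Rightarrow> dist"
    and F :: dist
  assumes "open \<Omega>" and "bounded \<Omega>" and "connected \<Omega>" and "smooth_boundary \<Omega>"
    and "frontier \<Omega> = \<Gamma>0 \<union> \<Gamma>1" and "\<Gamma>0 \<inter> \<Gamma>1 = {}"
    and "compact \<Gamma>0" and "smooth_curve_manifold \<Gamma>0"
    and "compact \<Gamma>1" and "smooth_curve_manifold \<Gamma>1"
    and "regular_surface \<Omega> \<phi>" and "elliptic_surface \<Omega> \<phi>"
    and "R0_operator \<Omega> \<Gamma>0 \<Gamma>1 \<phi> R0"
    and "\<And>s r. bounded_op (surface_length \<phi>) \<Gamma>1 s \<Gamma>0 r R0"
    and "\<And>s r. bounded_op (surface_length \<phi>) \<Gamma>0 (- r) \<Gamma>1 (- s) (adjoint_op (surface_length \<phi>) \<Gamma>1 \<Gamma>0 R0)"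
    and "\<theta> \<in> Cinf \<Gamma>0" and "\<And>x. x \<in> \<Gamma>0 \<Longrightarrow> \<theta> x \<noteq> 0"
    and "elliptic_symbol \<Gamma>0 (1/2) (P_symbol \<theta>)"
    and "pseudo_diff_op (surface_length \<phi>) \<Gamma>0 (1/2) (P_symbol \<theta>) P"
    and "\<And>s. bounded_op (surface_length \<phi>) \<Gamma>0 s \<Gamma>0 (s - 1/2) P"
    and "\<And>s. bij_betw P (sobolev (surface_length \<phi>) \<Gamma>0 s) (sobolev (surface_length \<phi>) \<Gamma>0 (s - 1/2))"
    and "\<And>s. bounded_op (surface_length \<phi>) \<Gamma>0 (s - 1/2) \<Gamma>0 s (inv_into (sobolev (surface_length \<phi>) \<Gamma>0 s) P)"
    and "F \<in> sobolev (surface_length \<phi>) \<Gamma>1 (-3/2)"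
    and "F \<notin> dist_of (surface_length \<phi>) \<Gamma>1 ` Cinf \<Gamma>1"
  shows "\<not> (\<exists>u0 \<in> distributions \<Gamma>1. A_operator (surface_length \<phi>) \<Gamma>0 \<Gamma>1 R0 P u0 = F)"
proof
  define L where "L = surface_length \<phi>"
  assume "\<exists>u0\<in>distributions \<Gamma>1. A_operator (surface_length \<phi>) \<Gamma>0 \<Gamma>1 R0 P u0 = F"
  then obtain u0 where u0: "u0 \<in> distributions \<Gamma>1"
    and F: "adjoint_op L \<Gamma>1 \<Gamma>0 R0 (adjoint_op L \<Gamma>0 \<Gamma>0 P (P (R0 u0))) = F"
    by (auto simp: A_operator_def L_def)
  note R0 = assms(14)[folded L_def] and R0_adj = assms(15)[folded L_def]
    and P = assms(20)[folded L_def] and P_psdo = assms(19)[folded L_def]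
  have sub: "\<Gamma>0 \<subseteq> closure \<Omega>" "\<Gamma>1 \<subseteq> closure \<Omega>" using assms(5) by (auto simp: frontier_def)
  interpret \<Gamma>0: curve L \<Gamma>0
    unfolding L_def by (rule curve_surface_length[OF assms(11) sub(1) assms(7,8)])
  interpret \<Gamma>1: curve L \<Gamma>1
    unfolding L_def by (rule curve_surface_length[OF assms(11) sub(2) assms(9,10)])
  obtain s where "u0 \<in> sobolev L \<Gamma>1 s" using \<Gamma>1.distribution_in_sobolev[OF u0] by auto
  then have "R0 u0 \<in> sobolev L \<Gamma>0 r" for r using R0[of s r] by (simp add: bounded_op_def)
  then have "P (R0 u0) \<in> sobolev L \<Gamma>0 r" for r using P[of "r + 1/2"] by (simp add: bounded_op_def)
  then have "P (R0 u0) \<in> dist_of L \<Gamma>0 ` Cinf \<Gamma>0" by (rule \<Gamma>0.sobolev_smooth)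
  then obtain g where g: "g \<in> Cinf \<Gamma>0" "P (R0 u0) = dist_of L \<Gamma>0 g" by auto
  define v where "v = adjoint_op L \<Gamma>0 \<Gamma>0 P (P (R0 u0))"
  have "v \<in> distributions \<Gamma>0"
    unfolding v_def g(2)
  proof (rule \<Gamma>0.adjoint_of_smooth_distribution[OF _ _ _ g(1)])
    show "P (dist_of L \<Gamma>0 f) \<in> dist_of L \<Gamma>0 ` Cinf \<Gamma>0" if "f \<in> Cinf \<Gamma>0" for f
      using P_psdo that by (simp add: pseudo_diff_op_def)
    \<comment> \<open>Order \<open>3/2\<close>, because \<open>P\<close> loses \<open>1/2\<close> and the embedding into bounded functions needs \<open>1\<close>.\<close>
    show "bounded_op L \<Gamma>0 (3/2) \<Gamma>0 1 P" using P[of "3/2"] by simp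
  qed simp
  then obtain s where s: "v \<in> sobolev L \<Gamma>0 s" using \<Gamma>0.distribution_in_sobolev by blast
  have "adjoint_op L \<Gamma>1 \<Gamma>0 R0 v \<in> sobolev L \<Gamma>1 r" for r
    using R0_adj[of "- s" "- r"] s by (simp add: bounded_op_def)
  then have "F \<in> sobolev L \<Gamma>1 r" for r by (simp add: v_def F)
  then have "F \<in> dist_of L \<Gamma>1 ` Cinf \<Gamma>1" by (rule \<Gamma>1.sobolev_smooth)
  then show False using assms(24) by (simp add: L_def)
qed

end
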